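(* Suppose $V:\mathbb{R}^d\to\mathbb{R}^d$ satisfies $\|V\|_{L^p(\mathbb{R}^d)}<\infty$ for some $p\ge2$, and $1<m<1+\frac2p$. Let $u_1,u_2$ be two nonnegative weak solutions on $\mathbb{R}^d\times[0,T]$ of $u_t=\Delta u^m+\nabla\cdot(uV)$ with initial data $u_{1,0},u_{2,0}$ respectively. Assume in addition that $$\partial_t(u_1-u_2)\in L^1(\mathbb{R}^d\times[0,T]).$$ Then $$\int_{\mathbb{R}^d}(u_1-u_2)_+(x,t)\,dx\le\int_{\mathbb{R}^d}(u_{1,0}-u_{2,0})_+\,dx\qquad\text{for }0\le t\le T.$$
   Context: A weak solution with nonnegative initial data $u_0\in L^1(\mathbb{R}^d)\cap L^\infty(\mathbb{R}^d)$ is a nonnegative $u$ with $u\in C([0,T],L^1(\mathbb{R}^d))\cap L^\infty(\mathbb{R}^d\times[0,T])$, $uV\in L^2(\mathbb{R}^d\times[0,T])$, $u^m\in L^2(0,T;\dot H^1(\mathbb{R}^d))$, such that for all $\phi\in C_c^\infty(\mathbb{R}^d\times[0,T))$ $$\int_0^T\!\!\int u\,\phi_t\,dxdt=-\int u_0(x)\phi(x,0)\,dx+\int_0^T\!\!\int(\nabla u^m+uV)\cdot\nabla\phi\,dxdt .$$ Here $f_+=\max\{f,0\}$. *)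

theory Defs
  imports "HOL-Analysis.Analysis"
begin

fun Ck :: "nat \<Rightarrow> ('a::real_normed_vector \<Rightarrow> real) \<Rightarrow> bool" where
  "Ck 0 f \<longleftrightarrow> continuous_on UNIV f"
| "Ck (Suc k) f \<longleftrightarrow>
     (\<forall>x. f differentiable (at x)) \<and> (\<forall>v. Ck k (\<lambda>x. frechet_derivative f (at x) v))"

definition smooth :: "('a::real_normed_vector \<Rightarrow> real) \<Rightarrow> bool" where
  "smooth f \<longleftrightarrow> (\<forall>k. Ck k f)"

(* Functions are defined on the whole space.  With S = UNIV \<times> {..<T} this gives, after restriction
   to times t \<ge> 0, the space of smooth functions compactly supported in UNIV \<times> {0..<T}:
   they need not vanish at t = 0. *)
definition test_functions :: "'a::real_normed_vector set \<Rightarrow> ('a \<Rightarrow> real) set" where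
  "test_functions S =
     {\<phi>. smooth \<phi> \<and> compact (closure {x. \<phi> x \<noteq> 0}) \<and> closure {x. \<phi> x \<noteq> 0} \<subseteq> S}"

definition grad :: "('a::euclidean_space \<Rightarrow> real) \<Rightarrow> 'a \<Rightarrow> 'a" where
  "grad f x = (\<Sum>b\<in>Basis. frechet_derivative f (at x) b *\<^sub>R b)"

definition Lp :: "real \<Rightarrow> 'b measure \<Rightarrow> ('b \<Rightarrow> 'c::euclidean_space) \<Rightarrow> bool" where
  "Lp p M f \<longleftrightarrow> f \<in> borel_measurable M \<and> integrable M (\<lambda>x. norm (f x) powr p)"

definition Linfty :: "'b measure \<Rightarrow> ('b \<Rightarrow> 'c::euclidean_space) \<Rightarrow> bool" where
  "Linfty M f \<longleftrightarrow> f \<in> borel_measurable M \<and> (\<exists>C. AE x in M. norm (f x) \<le> C)"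

definition locally_L1 :: "('a::euclidean_space \<Rightarrow> 'c::euclidean_space) \<Rightarrow> bool" where
  "locally_L1 f \<longleftrightarrow> (\<forall>K. compact K \<longrightarrow> integrable (lebesgue_on K) f)"

definition has_weak_gradient :: "('a::euclidean_space \<Rightarrow> real) \<Rightarrow> ('a \<Rightarrow> 'a) \<Rightarrow> bool" where
  "has_weak_gradient f g \<longleftrightarrow> locally_L1 f \<and> locally_L1 g \<and>
     (\<forall>\<phi>\<in>test_functions UNIV. \<forall>b\<in>Basis.
        (LINT x|lebesgue. f x * (grad \<phi> x \<bullet> b)) = - (LINT x|lebesgue. (g x \<bullet> b) * \<phi> x))"

abbreviation cylinder :: "real \<Rightarrow> ('a::euclidean_space \<times> real) measure" where
  "cylinder T \<equiv> lebesgue_on (UNIV \<times> {0..T})"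

definition C_L1 :: "real \<Rightarrow> ('a::euclidean_space \<times> real \<Rightarrow> real) \<Rightarrow> bool" where
  "C_L1 T u \<longleftrightarrow>
     (\<forall>t\<in>{0..T}. Lp 1 lebesgue (\<lambda>x. u (x, t))) \<and>
     (\<forall>t\<in>{0..T}. ((\<lambda>s. LINT x|lebesgue. \<bar>u (x, s) - u (x, t)\<bar>) \<longlongrightarrow> 0) (at t within {0..T}))"

(* w belongs to L^2(0,T; homogeneous H^1) with spatial weak gradient G.  The Bochner measurability
   and square integrability of t \<mapsto> w(.,t) is expressed by joint measurability and square
   integrability of G on the space-time cylinder. *)
definition L2_Hdot1 ::
    "real \<Rightarrow> ('a::euclidean_space \<times> real \<Rightarrow> real) \<Rightarrow> ('a \<times> real \<Rightarrow> 'a) \<Rightarrow> bool" where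
  "L2_Hdot1 T w G \<longleftrightarrow> Lp 2 (cylinder T) G \<and>
     (AE t in lebesgue_on {0..T}. has_weak_gradient (\<lambda>x. w (x, t)) (\<lambda>x. G (x, t)))"

(* Weak solution on [0,T] of u_t = Laplace u^m + div (u V) with initial datum u0.
   The spatial weak gradient G of u^m is unique up to null sets. *)
definition weak_solution ::
    "('a::euclidean_space \<Rightarrow> 'a) \<Rightarrow> real \<Rightarrow> real \<Rightarrow> ('a \<Rightarrow> real) \<Rightarrow> ('a \<times> real \<Rightarrow> real) \<Rightarrow> bool" where
  "weak_solution V m T u0 u \<longleftrightarrow>
     (AE x in lebesgue. 0 \<le> u0 x) \<and> Lp 1 lebesgue u0 \<and> Linfty lebesgue u0 \<and>
     (AE z in cylinder T. 0 \<le> u z) \<and> C_L1 T u \<and> Linfty (cylinder T) u \<and>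
     Lp 2 (cylinder T) (\<lambda>(x, t). u (x, t) *\<^sub>R V x) \<and>
     (\<exists>G. L2_Hdot1 T (\<lambda>z. u z powr m) G \<and>
        (\<forall>\<phi>\<in>test_functions (UNIV \<times> {..<T}).
           integral\<^sup>L (cylinder T) (\<lambda>(x, t). u (x, t) * deriv (\<lambda>s. \<phi> (x, s)) t) =
             - (LINT x|lebesgue. u0 x * \<phi> (x, 0))
             + integral\<^sup>L (cylinder T)
                 (\<lambda>(x, t). (G (x, t) + u (x, t) *\<^sub>R V x) \<bullet> grad (\<lambda>y. \<phi> (y, t)) x)))"

(* The distributional time derivative of w on UNIV \<times> {0<..<T} is an L^1 function. *)
definition time_derivative_L1 :: "real \<Rightarrow> ('a::euclidean_space \<times> real \<Rightarrow> real) \<Rightarrow> bool" where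
  "time_derivative_L1 T w \<longleftrightarrow>
     (\<exists>g. Lp 1 (cylinder T) g \<and>
        (\<forall>\<phi>\<in>test_functions (UNIV \<times> {0<..<T}).
           integral\<^sup>L (cylinder T) (\<lambda>(x, t). w (x, t) * deriv (\<lambda>s. \<phi> (x, s)) t) =
             - integral\<^sup>L (cylinder T) (\<lambda>z. g z * \<phi> z)))"

end

theory Submission
  imports Defs
begin

text \<open>
  Put \<open>w = u\<^sub>1 - u\<^sub>2\<close> and \<open>z = u\<^sub>1\<^sup>m - u\<^sub>2\<^sup>m\<close>, which have the same sign. Since \<open>g = \<partial>\<^sub>t w\<close> is integrable,
  the equation \<open>g = div (\<nabla>z + w V)\<close> may be tested with a smooth approximation \<open>H(z/\<epsilon>)\<close> of the
  positive sign of \<open>z\<close>. Completing the square in \<open>\<nabla>z\<close> leaves at most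
  \<open>(C/\<epsilon>) \<integral> w\<^sup>2 \<bar>V\<bar>\<^sup>2\<close> over \<open>{0 < z < \<epsilon>}\<close>. There \<open>w \<le> z\<^bsup>1/m\<^esup>\<close>, because \<open>m > 1\<close>, and Young's inequality
  bounds the integrand by \<open>\<epsilon>\<^bsup>(1+2/p)/m\<^esup> (\<bar>V\<bar>\<^sup>p + w)\<close>, so for \<open>m < 1 + 2/p\<close> this term vanishes as
  \<open>\<epsilon> \<rightarrow> 0\<close>. Hence \<open>\<integral> g \<eta> 1\<^bsub>{w > 0}\<^esub> \<le> 0\<close> for every \<open>\<eta>(t) \<ge> 0\<close>. The chain rule in time turns
  this into \<open>\<integral> \<eta>' W \<ge> 0\<close> for the continuous function \<open>W(t) = \<integral> w\<^sub>+(x,t) dx\<close>, which is therefore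
  nonincreasing; the weak formulation up to \<open>t = 0\<close> identifies \<open>W(0)\<close>.
\<close>

section \<open>Smooth functions\<close>

text \<open>The two halves of the argument act on different functions because the data do: a spatial
  gradient is known only for the powers, hence for \<open>z\<close>, and a time derivative only for
  \<open>w\<close>. Once the time derivative is replaced by the integrable \<open>g\<close>, the
  equation contains only space derivatives of the test function, so an approximate sign of
  \<open>z\<close> may be inserted without any control of the time derivative of \<open>z\<close>.
  The chain rule in time is then applied to \<open>w\<close>, and the common sign of
  \<open>z\<close> and \<open>w\<close> joins the two results. Neither insertion is a pointwise
  computation. Both pass through mollification in space-time, with limits in L^1 for the time
  derivative and in L^2 for the gradient; this is why many estimates are stated for
  \<open>q = 1\<close> and \<open>q = 2\<close> at once. A further obstacle is the unbounded space:
  the flux is only square integrable and an indicator function need not be, so a spatial cut-off is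
  required, and its error has to vanish together with the smoothing parameter of the sign.\<close>

abbreviation dird :: "('a::real_normed_vector \<Rightarrow> real) \<Rightarrow> 'a \<Rightarrow> 'a \<Rightarrow> real" where
  "dird f v \<equiv> (\<lambda>x. frechet_derivative f (at x) v)"

lemma dird_eq:
  assumes "(f has_derivative f') (at x)"
  shows "dird f v x = f' v"
  using frechet_derivative_at[OF assms] by metis

text \<open>By uniqueness of the Frechet derivative an explicit family \<open>f'\<close> coincides
  with the chosen \<open>frechet_derivative\<close>, so the recursion defining \<open>Ck\<close> can
  be fed with formulas.\<close>

lemma Ck_SucI:
  assumes "\<And>x. (f has_derivative f' x) (at x)" "\<And>v. Ck k (\<lambda>x. f' x v)"
  shows "Ck (Suc k) f"
proof -
  have "dird f v = (\<lambda>x. f' x v)" for v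
    using dird_eq[OF assms(1)] by blast
  then show ?thesis
    using assms by (auto simp: differentiable_def)
qed

lemma Ck_Suc_has_derivative:
  "Ck (Suc k) f \<Longrightarrow> (f has_derivative frechet_derivative f (at x)) (at x)"
  by (simp add: frechet_derivative_works)

lemma Ck_SucD: "Ck (Suc k) f \<Longrightarrow> Ck k f"
proof (induction k arbitrary: f)
  case 0
  then show ?case
    by (auto intro!: differentiable_imp_continuous_on simp: differentiable_on_def)
next
  case (Suc k)
  have "\<forall>x. f differentiable (at x)" "\<forall>v. Ck (Suc k) (dird f v)"
    using Suc.prems Ck.simps(2)[of "Suc k" f] by blast+
  then show ?case using Suc.IH Ck.simps(2)[of k f] by blast
qed

lemma Ck_const [simp]: "Ck k (\<lambda>x. c)"
proof (induction k arbitrary: c)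
  case (Suc k)
  show ?case by (rule Ck_SucI[where f' = "\<lambda>x v. 0"]) (auto intro: Suc)
qed auto

lemma Ck_linear:
  assumes "bounded_linear f" shows "Ck k f"
proof (cases k)
  case 0
  then show ?thesis using assms by (simp add: linear_continuous_on)
next
  case (Suc j)
  show ?thesis unfolding Suc
    by (rule Ck_SucI[where f' = "\<lambda>x. f"])
      (auto intro: bounded_linear_imp_has_derivative assms)
qed

lemma Ck_add: "Ck k f \<Longrightarrow> Ck k g \<Longrightarrow> Ck k (\<lambda>x. f x + g x)"
proof (induction k arbitrary: f g)
  case 0
  then show ?case by (auto intro: continuous_intros)
next
  case (Suc k)
  show ?case
    by (rule Ck_SucI[where f' = "\<lambda>x v. dird f v x + dird g v x"])
      (use Suc in \<open>auto intro!: has_derivative_add Ck_Suc_has_derivative[of k]\<close>)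
qed

lemma Ck_mult: "Ck k f \<Longrightarrow> Ck k g \<Longrightarrow> Ck k (\<lambda>x. f x * g x)"
proof (induction k arbitrary: f g)
  case 0
  then show ?case by (auto intro: continuous_intros)
next
  case (Suc k)
  show ?case
  proof (rule Ck_SucI[where f' = "\<lambda>x v. f x * dird g v x + dird f v x * g x"])
    show "((\<lambda>x. f x * g x) has_derivative (\<lambda>v. f x * dird g v x + dird f v x * g x)) (at x)" for x
      by (intro has_derivative_mult Ck_Suc_has_derivative[of k] Suc)
    show "Ck k (\<lambda>x. f x * dird g v x + dird f v x * g x)" for v
      using Suc Ck_SucD by (intro Ck_add Suc.IH) auto
  qed
qed

text \<open>The derivative of the composite is a product of \<open>dird H 1\<close> composed with
  \<open>f\<close> and a derivative of \<open>f\<close>. The induction must therefore vary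
  \<open>H\<close> and \<open>f\<close> together, and it needs closure under products.\<close>

lemma Ck_compose:
  fixes H :: "real \<Rightarrow> real"
  shows "Ck k H \<Longrightarrow> Ck k f \<Longrightarrow> Ck k (\<lambda>x. H (f x))"
proof (induction k arbitrary: H f)
  case 0
  then show ?case using continuous_on_compose2[of UNIV H UNIV f] by simp
next
  case (Suc k)
  show ?case
  proof (rule Ck_SucI[where f' = "\<lambda>x v. dird H 1 (f x) * dird f v x"])
    fix x
    have F: "(f has_derivative frechet_derivative f (at x)) (at x)"
      by (intro Ck_Suc_has_derivative[of k] Suc)
    have H: "(H has_derivative frechet_derivative H (at (f x))) (at (f x))"
      by (intro Ck_Suc_has_derivative[of k] Suc)
    have eq: "dird H 1 (f x) * v = frechet_derivative H (at (f x)) v" for v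
      using linear_scale[OF has_derivative_linear[OF H], of v 1] by simp
    show "((\<lambda>x. H (f x)) has_derivative (\<lambda>v. dird H 1 (f x) * dird f v x)) (at x)"
      unfolding eq by (rule has_derivative_compose[OF F H])
  next
    show "Ck k (\<lambda>x. dird H 1 (f x) * dird f v x)" for v
      using Suc.prems Ck_SucD[of k f] by (intro Ck_mult Suc.IH[of "dird H 1" f]) auto
  qed
qed

lemma Ck_affine:
  assumes A: "bounded_linear A"
  shows "Ck k f \<Longrightarrow> Ck k (\<lambda>x. f (A x + c))"
proof (induction k arbitrary: f)
  case 0
  then show ?case
    using A by (auto intro!: continuous_on_compose2[of UNIV f UNIV "\<lambda>x. A x + c"] continuous_on_add
        intro: linear_continuous_on)
next
  case (Suc k)
  show ?case
  proof (rule Ck_SucI[where f' = "\<lambda>x v. dird f (A v) (A x + c)"])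
    show "((\<lambda>x. f (A x + c)) has_derivative (\<lambda>v. dird f (A v) (A x + c))) (at x)" for x
      by (rule has_derivative_compose[where g=f])
        (auto intro!: derivative_eq_intros Ck_Suc_has_derivative[of k] Suc
           bounded_linear_imp_has_derivative A)
    show "Ck k (\<lambda>x. dird f (A v) (A x + c))" for v
      using Suc.prems by (intro Suc.IH[of "dird f (A v)"]) auto
  qed
qed

lemma smooth_const [simp, intro]: "smooth (\<lambda>x. c)"
  and smooth_linear: "bounded_linear f \<Longrightarrow> smooth f"
  and smooth_add [intro]: "smooth f \<Longrightarrow> smooth g \<Longrightarrow> smooth (\<lambda>x. f x + g x)"
  and smooth_mult [intro]: "smooth f \<Longrightarrow> smooth g \<Longrightarrow> smooth (\<lambda>x. f x * g x)"
  and smooth_compose: "smooth H \<Longrightarrow> smooth f \<Longrightarrow> smooth (\<lambda>x. H (f x))"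
  and smooth_affine: "bounded_linear A \<Longrightarrow> smooth h \<Longrightarrow> smooth (\<lambda>x. h (A x + d))"
  by (simp_all add: smooth_def Ck_linear Ck_add Ck_mult Ck_compose Ck_affine)

lemma smooth_minus [intro]:
  assumes "smooth f" "smooth g" shows "smooth (\<lambda>x. f x - g x)"
  using smooth_add[OF assms(1) smooth_mult[OF smooth_const[of "-1"] assms(2)]] by simp

lemma smooth_sum [intro]:
  "finite I \<Longrightarrow> (\<And>i. i \<in> I \<Longrightarrow> smooth (f i)) \<Longrightarrow> smooth (\<lambda>x. \<Sum>i\<in>I. f i x)"
  by (induction I rule: finite_induct) auto

lemma smooth_inner_self: "smooth (\<lambda>x::'a::euclidean_space. x \<bullet> x)"
proof -
  have "smooth (\<lambda>x::'a. \<Sum>b\<in>Basis. (x \<bullet> b) * (x \<bullet> b))"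
    by (intro smooth_sum smooth_mult smooth_linear bounded_linear_inner_left) auto
  then show ?thesis by (simp add: euclidean_inner[of x x for x])
qed

lemma smooth_has_derivative:
  "smooth f \<Longrightarrow> (f has_derivative frechet_derivative f (at x)) (at x)"
  by (rule Ck_Suc_has_derivative[of 0]) (simp only: smooth_def)

lemma smooth_dird [intro]: "smooth f \<Longrightarrow> smooth (dird f v)"
  unfolding smooth_def using Ck.simps(2)[of _ f] by blast

lemma smooth_continuous_on: "smooth f \<Longrightarrow> continuous_on S f"
  using Ck.simps(1)[of f] unfolding smooth_def by (blast intro: continuous_on_subset)

lemma smoothI_deriv:
  assumes "\<And>x. (f has_derivative f' x) (at x)" "\<And>v. smooth (\<lambda>x. f' x v)"
  shows "smooth f"
proof -
  have "Ck (Suc k) f" for k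
    using assms by (intro Ck_SucI) (auto simp: smooth_def)
  then show ?thesis
    unfolding smooth_def using Ck_SucD by blast
qed

lemma smoothI_real_deriv:
  assumes "\<And>x. (f has_real_derivative f' x) (at x)" "smooth f'"
  shows "smooth f"
  by (rule smoothI_deriv[where f' = "\<lambda>x v. f' x * v"])
    (use assms in \<open>auto simp: has_field_derivative_def\<close>)

lemma smooth_real_deriv:
  fixes f :: "real \<Rightarrow> real"
  assumes "smooth f"
  shows "(f has_real_derivative dird f 1 x) (at x)"
proof -
  note D = smooth_has_derivative[OF assms, of x]
  have eq: "dird f 1 x * v = frechet_derivative f (at x) v" for v
    using linear_scale[OF has_derivative_linear[OF D], of v 1] by simp
  show ?thesis unfolding has_field_derivative_def eq by (rule D)
qed

lemma dird_real_eq: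
  assumes "(f has_real_derivative c) (at x)"
  shows "dird f v x = c * v"
  using dird_eq[OF assms[unfolded has_field_derivative_def]] .

lemma dird_linear:
  assumes "smooth f"
  shows "linear (\<lambda>v. dird f v x)"
  using has_derivative_linear[OF smooth_has_derivative[OF assms]] .

lemma dird_mult:
  assumes "smooth f" "smooth g"
  shows "dird (\<lambda>x. f x * g x) v x = f x * dird g v x + dird f v x * g x"
  by (rule dird_eq) (intro has_derivative_mult smooth_has_derivative assms)

lemma dird_compose:
  fixes H :: "real \<Rightarrow> real"
  assumes "smooth H" "smooth f"
  shows "dird (\<lambda>x. H (f x)) v x = dird H 1 (f x) * dird f v x"
proof -
  have "((\<lambda>x. H (f x)) has_derivative (\<lambda>v. dird f v x * dird H 1 (f x))) (at x)"
    using DERIV_compose_FDERIV[OF smooth_real_deriv[OF assms(1)] smooth_has_derivative[OF assms(2)]] .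
  from dird_eq[OF this] show ?thesis by simp
qed

lemma dird_affine:
  assumes "smooth f" "bounded_linear A"
  shows "dird (\<lambda>x. f (A x + c)) v x = dird f (A v) (A x + c)"
proof -
  have "((\<lambda>x. f (A x + c)) has_derivative (\<lambda>v. dird f (A v) (A x + c))) (at x)"
    by (rule has_derivative_compose[where g=f])
        (auto intro!: derivative_eq_intros smooth_has_derivative assms
           bounded_linear_imp_has_derivative)
  from dird_eq[OF this] show ?thesis .
qed

section \<open>Flat exponentials and the smooth step\<close>

text \<open>The classical flat function exp(-1/s), with a polynomial in 1/s as a factor so that the
  family is closed under differentiation; smoothness of all members then follows from one
  induction.\<close>

definition exp_bump :: "real poly \<Rightarrow> real \<Rightarrow> real" where
  "exp_bump P s = (if s \<le> 0 then 0 else poly P (1 / s) * exp (- (1 / s)))"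

lemma tendsto_poly_exp_minus: "((\<lambda>x::real. poly P x * exp (- x)) \<longlongrightarrow> 0) at_top"
proof -
  have "((\<lambda>x::real. \<Sum>i\<le>degree P. coeff P i * (x ^ i / exp x)) \<longlongrightarrow> (\<Sum>i\<le>degree P. coeff P i * 0)) at_top"
    by (intro tendsto_sum tendsto_mult tendsto_const tendsto_power_div_exp_0)
  then show ?thesis
    by (simp add: poly_altdef sum_distrib_right exp_minus divide_inverse mult.assoc)
qed

text \<open>For s > 0 the chain rule produces 1/s^2 times P(1/s) - P'(1/s), and
  \<open>[:0, 0, 1:]\<close> is the polynomial X^2. At 0 all polynomial factors are beaten by the
  exponential.\<close>

lemma exp_bump_has_derivative:
  "(exp_bump P has_real_derivative exp_bump ([:0, 0, 1:] * (P - pderiv P)) s) (at s)"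
proof -
  consider "s < 0" | "s = 0" | "s > 0" by linarith
  then show ?thesis
  proof cases
    case 1
    have "((\<lambda>s. 0) has_real_derivative 0) (at s)" by simp
    then have "(exp_bump P has_real_derivative 0) (at s)"
      by (rule has_field_derivative_transform_within_open[where S="{..<0}"])
        (use 1 in \<open>auto simp: exp_bump_def\<close>)
    with 1 show ?thesis by (simp add: exp_bump_def)
  next
    case 2
    \<comment> \<open>Division by \<open>h\<close> in the difference quotient at 0 multiplies the
      polynomial in 1/h by X, which is \<open>pCons 0 P\<close>.\<close>
    have "((\<lambda>h. poly (pCons 0 P) (1 / h) * exp (- (1 / h))) \<longlongrightarrow> 0) (at_right (0::real))"
      using filterlim_compose[OF tendsto_poly_exp_minus[of "pCons 0 P"] filterlim_inverse_at_top_right]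
      by (simp add: inverse_eq_divide)
    then have "((\<lambda>h. (exp_bump P (0 + h) - exp_bump P 0) / h) \<longlongrightarrow> 0) (at_right 0)"
      by (rule Lim_transform_eventually)
        (auto simp: eventually_at_right_less exp_bump_def intro!: eventually_at_rightI[of 0 1])
    moreover have "((\<lambda>h. (exp_bump P (0 + h) - exp_bump P 0) / h) \<longlongrightarrow> 0) (at_left 0)"
      by (rule Lim_transform_eventually[where f="\<lambda>_. 0"])
        (auto simp: exp_bump_def intro!: eventually_at_leftI[of "-1" 0])
    ultimately have "((\<lambda>h. (exp_bump P (0 + h) - exp_bump P 0) / h) \<longlongrightarrow> 0) (at 0)"
      by (simp add: filterlim_split_at)
    with 2 show ?thesis by (simp add: DERIV_def exp_bump_def)
  next
    case 3
    have "((\<lambda>s. poly P (1 / s) * exp (- (1 / s))) has_real_derivative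
        (poly (pderiv P) (1 / s) * (- 1 / s\<^sup>2)) * exp (- (1 / s))
        + poly P (1 / s) * (exp (- (1 / s)) * (1 / s\<^sup>2))) (at s)"
      using 3
      by (auto intro!: derivative_eq_intros DERIV_chain2[OF poly_DERIV] simp: power2_eq_square)
    then have "(exp_bump P has_real_derivative
        (poly (pderiv P) (1 / s) * (- 1 / s\<^sup>2)) * exp (- (1 / s))
        + poly P (1 / s) * (exp (- (1 / s)) * (1 / s\<^sup>2))) (at s)"
      by (rule has_field_derivative_transform_within_open[where S="{0<..}"])
        (use 3 in \<open>auto simp: exp_bump_def\<close>)
    moreover have "(poly (pderiv P) (1 / s) * (- 1 / s\<^sup>2)) * exp (- (1 / s))
        + poly P (1 / s) * (exp (- (1 / s)) * (1 / s\<^sup>2)) = exp_bump ([:0, 0, 1:] * (P - pderiv P)) s"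
      using 3 by (simp add: exp_bump_def field_simps power2_eq_square)
    ultimately show ?thesis by metis
  qed
qed

lemma smooth_exp_bump: "smooth (exp_bump P)"
proof -
  have "Ck k (exp_bump P)" for k
  proof (induction k arbitrary: P)
    case 0
    show ?case
      using exp_bump_has_derivative
      by (auto intro!: continuous_at_imp_continuous_on DERIV_isCont)
  next
    case (Suc k)
    show ?case
      by (rule Ck_SucI[where f' = "\<lambda>s v. exp_bump ([:0, 0, 1:] * (P - pderiv P)) s * v"])
        (use exp_bump_has_derivative in \<open>auto simp: has_field_derivative_def intro!: Ck_mult Suc\<close>)
  qed
  then show ?thesis by (simp add: smooth_def)
qed

lemma exp_bump_1: "exp_bump 1 s \<ge> 0" "exp_bump 1 s > 0 \<longleftrightarrow> s > 0" "s \<le> 0 \<Longrightarrow> exp_bump 1 s = 0"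
  by (auto simp: exp_bump_def)

lemma antiderivative_exists:
  fixes f :: "real \<Rightarrow> real"
  assumes "continuous_on UNIV f" "\<And>x. x \<le> 0 \<Longrightarrow> f x = 0"
  obtains F where "\<And>x. (F has_real_derivative f x) (at x)" "\<And>x. x \<le> 0 \<Longrightarrow> F x = 0"
proof -
  \<comment> \<open>The base point -1 lies to the left of 0, so 0 is an interior point of the range
    where the fundamental theorem applies; further left \<open>F\<close> is locally zero.\<close>
  define F where "F x = integral {-1..x} f" for x
  have *: "(F has_real_derivative f x) (at x)" if "x > -1" for x
  proof -
    have "((\<lambda>u. integral {-1..u} f) has_vector_derivative f x) (at x within {-1..x+1})"
      by (rule integral_has_vector_derivative)
        (use that assms(1) in \<open>auto intro: continuous_on_subset\<close>)
    moreover have "x \<in> interior {-1..x+1}" using that by (simp add: interior_atLeastAtMost_real)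
    ultimately show ?thesis
      unfolding F_def
      by (metis at_within_interior has_real_derivative_iff_has_vector_derivative)
  qed
  have 0: "F x = 0" if "x \<le> 0" for x
  proof -
    have "integral {-1..x} f = integral {-1..x} (\<lambda>_. 0)"
      by (rule integral_cong) (use that assms(2) in auto)
    then show ?thesis by (simp add: F_def)
  qed
  have "(F has_real_derivative f x) (at x)" for x
  proof (cases "x > -1")
    case False
    have "((\<lambda>s. 0) has_real_derivative 0) (at x)" by simp
    then have "(F has_real_derivative 0) (at x)"
      by (rule has_field_derivative_transform_within_open[where S="{..<0}"])
        (use False 0 in auto)
    with False show ?thesis by (simp add: assms(2))
  qed (rule *)
  with 0 that show ?thesis by blast
qed

text \<open>\<open>H\<close> is the normalised primitive of
  \<open>exp_bump 1 s * exp_bump 1 (1 - s)\<close>, which is positive exactly on (0,1). Monotonicity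
  and the two constant ranges are read off from the sign and the support of this integrand.\<close>

lemma smooth_step_exists:
  obtains H :: "real \<Rightarrow> real" where "smooth H" "\<And>s. s \<le> 0 \<Longrightarrow> H s = 0" "\<And>s. 1 \<le> s \<Longrightarrow> H s = 1"
    "\<And>s. 0 \<le> H s" "\<And>s. H s \<le> 1" "\<And>s. 0 \<le> dird H 1 s" "mono H"
proof -
  define b where "b s = exp_bump 1 s * exp_bump 1 (1 - s)" for s
  have "smooth (\<lambda>s::real. exp_bump 1 ((-1) * s + 1))"
    by (rule smooth_affine[OF _ smooth_exp_bump]) (rule bounded_linear_mult_right)
  then have sb: "smooth b"
    unfolding b_def by (intro smooth_mult smooth_exp_bump) (simp add: algebra_simps)
  have b0: "b s = 0" if "s \<le> 0 \<or> s \<ge> 1" for s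
    using that by (auto simp: b_def exp_bump_1)
  have bpos: "b s \<ge> 0" for s by (simp add: b_def exp_bump_1)
  obtain F where F: "\<And>x. (F has_real_derivative b x) (at x)" "\<And>x. x \<le> 0 \<Longrightarrow> F x = 0"
    using antiderivative_exists[of b] smooth_continuous_on[OF sb] b0 by auto
  have mono: "F x \<le> F y" if "x \<le> y" for x y
    using DERIV_nonneg_imp_nondecreasing[OF that] F bpos by blast
  have F1: "F s = F 1" if "s \<ge> 1" for s
    using DERIV_isconst_end[of 1 s F] that F(1) b0
    by (metis DERIV_isCont continuous_at_imp_continuous_on less_eq_real_def)
  have "F 0 < F 1"
    using DERIV_pos_imp_increasing_open[of 0 1 F] F(1)
    by (force simp: b_def exp_bump_1 intro: continuous_at_imp_continuous_on DERIV_isCont)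
  then have F1pos: "F 1 > 0" using F(2)[of 0] by simp
  have sF: "smooth F" by (rule smoothI_real_deriv[OF F(1) sb])
  have D: "((\<lambda>s. (1 / F 1) * F s) has_real_derivative (1 / F 1) * b s) (at s)" for s
    by (rule DERIV_cmult[OF F(1)])
  have Fle: "0 \<le> F s" "F s \<le> F 1" for s
    using mono[of 0 s] F(2)[of s] F(2)[of 0] mono[of s 1] F1[of s] by linarith+
  show thesis
  proof (rule that[of "\<lambda>s. (1 / F 1) * F s"])
    show "smooth (\<lambda>s. (1 / F 1) * F s)" by (intro smooth_mult smooth_const sF)
    show "0 \<le> dird (\<lambda>s. (1 / F 1) * F s) 1 s" for s
      using dird_real_eq[OF D] bpos F1pos by simp
    show "mono (\<lambda>s. (1 / F 1) * F s)"
      using F1pos mono by (auto simp: mono_def divide_right_mono)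
    show "(1 / F 1) * F s = 0" if "s \<le> 0" for s using F(2)[OF that] by simp
    show "(1 / F 1) * F s = 1" if "1 \<le> s" for s unfolding F1[OF that] using F1pos by simp
    show "0 \<le> (1 / F 1) * F s" "(1 / F 1) * F s \<le> 1" for s
      using Fle[of s] F1pos by (auto simp: divide_simps)
  qed
qed

section \<open>Test functions and mollification\<close>

text \<open>Replaces the closure of the support by any compact set outside which the function
  vanishes. Products, derivatives and translates then only have to exhibit such a set.\<close>

lemma test_functions_iff:
  "\<phi> \<in> test_functions S \<longleftrightarrow> smooth \<phi> \<and> (\<exists>K. compact K \<and> K \<subseteq> S \<and> (\<forall>x. \<phi> x \<noteq> 0 \<longrightarrow> x \<in> K))"
proof (intro iffI conjI)
  assume "smooth \<phi> \<and> (\<exists>K. compact K \<and> K \<subseteq> S \<and> (\<forall>x. \<phi> x \<noteq> 0 \<longrightarrow> x \<in> K))"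
  then obtain K where *: "smooth \<phi>" "compact K" "K \<subseteq> S" "\<And>x. \<phi> x \<noteq> 0 \<Longrightarrow> x \<in> K" by blast
  then have sub: "closure {x. \<phi> x \<noteq> 0} \<subseteq> K"
    by (intro closure_minimal) (auto intro: compact_imp_closed)
  then have "compact (closure {x. \<phi> x \<noteq> 0})"
    using compact_Int_closed[OF *(2) closed_closure, of "{x. \<phi> x \<noteq> 0}"] by (simp add: Int_absorb1)
  with * sub show "\<phi> \<in> test_functions S" by (auto simp: test_functions_def)
next
  assume *: "\<phi> \<in> test_functions S"
  then show "smooth \<phi>" by (simp add: test_functions_def)
  from * show "\<exists>K. compact K \<and> K \<subseteq> S \<and> (\<forall>x. \<phi> x \<noteq> 0 \<longrightarrow> x \<in> K)"
    by (intro exI[of _ "closure {x. \<phi> x \<noteq> 0}"])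
      (auto simp: test_functions_def intro: closure_subset[THEN subsetD])
qed

lemma test_functionsI:
  "smooth \<phi> \<Longrightarrow> compact K \<Longrightarrow> K \<subseteq> S \<Longrightarrow> (\<And>x. \<phi> x \<noteq> 0 \<Longrightarrow> x \<in> K) \<Longrightarrow> \<phi> \<in> test_functions S"
  using test_functions_iff[of \<phi> S] by blast

lemma test_functionsE:
  assumes "\<phi> \<in> test_functions S"
  obtains K where "smooth \<phi>" "compact K" "K \<subseteq> S" "\<And>x. \<phi> x \<noteq> 0 \<Longrightarrow> x \<in> K"
  using assms test_functions_iff[of \<phi> S] by blast

lemma test_smooth: "\<phi> \<in> test_functions S \<Longrightarrow> smooth \<phi>"
  by (simp add: test_functions_iff)

lemma test_functions_mono: "\<phi> \<in> test_functions S \<Longrightarrow> S \<subseteq> S' \<Longrightarrow> \<phi> \<in> test_functions S'"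
  unfolding test_functions_def by blast

lemma test_mult:
  assumes "\<zeta> \<in> test_functions S" "smooth f"
  shows "(\<lambda>x. \<zeta> x * f x) \<in> test_functions S"
proof -
  obtain K where "smooth \<zeta>" "compact K" "K \<subseteq> S" "\<And>x. \<zeta> x \<noteq> 0 \<Longrightarrow> x \<in> K"
    using test_functionsE[OF assms(1)] by blast
  then show ?thesis by (intro test_functionsI[of _ K] smooth_mult assms) auto
qed

lemma dird_zero_outside:
  assumes "compact K" "\<And>x. \<phi> x \<noteq> 0 \<Longrightarrow> x \<in> K" "x \<notin> K"
  shows "dird \<phi> v x = 0"
proof -
  have "(\<phi> has_derivative (\<lambda>_. 0)) (at x)"
    by (rule has_derivative_transform_within_open[of "\<lambda>_. 0" _ _ _ "- K"])
      (use assms in \<open>auto intro: compact_imp_closed\<close>)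
  from dird_eq[OF this] show ?thesis .
qed

lemma test_dird:
  fixes \<phi> :: "'a::real_normed_vector \<Rightarrow> real"
  assumes "\<phi> \<in> test_functions S"
  shows "dird \<phi> v \<in> test_functions S"
proof -
  obtain K where K: "smooth \<phi>" "compact K" "K \<subseteq> S" "\<And>x. \<phi> x \<noteq> 0 \<Longrightarrow> x \<in> K"
    using test_functionsE[OF assms] by blast
  then show ?thesis
    using dird_zero_outside[OF K(2,4), where v=v] by (intro test_functionsI[of _ K]) (auto intro: smooth_dird)
qed

lemma test_bounded:
  assumes "\<phi> \<in> test_functions S"
  obtains C where "0 \<le> C" "\<And>x. \<bar>\<phi> x\<bar> \<le> C"
proof -
  obtain K where K: "smooth \<phi>" "compact K" "K \<subseteq> S" "\<And>x. \<phi> x \<noteq> 0 \<Longrightarrow> x \<in> K"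
    using test_functionsE[OF assms] by blast
  have "bounded (\<phi> ` K)"
    by (intro compact_imp_bounded compact_continuous_image smooth_continuous_on K)
  then obtain C where C: "\<And>x. x \<in> K \<Longrightarrow> \<bar>\<phi> x\<bar> \<le> C"
    by (auto simp: bounded_iff)
  have "\<bar>\<phi> x\<bar> \<le> max C 0" for x
    using C[of x] K(4)[of x] by (cases "\<phi> x = 0") auto
  with that[of "max C 0"] show thesis by auto
qed

lemma test_borel: "\<phi> \<in> test_functions S \<Longrightarrow> \<phi> \<in> borel_measurable borel"
  by (intro borel_measurable_continuous_onI smooth_continuous_on test_smooth)

lemma test_borel_lebesgue:
  "\<phi> \<in> test_functions S \<Longrightarrow> (\<phi> :: 'a::euclidean_space \<Rightarrow> real) \<in> borel_measurable lebesgue"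
  using test_borel[of \<phi> S] by (simp add: measurable_completion)

lemma integrable_mult_bounded:
  fixes f h :: "'a \<Rightarrow> real"
  assumes "integrable M f" "h \<in> borel_measurable M" "AE x in M. \<bar>h x\<bar> \<le> C"
  shows "integrable M (\<lambda>x. f x * h x)"
proof (rule Bochner_Integration.integrable_bound)
  show "integrable M (\<lambda>x. C * f x)" using assms by simp
  show "(\<lambda>x. f x * h x) \<in> borel_measurable M" using assms by measurable
  show "AE x in M. norm (f x * h x) \<le> norm (C * f x)"
    using assms(3)
  proof eventually_elim
    case (elim x)
    then show ?case
      by (simp add: abs_mult mult.commute[of "\<bar>f x\<bar>"]) (intro mult_right_mono, auto)
  qed
qed

lemma test_integrable:
  fixes \<phi> :: "'a::euclidean_space \<Rightarrow> real"
  assumes "\<phi> \<in> test_functions S"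
  shows "integrable lebesgue \<phi>"
proof -
  obtain K where K: "smooth \<phi>" "compact K" "K \<subseteq> S" "\<And>x. \<phi> x \<noteq> 0 \<Longrightarrow> x \<in> K"
    using test_functionsE[OF assms] by blast
  obtain C where C: "0 \<le> C" "\<And>x. \<bar>\<phi> x\<bar> \<le> C" using test_bounded[OF assms] by blast
  have "integrable lebesgue (indicat_real K)"
    by (rule lmeasurable_iff_integrable[THEN iffD1, OF lmeasurable_compact[OF K(2)]])
  then have "integrable lebesgue (\<lambda>x. indicat_real K x * \<phi> x)"
    by (rule integrable_mult_bounded[where C=C]) (use assms C test_borel_lebesgue in auto)
  moreover have "indicat_real K x * \<phi> x = \<phi> x" for x using K(4)[of x] by (auto simp: indicator_def)
  ultimately show ?thesis by simp
qed

lemma test_integrable_mult: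
  fixes \<phi> :: "'a::euclidean_space \<Rightarrow> real"
  assumes "\<phi> \<in> test_functions S" "integrable lebesgue f"
  shows "integrable lebesgue (\<lambda>x. f x * \<phi> x)"
proof -
  obtain C where C: "0 \<le> C" "\<And>x. \<bar>\<phi> x\<bar> \<le> C" using test_bounded[OF assms(1)] by blast
  show ?thesis by (rule integrable_mult_bounded[where C=C]) (use assms C test_borel_lebesgue in auto)
qed

lemma test_translate:
  fixes \<rho> :: "'a::real_normed_vector \<Rightarrow> real"
  assumes "\<rho> \<in> test_functions UNIV"
  shows "(\<lambda>y. \<rho> (y - p)) \<in> test_functions UNIV"
proof -
  obtain K where K: "smooth \<rho>" "compact K" "\<And>x. \<rho> x \<noteq> 0 \<Longrightarrow> x \<in> K"
    using test_functionsE[OF assms] by metis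
  have "smooth (\<lambda>y. \<rho> (y + (- p)))"
    by (rule smooth_affine[OF bounded_linear_ident K(1)])
  then have s: "smooth (\<lambda>y. \<rho> (y - p))" by simp
  show ?thesis
  proof (rule test_functionsI[OF s compact_translation[OF K(2), of p]])
    show "y \<in> (+) p ` K" if "\<rho> (y - p) \<noteq> 0" for y
      using K(3)[OF that] by (auto intro!: image_eqI[of _ _ "y - p"])
  qed auto
qed

lemma dird_expand:
  fixes \<phi> :: "'a::euclidean_space \<Rightarrow> real"
  assumes "smooth \<phi>"
  shows "dird \<phi> h x = (\<Sum>b\<in>Basis. (h \<bullet> b) * dird \<phi> b x)"
proof -
  interpret linear "\<lambda>v. dird \<phi> v x" by (rule dird_linear[OF assms])
  have "dird \<phi> h x = dird \<phi> (\<Sum>b\<in>Basis. (h \<bullet> b) *\<^sub>R b) x" by (simp add: euclidean_representation)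
  also have "\<dots> = (\<Sum>b\<in>Basis. (h \<bullet> b) * dird \<phi> b x)"
    by (simp only: sum scaleR real_scaleR_def)
  finally show ?thesis .
qed

lemma dird_mean_value:
  assumes "smooth \<phi>"
  obtains t where "0 < t" "t < 1" "\<phi> (x + h) - \<phi> x = dird \<phi> h (x + t *\<^sub>R h)"
proof -
  have D: "((\<lambda>t. \<phi> (x + t *\<^sub>R h)) has_real_derivative dird \<phi> h (x + t *\<^sub>R h)) (at t)" for t
  proof -
    have "((\<lambda>t. \<phi> (x + t *\<^sub>R h)) has_derivative (\<lambda>s. dird \<phi> (s *\<^sub>R h) (x + t *\<^sub>R h))) (at t)"
      by (rule has_derivative_compose[where g=\<phi>])
        (auto intro!: derivative_eq_intros smooth_has_derivative assms)
    moreover have "(\<lambda>s. dird \<phi> (s *\<^sub>R h) (x + t *\<^sub>R h)) = (\<lambda>s. dird \<phi> h (x + t *\<^sub>R h) * s)"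
      using linear_scale[OF dird_linear[OF assms]] by (auto simp: mult.commute)
    ultimately show ?thesis by (simp add: has_field_derivative_def)
  qed
  from MVT2[of 0 1 "\<lambda>t. \<phi> (x + t *\<^sub>R h)", OF _ D] that show thesis by auto
qed

lemma test_Lipschitz:
  fixes \<phi> :: "'a::euclidean_space \<Rightarrow> real"
  assumes "\<phi> \<in> test_functions S"
  obtains L where "0 \<le> L" "\<And>x h. \<bar>\<phi> (x + h) - \<phi> x\<bar> \<le> L * norm h"
proof -
  have "\<forall>b. \<exists>C\<ge>0. \<forall>x. \<bar>dird \<phi> b x\<bar> \<le> C"
    using test_bounded[OF test_dird[OF assms]] by metis
  then obtain C where C: "\<And>b. C b \<ge> 0" "\<And>b x. \<bar>dird \<phi> b x\<bar> \<le> C b" by metis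
  have "\<bar>\<phi> (x + h) - \<phi> x\<bar> \<le> (\<Sum>b\<in>Basis. C b) * norm h" for x h
  proof -
    obtain t where t: "\<phi> (x + h) - \<phi> x = dird \<phi> h (x + t *\<^sub>R h)"
      using dird_mean_value[OF test_smooth[OF assms]] by metis
    have "\<bar>dird \<phi> h (x + t *\<^sub>R h)\<bar> \<le> (\<Sum>b\<in>Basis. \<bar>(h \<bullet> b) * dird \<phi> b (x + t *\<^sub>R h)\<bar>)"
      unfolding dird_expand[OF test_smooth[OF assms], where h=h] by (rule sum_abs)
    also have "\<dots> \<le> (\<Sum>b\<in>Basis. norm h * C b)"
      unfolding abs_mult by (intro sum_mono mult_mono C Basis_le_norm) auto
    also have "\<dots> = (\<Sum>b\<in>Basis. C b) * norm h" by (simp add: sum_distrib_left mult.commute)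
    finally show ?thesis using t by simp
  qed
  with that[of "\<Sum>b\<in>Basis. C b"] C show thesis by (simp add: sum_nonneg)
qed

text \<open>Mean value theorem along the segment, then the Lipschitz bound for each of the finitely
  many partial derivatives. The constant does not depend on \<open>x\<close>, which is what lets
  \<open>conv\<close> be differentiated under the integral.\<close>

lemma test_quadratic_remainder:
  fixes \<phi> :: "'a::euclidean_space \<Rightarrow> real"
  assumes "\<phi> \<in> test_functions S"
  obtains M where "0 \<le> M" "\<And>x h. \<bar>\<phi> (x + h) - \<phi> x - dird \<phi> h x\<bar> \<le> M * (norm h)\<^sup>2"
proof -
  have "\<forall>b. \<exists>L\<ge>0. \<forall>x h. \<bar>dird \<phi> b (x + h) - dird \<phi> b x\<bar> \<le> L * norm h"
    using test_Lipschitz[OF test_dird[OF assms]] by metis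
  then obtain L where L: "\<And>b. L b \<ge> 0"
    "\<And>b x h. \<bar>dird \<phi> b (x + h) - dird \<phi> b x\<bar> \<le> L b * norm h" by metis
  have "\<bar>\<phi> (x + h) - \<phi> x - dird \<phi> h x\<bar> \<le> (\<Sum>b\<in>Basis. L b) * (norm h)\<^sup>2" for x h
  proof -
    obtain t where t: "0 < t" "t < 1" "\<phi> (x + h) - \<phi> x = dird \<phi> h (x + t *\<^sub>R h)"
      using dird_mean_value[OF test_smooth[OF assms]] by metis
    have "\<bar>dird \<phi> h (x + t *\<^sub>R h) - dird \<phi> h x\<bar>
        = \<bar>\<Sum>b\<in>Basis. (h \<bullet> b) * (dird \<phi> b (x + t *\<^sub>R h) - dird \<phi> b x)\<bar>"
      unfolding dird_expand[OF test_smooth[OF assms], where h=h]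
      by (simp add: sum_subtractf algebra_simps)
    also have "\<dots> \<le> (\<Sum>b\<in>Basis. \<bar>(h \<bullet> b) * (dird \<phi> b (x + t *\<^sub>R h) - dird \<phi> b x)\<bar>)"
      by (rule sum_abs)
    also have "\<dots> \<le> (\<Sum>b\<in>Basis. norm h * (L b * norm h))"
      unfolding abs_mult
    proof (intro sum_mono mult_mono)
      fix b :: 'a assume "b \<in> Basis"
      then show "\<bar>h \<bullet> b\<bar> \<le> norm h" by (rule Basis_le_norm)
      have "\<bar>dird \<phi> b (x + t *\<^sub>R h) - dird \<phi> b x\<bar> \<le> L b * norm (t *\<^sub>R h)" by (rule L)
      also have "\<dots> \<le> L b * norm h" using t L(1)[of b] by (intro mult_left_mono) (auto simp: mult_left_le_one_le)
      finally show "\<bar>dird \<phi> b (x + t *\<^sub>R h) - dird \<phi> b x\<bar> \<le> L b * norm h" .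
    qed auto
    also have "\<dots> = (\<Sum>b\<in>Basis. L b) * (norm h)\<^sup>2"
      by (simp add: sum_distrib_left power2_eq_square mult_ac)
    finally show ?thesis using t by simp
  qed
  with that[of "\<Sum>b\<in>Basis. L b"] L show thesis by (simp add: sum_nonneg)
qed

text \<open>A correlation rather than a convolution: with \<open>\<rho> (y - p)\<close> the measure never has to be
  reflected, at the price of a sign in every derivative.\<close>

definition conv :: "('a::euclidean_space \<Rightarrow> real) \<Rightarrow> ('a \<Rightarrow> real) \<Rightarrow> 'a \<Rightarrow> real" where
  "conv f \<rho> p = (LINT y|lebesgue. f y * \<rho> (y - p))"

lemma conv_integrable:
  assumes "integrable lebesgue f" "\<rho> \<in> test_functions UNIV"
  shows "integrable lebesgue (\<lambda>y. f y * \<rho> (y - p))"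
  by (rule test_integrable_mult[OF test_translate[OF assms(2)] assms(1)])

text \<open>The uniform Taylor remainder is integrated against \<open>f\<close>, leaving at most
  \<open>N * M\<close> times the squared increment, where \<open>N\<close> is the L^1 norm of
  \<open>f\<close>. The sign appears because \<open>p\<close> enters the kernel as
  \<open>- p\<close>.\<close>

lemma conv_has_derivative:
  fixes f :: "'a::euclidean_space \<Rightarrow> real"
  assumes f: "integrable lebesgue f" and \<rho>: "\<rho> \<in> test_functions UNIV"
  shows "(conv f \<rho> has_derivative (\<lambda>v. - conv f (dird \<rho> v) p)) (at p)"
proof -
  note int = conv_integrable[OF f]
  have lin: "linear (\<lambda>v. - conv f (dird \<rho> v) p)"
  proof (rule linearI)
    fix v w :: 'a and c :: real
    note L = dird_linear[OF test_smooth[OF \<rho>]]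
    have "conv f (dird \<rho> (v + w)) p = (LINT y|lebesgue. f y * dird \<rho> v (y - p) + f y * dird \<rho> w (y - p))"
      unfolding conv_def linear_add[OF L] by (simp add: algebra_simps)
    also have "\<dots> = conv f (dird \<rho> v) p + conv f (dird \<rho> w) p"
      unfolding conv_def by (rule Bochner_Integration.integral_add) (intro int test_dird \<rho>)+
    finally show "- conv f (dird \<rho> (v + w)) p = - conv f (dird \<rho> v) p + - conv f (dird \<rho> w) p" by simp
    have "conv f (dird \<rho> (c *\<^sub>R v)) p = (LINT y|lebesgue. c * (f y * dird \<rho> v (y - p)))"
      unfolding conv_def linear_scale[OF L] by (simp add: algebra_simps)
    then show "- conv f (dird \<rho> (c *\<^sub>R v)) p = c *\<^sub>R (- conv f (dird \<rho> v) p)"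
      by (simp add: conv_def)
  qed
  obtain M where M: "0 \<le> M" "\<And>x h. \<bar>\<rho> (x + h) - \<rho> x - dird \<rho> h x\<bar> \<le> M * (norm h)\<^sup>2"
    using test_quadratic_remainder[OF \<rho>] by blast
  define N where "N = (LINT y|lebesgue. \<bar>f y\<bar>)"
  have N: "N \<ge> 0" by (simp add: N_def)
  have bound: "\<bar>conv f \<rho> q - conv f \<rho> p - (- conv f (dird \<rho> (q - p)) p)\<bar> \<le> N * M * (norm (q - p))\<^sup>2" for q
  proof -
    have d: "dird \<rho> (p - q) y = - dird \<rho> (q - p) y" for y
      using linear_neg[OF dird_linear[OF test_smooth[OF \<rho>]], of y "q - p"] by simp
    have "conv f \<rho> q - conv f \<rho> p - (- conv f (dird \<rho> (q - p)) p)
       = (LINT y|lebesgue. f y * \<rho> (y - q) - f y * \<rho> (y - p) + f y * dird \<rho> (q - p) (y - p))"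
      unfolding conv_def using int[OF \<rho>] int[OF test_dird[OF \<rho>]] by simp
    also have "\<dots> = (LINT y|lebesgue. f y * (\<rho> ((y - p) + (p - q)) - \<rho> (y - p) - dird \<rho> (p - q) (y - p)))"
      by (rule Bochner_Integration.integral_cong) (auto simp: d algebra_simps)
    also have "\<bar>\<dots>\<bar> \<le> (LINT y|lebesgue. \<bar>f y\<bar> * (M * (norm (p - q))\<^sup>2))"
    proof (rule integral_abs_bound_integral)
      show "integrable lebesgue (\<lambda>y. f y * (\<rho> ((y - p) + (p - q)) - \<rho> (y - p) - dird \<rho> (p - q) (y - p)))"
        using int[OF \<rho>] int[OF test_dird[OF \<rho>]]
        by (simp add: right_diff_distrib)
      show "integrable lebesgue (\<lambda>y. \<bar>f y\<bar> * (M * (norm (p - q))\<^sup>2))" using f by simp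
      show "\<bar>f y * (\<rho> ((y - p) + (p - q)) - \<rho> (y - p) - dird \<rho> (p - q) (y - p))\<bar>
          \<le> \<bar>f y\<bar> * (M * (norm (p - q))\<^sup>2)" for y
        unfolding abs_mult by (intro mult_left_mono M) auto
    qed
    also have "\<dots> = N * M * (norm (q - p))\<^sup>2" by (simp add: N_def norm_minus_commute)
    finally show ?thesis .
  qed
  show ?thesis
    unfolding has_derivative_at_alt
  proof (intro conjI allI impI)
    show "bounded_linear (\<lambda>v. - conv f (dird \<rho> v) p)"
      using lin by (simp add: linear_conv_bounded_linear)
    fix e :: real assume e: "0 < e"
    show "\<exists>d>0. \<forall>y. norm (y - p) < d \<longrightarrow>
      norm (conv f \<rho> y - conv f \<rho> p - - conv f (dird \<rho> (y - p)) p) \<le> e * norm (y - p)"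
    proof (intro exI conjI allI impI)
      \<comment> \<open>The summand 1 in the denominator covers the case
        \<open>N * M = 0\<close>.\<close>
      show "e / (N * M + 1) > 0" using e N M(1) by (simp add: add_nonneg_pos)
      fix y assume y: "norm (y - p) < e / (N * M + 1)"
      have "N * M * (norm (y - p))\<^sup>2 \<le> e * norm (y - p)"
      proof -
        have "N * M * norm (y - p) \<le> (N * M + 1) * norm (y - p)" by (intro mult_right_mono) auto
        also have "\<dots> \<le> e" using y N M(1) by (simp add: pos_less_divide_eq add_nonneg_pos mult.commute)
        finally have "N * M * norm (y - p) * norm (y - p) \<le> e * norm (y - p)"
          by (intro mult_right_mono) auto
        then show ?thesis by (simp add: power2_eq_square mult.assoc)
      qed
      with bound[of y] show "norm (conv f \<rho> y - conv f \<rho> p - - conv f (dird \<rho> (y - p)) p) \<le> e * norm (y - p)"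
        by simp
    qed
  qed
qed

lemma dird_conv:
  assumes "integrable lebesgue f" "\<rho> \<in> test_functions UNIV"
  shows "dird (conv f \<rho>) v p = - conv f (dird \<rho> v) p"
  by (rule dird_eq[OF conv_has_derivative[OF assms]])

text \<open>All regularity comes from the kernel: each derivative of the correlation is again a
  correlation of the same \<open>f\<close>, with a differentiated kernel. Hence the induction varies
  \<open>\<rho>\<close> only.\<close>

lemma smooth_conv:
  fixes f :: "'a::euclidean_space \<Rightarrow> real"
  assumes f: "integrable lebesgue f" and "\<rho> \<in> test_functions UNIV"
  shows "smooth (conv f \<rho>)"
proof -
  have "Ck k (conv f \<rho>)" if "\<rho> \<in> test_functions UNIV" for k \<rho>
    using that
  proof (induction k arbitrary: \<rho>)
    case 0
    then show ?case
      using conv_has_derivative[OF f 0]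
      by (auto intro!: continuous_at_imp_continuous_on has_derivative_continuous)
  next
    case (Suc k)
    show ?case
    proof (rule Ck_SucI[OF conv_has_derivative[OF f Suc.prems]])
      fix v
      have "Ck k (\<lambda>x. (- 1) * conv f (dird \<rho> v) x)"
        by (intro Ck_mult Ck_const Suc.IH test_dird Suc.prems)
      then show "Ck k (\<lambda>x. - conv f (dird \<rho> v) x)" by simp
    qed
  qed
  with assms show ?thesis by (simp add: smooth_def)
qed

text \<open>The correlation of \<open>\<phi>\<close> with the indicator of a large ball is constant
  near 0 by translation invariance, and its derivative at 0 is minus the integral in question. This
  avoids integrating coordinate by coordinate.\<close>

lemma integral_dird_test:
  fixes \<phi> :: "'a::euclidean_space \<Rightarrow> real"
  assumes "\<phi> \<in> test_functions S"
  shows "(LINT x|lebesgue. dird \<phi> v x) = 0"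
proof -
  have \<phi>: "\<phi> \<in> test_functions UNIV" using assms by (rule test_functions_mono) auto
  obtain K where K: "smooth \<phi>" "compact K" "\<And>x. \<phi> x \<noteq> 0 \<Longrightarrow> x \<in> K"
    using test_functionsE[OF assms] by metis
  obtain R where R: "\<And>x. x \<in> K \<Longrightarrow> norm x \<le> R"
    using compact_imp_bounded[OF K(2)] by (auto simp: bounded_iff)
  \<comment> \<open>The extra 1 keeps all translates by vectors of the unit ball inside
    \<open>B\<close>.\<close>
  define B where "B = cball (0::'a) (R + 1)"
  have B: "integrable lebesgue (indicat_real B)"
    unfolding B_def by (rule lmeasurable_iff_integrable[THEN iffD1, OF lmeasurable_cball])
  have int\<phi>: "integrable lborel \<phi>"
    using test_integrable[OF \<phi>] test_borel[OF \<phi>] by (simp add: integrable_completion)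
  have c: "conv (indicat_real B) \<phi> p = (LINT x|lborel. \<phi> x)" if "p \<in> ball 0 1" for p
  proof -
    have "indicat_real B y * \<phi> (y - p) = \<phi> (y - p)" for y
    proof (cases "\<phi> (y - p) = 0")
      case False
      then have "norm (y - p) \<le> R" using K R by auto
      then have "norm y \<le> R + 1" using that norm_triangle_ineq[of "y - p" p] by auto
      then show ?thesis by (simp add: B_def)
    qed simp
    then have "conv (indicat_real B) \<phi> p = (LINT y|lebesgue. \<phi> (y - p))" by (simp only: conv_def)
    also have "\<dots> = (LINT y|lborel. \<phi> (y - p))"
      by (rule integral_completion) (use test_borel[OF test_translate[OF \<phi>, of p]] in simp)
    also have "\<dots> = (LINT y|distr lborel borel ((+) (- p)). \<phi> y)"
      by (subst integral_distr) (use test_borel[OF \<phi>] in \<open>auto simp: algebra_simps\<close>)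
    finally show ?thesis by (simp add: lborel_distr_plus)
  qed
  have "(conv (indicat_real B) \<phi> has_derivative (\<lambda>v. 0)) (at 0)"
    by (rule has_derivative_transform_within_open[of "\<lambda>_. (LINT x|lborel. \<phi> x)" _ _ _ "ball 0 1"])
      (auto simp: c)
  from dird_eq[OF this] have "conv (indicat_real B) (dird \<phi> v) 0 = 0"
    using dird_conv[OF B \<phi>, of 0 v] by simp
  moreover have "indicat_real B y * dird \<phi> v y = dird \<phi> v y" for y
    using dird_zero_outside[OF K(2,3), where x=y and v=v] R[of y] by (cases "y \<in> K") (auto simp: B_def)
  ultimately show ?thesis by (simp add: conv_def)
qed

lemma mollifier_exists:
  fixes e :: real
  assumes "e > 0"
  obtains \<rho> :: "'a::euclidean_space \<Rightarrow> real"
  where "\<rho> \<in> test_functions UNIV" "\<And>x. 0 \<le> \<rho> x" "(LINT x|lebesgue. \<rho> x) = 1" "\<And>x. \<rho> x \<noteq> 0 \<Longrightarrow> norm x \<le> e"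
proof -
  \<comment> \<open>The squared norm is smooth at the origin, where the norm itself is not.\<close>
  define r where "r x = exp_bump 1 (e\<^sup>2 - x \<bullet> x)" for x :: 'a
  have pos: "r x \<ge> 0" for x by (simp add: r_def exp_bump_1)
  have z: "r x \<noteq> 0 \<longleftrightarrow> norm x < e" for x
  proof -
    have "r x \<noteq> 0 \<longleftrightarrow> e\<^sup>2 - x \<bullet> x > 0"
      unfolding r_def using exp_bump_1[of "e\<^sup>2 - x \<bullet> x"] by linarith
    also have "\<dots> \<longleftrightarrow> (norm x)\<^sup>2 < e\<^sup>2" by (simp add: power2_norm_eq_inner)
    also have "\<dots> \<longleftrightarrow> norm x < e" using assms power2_less_imp_less[of "norm x" e] power_strict_mono[of "norm x" e 2] by auto
    finally show ?thesis .
  qed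
  have s: "smooth r"
    unfolding r_def by (intro smooth_compose[OF smooth_exp_bump] smooth_minus smooth_inner_self smooth_const)
  have t: "r \<in> test_functions UNIV"
    by (rule test_functionsI[OF s compact_cball[of 0 e]]) (auto simp: z)
  note int = test_integrable[OF t]
  define c where "c = (LINT x|lebesgue. r x)"
  have "c \<noteq> 0"
  proof
    assume "c = 0"
    then have "AE x in lebesgue. r x = 0"
      using integral_nonneg_eq_0_iff_AE[OF int] pos by (simp add: c_def)
    then have "AE x in lebesgue. x \<notin> ball (0::'a) e"
      by eventually_elim (use z in auto)
    then have "ball (0::'a) e \<in> null_sets lebesgue"
      by (subst AE_iff_null_sets) auto
    then show False
      using open_not_negligible[OF open_ball, of "0::'a" e] assms by (simp add: negligible_iff_null_sets)
  qed
  moreover have "c \<ge> 0" by (simp add: c_def pos)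
  ultimately have c: "c > 0" by simp
  show thesis
  proof (rule that[of "\<lambda>x. r x * (1 / c)"])
    show "(\<lambda>x. r x * (1 / c)) \<in> test_functions UNIV" by (intro test_mult t smooth_const)
    show "(LINT x|lebesgue. r x * (1 / c)) = 1" using c by (simp flip: c_def)
  qed (use pos z c in \<open>auto simp: less_imp_le\<close>)
qed

section \<open>Mollification in L^1 and L^2\<close>

text \<open>The exponent 1 serves the time derivative and 2 the gradient; the common constant 2,
  needed for squares only, lets later estimates treat both at once.\<close>

lemma abs_add_power_le:
  fixes a b :: real
  assumes "q = 1 \<or> q = (2::nat)"
  shows "\<bar>a + b\<bar> ^ q \<le> 2 * (\<bar>a\<bar> ^ q + \<bar>b\<bar> ^ q)"
  using assms
proof
  assume "q = 2"
  have "0 \<le> (a - b)\<^sup>2" by simp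
  then show ?thesis unfolding \<open>q = 2\<close> power2_abs by (simp add: power2_eq_square algebra_simps)
qed (use abs_triangle_ineq[of a b] abs_ge_zero[of a] abs_ge_zero[of b] in auto)

text \<open>Translation and Tonelli arguments are run on \<open>lborel\<close> with a Borel
  representative; results return to \<open>lebesgue\<close> by almost everywhere equality.\<close>

lemma ex_borel_version:
  fixes f :: "'a::euclidean_space \<Rightarrow> real"
  assumes "f \<in> borel_measurable lebesgue"
  obtains f' where "f' \<in> borel_measurable borel" "AE x in lebesgue. f x = f' x"
proof -
  obtain f' where "f' \<in> borel_measurable lborel" "AE x in lborel. f x = f' x"
    using completion_ex_borel_measurable_real[OF assms] by blast
  then show thesis using that[of f'] by (auto intro: AE_completion)
qed

text \<open>Two approximations, each with error below e/4, combined with the constant 2 of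
  \<open>abs_add_power_le\<close>. The function is first clamped in value and cut off in space at
  level \<open>k\<close>; it is then replaced by continuous functions converging to it almost
  everywhere, clamped and cut off in the same way so that dominated convergence applies.\<close>

lemma Lq_dense_continuous:
  fixes f :: "'a::euclidean_space \<Rightarrow> real"
  assumes q: "q = 1 \<or> q = (2::nat)"
    and f: "f \<in> borel_measurable lebesgue" "integrable lebesgue (\<lambda>x. \<bar>f x\<bar> ^ q)"
    and e: "e > (0::real)"
  obtains h R where "continuous_on UNIV h" "\<And>x. norm x > R \<Longrightarrow> h x = 0"
    "integrable lebesgue (\<lambda>x. \<bar>f x - h x\<bar> ^ q)" "(LINT x|lebesgue. \<bar>f x - h x\<bar> ^ q) < e"
proof -
  note [measurable] = f(1)
  have q0: "q > 0" using q by auto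
  define cut where "cut k x = max 0 (min 1 (real k + 1 - norm x))" for k and x :: 'a
  define clamp where "clamp k s = max (- real k) (min (real k) s)" for k s
  have cut01: "0 \<le> cut k x" "cut k x \<le> 1" for k x by (auto simp: cut_def)
  have cut0: "cut k x = 0" if "norm x > real k + 1" for k x using that by (auto simp: cut_def)
  have "cut k \<in> borel_measurable borel" for k
    unfolding cut_def by (intro borel_measurable_continuous_onI continuous_intros)
  then have [measurable]: "cut k \<in> borel_measurable lebesgue" for k
    by (simp add: measurable_completion)
  have clamp_le: "\<bar>clamp k s\<bar> \<le> real k" "\<bar>clamp k s\<bar> \<le> \<bar>s\<bar>" "s \<ge> 0 \<Longrightarrow> 0 \<le> clamp k s \<and> clamp k s \<le> s"
    "s \<le> 0 \<Longrightarrow> clamp k s \<le> 0 \<and> s \<le> clamp k s" for k s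
    unfolding clamp_def by linarith+
  have [measurable]: "clamp k \<in> borel_measurable borel" for k unfolding clamp_def by measurable
  define F where "F k x = cut k x * clamp k (f x)" for k x
  have [measurable]: "F k \<in> borel_measurable lebesgue" for k unfolding F_def by measurable
  \<comment> \<open>Clamping and cutting move a value towards 0 without changing its sign, so the
    error never exceeds the value. The q-th power of \<open>f\<close> is then a dominating
    function.\<close>
  have F_le: "\<bar>f x - F k x\<bar> \<le> \<bar>f x\<bar>" for k x
  proof -
    have "0 \<le> F k x \<and> F k x \<le> f x" if "f x \<ge> 0"
      using clamp_le(3)[OF that, of k] cut01[of k x] mult_mono[of "cut k x" 1 "clamp k (f x)" "f x"] that
      by (simp add: F_def)
    moreover have "F k x \<le> 0 \<and> f x \<le> F k x" if "f x \<le> 0"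
      using clamp_le(4)[OF that, of k] cut01[of k x] mult_mono[of "cut k x" 1 "- clamp k (f x)" "- f x"] that
      by (simp add: F_def mult_nonneg_nonpos)
    ultimately show ?thesis by linarith
  qed
  have "(\<lambda>k. LINT x|lebesgue. \<bar>f x - F k x\<bar> ^ q) \<longlonglongrightarrow> integral\<^sup>L lebesgue (\<lambda>x::'a. 0::real)"
  proof (rule integral_dominated_convergence[OF _ _ f(2)])
    show "AE x in lebesgue. (\<lambda>k. \<bar>f x - F k x\<bar> ^ q) \<longlonglongrightarrow> 0"
    proof (intro AE_I2)
      fix x
      have "\<forall>\<^sub>F k in sequentially. \<bar>f x - F k x\<bar> ^ q = 0"
        using eventually_ge_at_top[of "nat \<lceil>max (norm x) \<bar>f x\<bar>\<rceil>"]
      proof eventually_elim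
        case (elim k)
        then have "norm x \<le> real k" "\<bar>f x\<bar> \<le> real k" by linarith+
        then have "cut k x = 1" "clamp k (f x) = f x" unfolding cut_def clamp_def by linarith+
        then show ?case using q0 by (simp add: F_def zero_power)
      qed
      then show "(\<lambda>k. \<bar>f x - F k x\<bar> ^ q) \<longlonglongrightarrow> 0" by (rule tendsto_eventually)
    qed
    show "AE x in lebesgue. norm (\<bar>f x - F k x\<bar> ^ q) \<le> \<bar>f x\<bar> ^ q" for k
      using F_le by (intro AE_I2) (auto intro!: power_mono)
  qed measurable
  then have "\<forall>\<^sub>F k in sequentially. (LINT x|lebesgue. \<bar>f x - F k x\<bar> ^ q) < e / 4"
    using e by (intro order_tendstoD(2)[where y=0]) auto
  then obtain k where k: "(LINT x|lebesgue. \<bar>f x - F k x\<bar> ^ q) < e / 4"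
    unfolding eventually_sequentially by blast
  have int1: "integrable lebesgue (\<lambda>x. \<bar>f x - F k x\<bar> ^ q)"
    by (rule Bochner_Integration.integrable_bound[OF f(2)])
      (use F_le in \<open>auto intro!: power_mono AE_I2\<close>)

  obtain N g where N: "negligible N" and g: "\<And>n. continuous_on UNIV (g n)"
    "\<And>x. x \<notin> N \<Longrightarrow> (\<lambda>n. g n x) \<longlonglongrightarrow> f x"
    using lebesgue_measurable_imp_measurable_on_real[of f UNIV] f(1)
    unfolding measurable_on_def by (auto simp: lebesgue_on_UNIV_eq)
  define h where "h n x = cut k x * clamp k (g n x)" for n x
  have ch: "continuous_on UNIV (h n)" for n
    unfolding h_def cut_def clamp_def by (intro continuous_intros g)
  have [measurable]: "h n \<in> borel_measurable lebesgue" for n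
    using borel_measurable_continuous_onI[OF ch] by (simp add: measurable_completion)
  have bound: "\<bar>F k x - h n x\<bar> ^ q \<le> (2 * real k) ^ q * indicat_real (cball 0 (real k + 1)) x" for n x
  proof (cases "norm x > real k + 1")
    case True
    then show ?thesis using q0 by (simp add: F_def h_def cut0 zero_power)
  next
    case False
    have *: "\<bar>cut k x * clamp k s\<bar> \<le> real k" for s
      using mult_mono[of "cut k x" 1 "\<bar>clamp k s\<bar>" "real k"] cut01[of k x] clamp_le(1)[of k s]
      by (simp add: abs_mult)
    have "\<bar>F k x - h n x\<bar> \<le> 2 * real k"
      using *[of "f x"] *[of "g n x"] by (simp add: F_def h_def)
    then have "\<bar>F k x - h n x\<bar> ^ q \<le> (2 * real k) ^ q" by (intro power_mono) auto
    with False show ?thesis by simp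
  qed
  have intB: "integrable lebesgue (\<lambda>x::'a. (2 * real k) ^ q * indicat_real (cball 0 (real k + 1)) x)"
    by (intro integrable_mult_right lmeasurable_iff_integrable[THEN iffD1, OF lmeasurable_cball])
  have "(\<lambda>n. LINT x|lebesgue. \<bar>F k x - h n x\<bar> ^ q) \<longlonglongrightarrow> integral\<^sup>L lebesgue (\<lambda>x::'a. 0::real)"
  proof (rule integral_dominated_convergence[OF _ _ intB])
    have "AE x in lebesgue. x \<notin> N"
      using N by (intro AE_not_in) (simp add: negligible_iff_null_sets)
    then show "AE x in lebesgue. (\<lambda>n. \<bar>F k x - h n x\<bar> ^ q) \<longlonglongrightarrow> 0"
    proof eventually_elim
      case (elim x)
      have "(\<lambda>n. \<bar>F k x - h n x\<bar> ^ q) \<longlonglongrightarrow> \<bar>F k x - cut k x * clamp k (f x)\<bar> ^ q"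
        unfolding h_def clamp_def by (intro tendsto_intros g(2) elim)
      then show ?case using q0 by (simp add: F_def zero_power)
    qed
    show "AE x in lebesgue. norm (\<bar>F k x - h n x\<bar> ^ q) \<le> (2 * real k) ^ q * indicat_real (cball 0 (real k + 1)) x" for n
      using bound by (intro AE_I2) simp
  qed measurable
  then have "\<forall>\<^sub>F n in sequentially. (LINT x|lebesgue. \<bar>F k x - h n x\<bar> ^ q) < e / 4"
    using e by (intro order_tendstoD(2)[where y=0]) auto
  then obtain n where n: "(LINT x|lebesgue. \<bar>F k x - h n x\<bar> ^ q) < e / 4"
    unfolding eventually_sequentially by blast
  have int2: "integrable lebesgue (\<lambda>x. \<bar>F k x - h n x\<bar> ^ q)"
    by (rule Bochner_Integration.integrable_bound[OF intB])
      (use bound in \<open>auto intro!: AE_I2\<close>)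
  have le: "\<bar>f x - h n x\<bar> ^ q \<le> 2 * (\<bar>f x - F k x\<bar> ^ q + \<bar>F k x - h n x\<bar> ^ q)" for x
    using abs_add_power_le[OF q, of "f x - F k x" "F k x - h n x"] by simp
  have int3: "integrable lebesgue (\<lambda>x. 2 * (\<bar>f x - F k x\<bar> ^ q + \<bar>F k x - h n x\<bar> ^ q))"
    using int1 int2 by simp
  have int: "integrable lebesgue (\<lambda>x. \<bar>f x - h n x\<bar> ^ q)"
    by (rule Bochner_Integration.integrable_bound[OF int3])
      (use le in \<open>auto intro!: AE_I2\<close>)
  have "(LINT x|lebesgue. \<bar>f x - h n x\<bar> ^ q) \<le> (LINT x|lebesgue. 2 * (\<bar>f x - F k x\<bar> ^ q + \<bar>F k x - h n x\<bar> ^ q))"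
    by (rule integral_mono[OF int int3]) (rule le)
  also have "\<dots> < e" using k n int1 int2 by simp
  finally have "(LINT x|lebesgue. \<bar>f x - h n x\<bar> ^ q) < e" .
  moreover have "h n x = 0" if "norm x > real k + 1" for x using that by (simp add: h_def cut0)
  ultimately show thesis using that[OF ch _ int] by blast
qed

lemma lborel_translate:
  fixes f :: "'a::euclidean_space \<Rightarrow> real"
  assumes [measurable]: "f \<in> borel_measurable borel"
  shows "integrable lborel (\<lambda>x. f (x + y)) \<longleftrightarrow> integrable lborel f"
    "(LINT x|lborel. f (x + y)) = (LINT x|lborel. f x)"
proof -
  have "integrable (distr lborel borel ((+) y)) f \<longleftrightarrow> integrable lborel (\<lambda>x. f (x + y))"
    by (subst integrable_distr_eq) (auto simp: add.commute)
  then show "integrable lborel (\<lambda>x. f (x + y)) \<longleftrightarrow> integrable lborel f"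
    by (simp add: lborel_distr_plus)
  have "(LINT x|distr lborel borel ((+) y). f x) = (LINT x|lborel. f (x + y))"
    by (subst integral_distr) (auto simp: add.commute)
  then show "(LINT x|lborel. f (x + y)) = (LINT x|lborel. f x)"
    by (simp add: lborel_distr_plus)
qed

lemma Lq_diff_integrable:
  fixes f g :: "'a \<Rightarrow> real"
  assumes q: "q = 1 \<or> q = (2::nat)"
    and [measurable]: "f \<in> borel_measurable M" "g \<in> borel_measurable M"
    and int: "integrable M (\<lambda>x. \<bar>f x\<bar> ^ q)" "integrable M (\<lambda>x. \<bar>g x\<bar> ^ q)"
  shows "integrable M (\<lambda>x. \<bar>f x - g x\<bar> ^ q)"
    "(LINT x|M. \<bar>f x - g x\<bar> ^ q) \<le> 2 * ((LINT x|M. \<bar>f x\<bar> ^ q) + (LINT x|M. \<bar>g x\<bar> ^ q))"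
proof -
  have le: "\<bar>f x - g x\<bar> ^ q \<le> 2 * (\<bar>f x\<bar> ^ q + \<bar>g x\<bar> ^ q)" for x
    using abs_add_power_le[OF q, of "f x" "- g x"] by simp
  have int3: "integrable M (\<lambda>x. 2 * (\<bar>f x\<bar> ^ q + \<bar>g x\<bar> ^ q))" using int by simp
  show 1: "integrable M (\<lambda>x. \<bar>f x - g x\<bar> ^ q)"
    by (rule Bochner_Integration.integrable_bound[OF int3]) (use le in \<open>auto intro!: AE_I2\<close>)
  have "(LINT x|M. \<bar>f x - g x\<bar> ^ q) \<le> (LINT x|M. 2 * (\<bar>f x\<bar> ^ q + \<bar>g x\<bar> ^ q))"
    by (rule integral_mono[OF 1 int3]) (rule le)
  with int show "(LINT x|M. \<bar>f x - g x\<bar> ^ q) \<le> 2 * ((LINT x|M. \<bar>f x\<bar> ^ q) + (LINT x|M. \<bar>g x\<bar> ^ q))"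
    by simp
qed

text \<open>For a continuous compactly supported function the claim is dominated convergence. The
  remaining part \<open>a\<close> is small in L^q, and so is each of its translates, by invariance
  of the measure. The fractions e/16 and e/8 absorb two applications of the constant 2.\<close>

lemma translation_continuous_Lq:
  fixes f :: "'a::euclidean_space \<Rightarrow> real"
  assumes q: "q = 1 \<or> q = (2::nat)"
    and f [measurable]: "f \<in> borel_measurable borel" and int: "integrable lborel (\<lambda>x. \<bar>f x\<bar> ^ q)"
    and e: "e > (0::real)"
  obtains d where "d > 0" "\<And>y. norm y < d \<Longrightarrow> (LINT x|lborel. \<bar>f (x + y) - f x\<bar> ^ q) < e"
proof -
  have q0: "q > 0" using q by auto
  have "integrable lebesgue (\<lambda>x. \<bar>f x\<bar> ^ q)" using int by (simp add: integrable_completion)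
  then obtain h R where h: "continuous_on UNIV h" "\<And>x. norm x > R \<Longrightarrow> h x = 0"
    and inth: "integrable lebesgue (\<lambda>x. \<bar>f x - h x\<bar> ^ q)" "(LINT x|lebesgue. \<bar>f x - h x\<bar> ^ q) < e / 16"
    using Lq_dense_continuous[OF q, of f "e / 16"] f e by (auto simp: measurable_completion)
  have [measurable]: "h \<in> borel_measurable borel" using h(1) by (rule borel_measurable_continuous_onI)
  have inth': "integrable lborel (\<lambda>x. \<bar>f x - h x\<bar> ^ q)" "(LINT x|lborel. \<bar>f x - h x\<bar> ^ q) < e / 16"
    using inth by (simp_all add: integrable_completion integral_completion)
  have "bounded (h ` cball 0 R)"
    by (intro compact_imp_bounded compact_continuous_image continuous_on_subset[OF h(1)]) auto
  then obtain C0 where C0: "\<And>x. x \<in> cball 0 R \<Longrightarrow> \<bar>h x\<bar> \<le> C0" by (force simp: bounded_iff)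
  define C where "C = max C0 0"
  have C: "\<bar>h x\<bar> \<le> C" for x using C0[of x] h(2)[of x] by (cases "norm x > R") (auto simp: C_def)
  \<comment> \<open>For shifts of norm at most 1 the difference of \<open>h\<close> and its
    translate lives in the ball of radius \<open>R + 1\<close>.\<close>
  define D where "D x = (2 * C) ^ q * indicat_real (cball 0 (R + 1)) x" for x :: 'a
  have intD: "integrable lborel D"
  proof -
    have "integrable lebesgue D" unfolding D_def
      by (intro integrable_mult_right lmeasurable_iff_integrable[THEN iffD1, OF lmeasurable_cball])
    moreover have "D \<in> borel_measurable lborel"
      unfolding D_def by (intro borel_measurable_times borel_measurable_const borel_measurable_indicator) simp
    ultimately show ?thesis by (simp add: integrable_completion)
  qed
  have bd: "\<bar>h (x + y) - h x\<bar> ^ q \<le> D x" if "norm y \<le> 1" for x y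
  proof (cases "norm x > R + 1")
    case True
    have "norm x \<le> norm (x + y) + norm y" using norm_triangle_ineq[of "x + y" "- y"] by simp
    then have "norm (x + y) > R" using True that by linarith
    with True h(2) q0 show ?thesis by (simp add: D_def zero_power)
  next
    case False
    have "\<bar>h (x + y) - h x\<bar> \<le> 2 * C" using C[of x] C[of "x+y"] by linarith
    then have "\<bar>h (x + y) - h x\<bar> ^ q \<le> (2 * C) ^ q" by (intro power_mono) auto
    with False show ?thesis by (simp add: D_def)
  qed
  have "((\<lambda>y. LINT x|lborel. \<bar>h (x + y) - h x\<bar> ^ q) \<longlongrightarrow> 0) (at 0)"
    unfolding tendsto_at_iff_sequentially o_def
  proof (intro allI impI)
    fix Y :: "nat \<Rightarrow> 'a" assume Y: "\<forall>i. Y i \<in> UNIV - {0}" "Y \<longlonglongrightarrow> 0"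
    have ev: "\<forall>\<^sub>F n in sequentially. norm (Y n) \<le> 1"
      using tendsto_norm_zero[OF Y(2)] by (auto dest!: order_tendstoD(2)[where a=1] elim!: eventually_mono)
    then obtain n0 where n0: "\<And>n. n \<ge> n0 \<Longrightarrow> norm (Y n) \<le> 1"
      by (auto simp: eventually_sequentially)
    have "(\<lambda>n. LINT x|lborel. \<bar>h (x + Y (n + n0)) - h x\<bar> ^ q) \<longlonglongrightarrow> integral\<^sup>L lborel (\<lambda>x::'a. 0::real)"
    proof (rule integral_dominated_convergence[OF _ _ intD])
      show "AE x in lborel. (\<lambda>n. \<bar>h (x + Y (n + n0)) - h x\<bar> ^ q) \<longlonglongrightarrow> 0"
      proof (intro AE_I2)
        fix x
        have "isCont h x" using h(1) by (simp add: continuous_on_eq_continuous_at)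
        moreover have "(\<lambda>n. x + Y (n + n0)) \<longlonglongrightarrow> x + 0"
          by (intro tendsto_add tendsto_const LIMSEQ_ignore_initial_segment Y)
        ultimately have "(\<lambda>n. h (x + Y (n + n0))) \<longlonglongrightarrow> h x"
          using isCont_tendsto_compose[of x h] by simp
        then have "(\<lambda>n. \<bar>h (x + Y (n + n0)) - h x\<bar> ^ q) \<longlonglongrightarrow> \<bar>h x - h x\<bar> ^ q"
          by (intro tendsto_intros)
        then show "(\<lambda>n. \<bar>h (x + Y (n + n0)) - h x\<bar> ^ q) \<longlonglongrightarrow> 0" using q0 by (simp add: zero_power)
      qed
      show "AE x in lborel. norm (\<bar>h (x + Y (n + n0)) - h x\<bar> ^ q) \<le> D x" for n
        using bd[of "Y (n + n0)"] n0[of "n + n0"] by (intro AE_I2) simp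
    qed measurable
    then show "(\<lambda>n. LINT x|lborel. \<bar>h (x + Y n) - h x\<bar> ^ q) \<longlonglongrightarrow> 0"
      by (simp add: LIMSEQ_offset[where k=n0])
  qed
  then have "\<forall>\<^sub>F y in at 0. (LINT x|lborel. \<bar>h (x + y) - h x\<bar> ^ q) < e / 8"
    using e by (intro order_tendstoD(2)) auto
  then obtain d0 where d0: "d0 > 0"
    "\<And>y. y \<noteq> 0 \<Longrightarrow> norm y < d0 \<Longrightarrow> (LINT x|lborel. \<bar>h (x + y) - h x\<bar> ^ q) < e / 8"
    unfolding eventually_at by (auto simp: dist_norm)
  show thesis
  proof (rule that[of "min d0 1"])
    fix y :: 'a assume y: "norm y < min d0 1"
    define a where "a x = f x - h x" for x
    have [measurable]: "a \<in> borel_measurable borel" unfolding a_def by measurable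
    have a: "integrable lborel (\<lambda>x. \<bar>a x\<bar> ^ q)" "(LINT x|lborel. \<bar>a x\<bar> ^ q) < e / 16"
      using inth' by (simp_all add: a_def)
    have ay: "integrable lborel (\<lambda>x. \<bar>a (x + y)\<bar> ^ q)" "(LINT x|lborel. \<bar>a (x + y)\<bar> ^ q) < e / 16"
      using a lborel_translate[of "\<lambda>x. \<bar>a x\<bar> ^ q" y] by simp_all
    have hy: "(LINT x|lborel. \<bar>h (x + y) - h x\<bar> ^ q) < e / 8"
      using d0(2)[of y] y e q0 by (cases "y = 0") (auto simp: zero_power)
    have hi: "integrable lborel (\<lambda>x. \<bar>h (x + y) - h x\<bar> ^ q)"
      by (rule Bochner_Integration.integrable_bound[OF intD])
        (use y in \<open>auto intro!: AE_I2 order_trans[OF bd abs_ge_self]\<close>)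
    note 1 = Lq_diff_integrable[OF q _ _ ay(1) a(1)]
    \<comment> \<open>The double negation writes a sum as a difference, so that
      \<open>Lq_diff_integrable\<close> covers it.\<close>
    have 2: "integrable lborel (\<lambda>x. \<bar>(a (x + y) - a x) - (- (h (x + y) - h x))\<bar> ^ q)"
      "(LINT x|lborel. \<bar>(a (x + y) - a x) - (- (h (x + y) - h x))\<bar> ^ q)
        \<le> 2 * ((LINT x|lborel. \<bar>a (x + y) - a x\<bar> ^ q) + (LINT x|lborel. \<bar>- (h (x + y) - h x)\<bar> ^ q))"
      by (rule Lq_diff_integrable[OF q]; use 1 hi in \<open>simp add: abs_minus_commute\<close>)+
    have "(LINT x|lborel. \<bar>a (x + y) - a x\<bar> ^ q) \<le> 2 * (e / 16 + e / 16)"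
      using 1(2) ay(2) a(2) by simp
    with 2(2) hy e show "(LINT x|lborel. \<bar>f (x + y) - f x\<bar> ^ q) < e"
      by (simp add: a_def abs_minus_commute)
  qed (use d0 in auto)
qed

lemma conv_borel:
  fixes f :: "'a::euclidean_space \<Rightarrow> real"
  assumes [measurable]: "f \<in> borel_measurable borel" "\<rho> \<in> borel_measurable borel"
  shows "conv f \<rho> p = (LINT y|lborel. f (y + p) * \<rho> y)"
proof -
  have "conv f \<rho> p = (LINT y|lborel. f y * \<rho> (y - p))"
    unfolding conv_def by (rule integral_completion) measurable
  also have "\<dots> = (LINT y|lborel. f (y + p) * \<rho> (y + p - p))"
    by (rule lborel_translate(2)[symmetric]) measurable
  finally show ?thesis by simp
qed

lemma conv_borel_measurable:
  fixes f :: "'a::euclidean_space \<Rightarrow> real"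
  assumes [measurable]: "f \<in> borel_measurable borel" "\<rho> \<in> borel_measurable borel"
  shows "conv f \<rho> \<in> borel_measurable borel"
proof -
  have [measurable]: "(\<lambda>(p, y). f (y + p) * \<rho> y) \<in> borel_measurable (borel \<Otimes>\<^sub>M lborel)" by measurable
  have "(\<lambda>p. LINT y|lborel. f (y + p) * \<rho> y) \<in> borel_measurable borel" by measurable
  moreover have "conv f \<rho> = (\<lambda>p. LINT y|lborel. f (y + p) * \<rho> y)"
    using conv_borel[OF assms] by auto
  ultimately show ?thesis by simp
qed

text \<open>Jensen's inequality for the probability density \<open>\<rho>\<close>. For q = 2 it is
  the nonnegativity of the variance about the mean \<open>c\<close>; the integrability of
  \<open>h\<close> against \<open>\<rho>\<close> follows from |s| <= 1 + |s|^q.\<close>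

lemma abs_weighted_integral_power_le:
  fixes h \<rho> :: "'a \<Rightarrow> real"
  assumes q: "q = 1 \<or> q = (2::nat)"
    and \<rho>: "\<And>y. 0 \<le> \<rho> y" "integrable M \<rho>" "(LINT y|M. \<rho> y) = 1"
    and h: "h \<in> borel_measurable M" "integrable M (\<lambda>y. \<bar>h y\<bar> ^ q * \<rho> y)"
  shows "integrable M (\<lambda>y. h y * \<rho> y)"
    "\<bar>LINT y|M. h y * \<rho> y\<bar> ^ q \<le> (LINT y|M. \<bar>h y\<bar> ^ q * \<rho> y)"
proof -
  have [measurable]: "\<rho> \<in> borel_measurable M" "h \<in> borel_measurable M" using \<rho>(2) h by auto
  have le: "\<bar>s\<bar> \<le> 1 + \<bar>s\<bar> ^ q" for s :: real
  proof -
    have "\<bar>s\<bar> \<le> 1 + \<bar>s\<bar>\<^sup>2"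
      using sum_squares_bound[of 1 "\<bar>s\<bar>"] abs_ge_zero[of s] by (simp add: power2_eq_square)
    then show ?thesis using q by auto
  qed
  show int: "integrable M (\<lambda>y. h y * \<rho> y)"
  proof (rule Bochner_Integration.integrable_bound)
    show "integrable M (\<lambda>y. \<rho> y + \<bar>h y\<bar> ^ q * \<rho> y)" using h \<rho> by simp
    show "AE y in M. norm (h y * \<rho> y) \<le> norm (\<rho> y + \<bar>h y\<bar> ^ q * \<rho> y)"
    proof (intro AE_I2)
      fix y
      have "\<bar>h y\<bar> * \<rho> y \<le> (1 + \<bar>h y\<bar> ^ q) * \<rho> y" by (intro mult_right_mono le \<rho>)
      then show "norm (h y * \<rho> y) \<le> norm (\<rho> y + \<bar>h y\<bar> ^ q * \<rho> y)"
        using \<rho>(1)[of y] by (simp add: abs_mult algebra_simps)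
    qed
  qed measurable
  show "\<bar>LINT y|M. h y * \<rho> y\<bar> ^ q \<le> (LINT y|M. \<bar>h y\<bar> ^ q * \<rho> y)"
    using q
  proof
    assume q1: "q = 1"
    have "\<bar>LINT y|M. h y * \<rho> y\<bar> \<le> (LINT y|M. \<bar>h y * \<rho> y\<bar>)" by (rule integral_abs_bound)
    with q1 \<rho>(1) show ?thesis by (simp add: abs_mult)
  next
    assume q2: "q = 2"
    define c where "c = (LINT y|M. h y * \<rho> y)"
    have i2: "integrable M (\<lambda>y. (h y)\<^sup>2 * \<rho> y)" using h(2) q2 by simp
    have "0 \<le> (LINT y|M. (h y - c)\<^sup>2 * \<rho> y)" using \<rho>(1) by simp
    also have "\<dots> = (LINT y|M. (h y)\<^sup>2 * \<rho> y - (2 * c) * (h y * \<rho> y) + c\<^sup>2 * \<rho> y)"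
      by (rule Bochner_Integration.integral_cong) (auto simp: power2_eq_square algebra_simps)
    also have "\<dots> = (LINT y|M. (h y)\<^sup>2 * \<rho> y) - 2 * c * c + c\<^sup>2"
      using i2 int \<rho> by (simp add: c_def)
    finally show ?thesis using q2 by (simp add: c_def power2_eq_square)
  qed
qed

text \<open>Jensen's inequality at each point \<open>p\<close>, then Tonelli: the error becomes an
  average over \<open>y\<close>, weighted by \<open>\<rho>\<close>, of the L^q distances between
  \<open>f\<close> and its translates. Only shifts in the support of \<open>\<rho>\<close>
  count.\<close>

lemma mollify_estimate:
  fixes f :: "'a::euclidean_space \<Rightarrow> real"
  assumes q: "q = 1 \<or> q = (2::nat)"
    and f: "f \<in> borel_measurable borel" "integrable lborel (\<lambda>x. \<bar>f x\<bar> ^ q)"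
    and \<rho>: "\<rho> \<in> test_functions UNIV" "\<And>y. 0 \<le> \<rho> y" "(LINT y|lebesgue. \<rho> y) = 1"
    and bound: "\<And>y. \<rho> y \<noteq> 0 \<Longrightarrow> (LINT x|lborel. \<bar>f (x + y) - f x\<bar> ^ q) \<le> e"
  shows "integrable lborel (\<lambda>p. \<bar>conv f \<rho> p - f p\<bar> ^ q)"
    "(LINT p|lborel. \<bar>conv f \<rho> p - f p\<bar> ^ q) \<le> e"
proof -
  note [measurable] = f(1) test_borel[OF \<rho>(1)]
  have [measurable]: "conv f \<rho> \<in> borel_measurable borel" by (rule conv_borel_measurable) measurable
  have i\<rho>: "integrable lborel \<rho>" "(LINT y|lborel. \<rho> y) = 1"
    using test_integrable[OF \<rho>(1)] \<rho>(3) by (simp_all add: integrable_completion integral_completion)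
  obtain C where C: "\<And>x. \<bar>\<rho> x\<bar> \<le> C" using test_bounded[OF \<rho>(1)] by metis
  \<comment> \<open>Since \<open>\<rho>\<close> has integral 1 it is nonzero somewhere, so
    \<open>bound\<close> applies at some point and forces \<open>e\<close> to be
    nonnegative.\<close>
  obtain y0 where "\<rho> y0 \<noteq> 0" using i\<rho>(2) by fastforce
  from bound[OF this] have e: "e \<ge> 0"
    by (rule order_trans[rotated]) simp
  have ty: "integrable lborel (\<lambda>x. \<bar>f (x + y)\<bar> ^ q)" for y
    using lborel_translate(1)[of "\<lambda>x. \<bar>f x\<bar> ^ q" y] f by simp
  have J: "\<bar>conv f \<rho> p - f p\<bar> ^ q \<le> (LINT y|lborel. \<bar>f (y + p) - f p\<bar> ^ q * \<rho> y)"
    and I: "integrable lborel (\<lambda>y. \<bar>f (y + p) - f p\<bar> ^ q * \<rho> y)" for p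
  proof -
    have i1: "integrable lborel (\<lambda>y. 2 * (\<bar>f (y + p)\<bar> ^ q * \<rho> y) + 2 * (\<bar>f p\<bar> ^ q * \<rho> y))"
      using integrable_mult_bounded[OF ty[of p], of \<rho> C] i\<rho>(1) C by simp
    show I: "integrable lborel (\<lambda>y. \<bar>f (y + p) - f p\<bar> ^ q * \<rho> y)"
    proof (rule Bochner_Integration.integrable_bound[OF i1])
      show "AE y in lborel. norm (\<bar>f (y + p) - f p\<bar> ^ q * \<rho> y)
          \<le> norm (2 * (\<bar>f (y + p)\<bar> ^ q * \<rho> y) + 2 * (\<bar>f p\<bar> ^ q * \<rho> y))"
      proof (intro AE_I2)
        fix y
        have "\<bar>f (y + p) - f p\<bar> ^ q * \<rho> y \<le> (2 * (\<bar>f (y + p)\<bar> ^ q + \<bar>f p\<bar> ^ q)) * \<rho> y"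
          using abs_add_power_le[OF q, of "f (y + p)" "- f p"] by (intro mult_right_mono \<rho>) simp
        then show "norm (\<bar>f (y + p) - f p\<bar> ^ q * \<rho> y)
          \<le> norm (2 * (\<bar>f (y + p)\<bar> ^ q * \<rho> y) + 2 * (\<bar>f p\<bar> ^ q * \<rho> y))"
          using \<rho>(2)[of y] by (simp add: algebra_simps)
      qed
    qed measurable
    note W = abs_weighted_integral_power_le[OF q \<rho>(2) i\<rho> _ I]
    have "(LINT y|lborel. (f (y + p) - f p) * \<rho> y) = conv f \<rho> p - f p"
    proof -
      have "integrable lborel (\<lambda>y. (f (y + p) - f p) * \<rho> y + f p * \<rho> y)"
        using W(1) i\<rho>(1) by simp
      then have "integrable lborel (\<lambda>y. f (y + p) * \<rho> y)" by (simp add: algebra_simps)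
      with i\<rho> show ?thesis by (simp add: conv_borel left_diff_distrib)
    qed
    with W(2) show "\<bar>conv f \<rho> p - f p\<bar> ^ q \<le> (LINT y|lborel. \<bar>f (y + p) - f p\<bar> ^ q * \<rho> y)"
      by simp
  qed
  have Id: "integrable lborel (\<lambda>p. \<bar>f (p + y) - f p\<bar> ^ q)" for y
    by (rule Lq_diff_integrable[OF q _ _ ty f(2)]) measurable
  have "(\<integral>\<^sup>+p. ennreal (\<bar>conv f \<rho> p - f p\<bar> ^ q) \<partial>lborel)
      \<le> (\<integral>\<^sup>+p. (\<integral>\<^sup>+y. ennreal (\<bar>f (y + p) - f p\<bar> ^ q * \<rho> y) \<partial>lborel) \<partial>lborel)"
  proof (rule nn_integral_mono)
    fix p :: 'a
    have "ennreal (\<bar>conv f \<rho> p - f p\<bar> ^ q) \<le> ennreal (LINT y|lborel. \<bar>f (y + p) - f p\<bar> ^ q * \<rho> y)"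
      by (rule ennreal_leI) (rule J)
    also have "\<dots> = (\<integral>\<^sup>+y. ennreal (\<bar>f (y + p) - f p\<bar> ^ q * \<rho> y) \<partial>lborel)"
      by (rule nn_integral_eq_integral[symmetric, OF I]) (use \<rho> in auto)
    finally show "ennreal (\<bar>conv f \<rho> p - f p\<bar> ^ q) \<le> (\<integral>\<^sup>+y. ennreal (\<bar>f (y + p) - f p\<bar> ^ q * \<rho> y) \<partial>lborel)" .
  qed
  also have "\<dots> = (\<integral>\<^sup>+y. (\<integral>\<^sup>+p. ennreal (\<bar>f (y + p) - f p\<bar> ^ q * \<rho> y) \<partial>lborel) \<partial>lborel)"
    by (rule lborel_pair.Fubini'[symmetric]) measurable
  also have "\<dots> \<le> (\<integral>\<^sup>+y. ennreal (e * \<rho> y) \<partial>lborel)"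
  proof (rule nn_integral_mono)
    fix y :: 'a
    have "(\<integral>\<^sup>+p. ennreal (\<bar>f (y + p) - f p\<bar> ^ q * \<rho> y) \<partial>lborel)
        = (\<integral>\<^sup>+p. ennreal (\<rho> y * \<bar>f (p + y) - f p\<bar> ^ q) \<partial>lborel)" by (simp add: add.commute mult.commute)
    also have "\<dots> = ennreal (LINT p|lborel. \<rho> y * \<bar>f (p + y) - f p\<bar> ^ q)"
      by (rule nn_integral_eq_integral) (use Id \<rho>(2) in auto)
    also have "\<dots> \<le> ennreal (e * \<rho> y)"
    proof (rule ennreal_leI)
      show "(LINT p|lborel. \<rho> y * \<bar>f (p + y) - f p\<bar> ^ q) \<le> e * \<rho> y"
      proof (cases "\<rho> y = 0")
        case False
        then show ?thesis
          using mult_right_mono[OF bound[OF False] \<rho>(2)[of y]] by (simp add: mult.commute)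
      qed simp
    qed
    finally show "(\<integral>\<^sup>+p. ennreal (\<bar>f (y + p) - f p\<bar> ^ q * \<rho> y) \<partial>lborel) \<le> ennreal (e * \<rho> y)" .
  qed
  also have "\<dots> = ennreal (LINT y|lborel. e * \<rho> y)"
    by (rule nn_integral_eq_integral) (use e i\<rho> \<rho>(2) in auto)
  also have "\<dots> = ennreal e" using i\<rho> by simp
  finally have *: "(\<integral>\<^sup>+p. ennreal (\<bar>conv f \<rho> p - f p\<bar> ^ q) \<partial>lborel) \<le> ennreal e" .
  show "integrable lborel (\<lambda>p. \<bar>conv f \<rho> p - f p\<bar> ^ q)"
    by (rule integrableI_bounded) (use * in \<open>auto simp: less_top[symmetric] top_unique intro: le_less_trans\<close>)
  show "(LINT p|lborel. \<bar>conv f \<rho> p - f p\<bar> ^ q) \<le> e"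
    using * e by (subst integral_eq_nn_integral) (auto intro: enn2real_leI)
qed

definition mollifiers :: "(nat \<Rightarrow> 'a::euclidean_space \<Rightarrow> real) \<Rightarrow> bool" where
  "mollifiers \<rho> \<longleftrightarrow> (\<forall>n. \<rho> n \<in> test_functions UNIV \<and> (\<forall>x. 0 \<le> \<rho> n x) \<and>
     (LINT x|lebesgue. \<rho> n x) = 1 \<and> (\<forall>x. \<rho> n x \<noteq> 0 \<longrightarrow> norm x \<le> 1 / real (Suc n)))"

lemma mollifiersD:
  assumes "mollifiers \<rho>"
  shows "\<rho> n \<in> test_functions UNIV" "0 \<le> \<rho> n x" "(LINT x|lebesgue. \<rho> n x) = 1"
    "\<rho> n x \<noteq> 0 \<Longrightarrow> norm x \<le> 1 / real (Suc n)"
  using assms by (auto simp: mollifiers_def)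

lemma mollifiers_exist:
  obtains \<rho> :: "nat \<Rightarrow> 'a::euclidean_space \<Rightarrow> real" where "mollifiers \<rho>"
proof -
  have "\<exists>r :: 'a \<Rightarrow> real. r \<in> test_functions UNIV \<and> (\<forall>x. 0 \<le> r x) \<and>
     (LINT x|lebesgue. r x) = 1 \<and> (\<forall>x. r x \<noteq> 0 \<longrightarrow> norm x \<le> 1 / real (Suc n))" for n
    by (rule mollifier_exists[of "1 / real (Suc n)"]) auto
  then show thesis using that unfolding mollifiers_def by metis
qed

lemma conv_cong_AE:
  assumes "AE x in lebesgue. f x = f' x" "f \<in> borel_measurable lebesgue" "f' \<in> borel_measurable lebesgue"
    "\<rho> \<in> test_functions UNIV"
  shows "conv f \<rho> = conv f' \<rho>"
proof
  fix p
  note [measurable] = assms(2,3) test_borel_lebesgue[OF test_translate[OF assms(4), of p]]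
  show "conv f \<rho> p = conv f' \<rho> p"
    unfolding conv_def by (rule integral_cong_AE) (use assms(1) in auto)
qed

lemma mollify_Lq:
  fixes f :: "'a::euclidean_space \<Rightarrow> real"
  assumes \<rho>: "mollifiers \<rho>" and q: "q = 1 \<or> q = (2::nat)"
    and f: "f \<in> borel_measurable lebesgue" "integrable lebesgue (\<lambda>x. \<bar>f x\<bar> ^ q)"
  shows "conv f (\<rho> n) \<in> borel_measurable lebesgue"
    "integrable lebesgue (\<lambda>p. \<bar>conv f (\<rho> n) p - f p\<bar> ^ q)"
    "(\<lambda>n. LINT p|lebesgue. \<bar>conv f (\<rho> n) p - f p\<bar> ^ q) \<longlonglongrightarrow> 0"
proof -
  obtain f' where f': "f' \<in> borel_measurable borel" "AE x in lebesgue. f x = f' x"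
    using ex_borel_version[OF f(1)] .
  note [measurable] = f(1) f'(1)
  have f'l [measurable]: "f' \<in> borel_measurable lebesgue" by (simp add: measurable_completion)
  have eq: "conv f (\<rho> n) = conv f' (\<rho> n)" for n
    by (rule conv_cong_AE) (use f' mollifiersD[OF \<rho>] in auto)
  have m [measurable]: "conv f' (\<rho> n) \<in> borel_measurable borel" for n
    by (rule conv_borel_measurable[OF f'(1) test_borel[OF mollifiersD(1)[OF \<rho>]]])
  then have ml [measurable]: "conv f' (\<rho> n) \<in> borel_measurable lebesgue" for n
    by (simp add: measurable_completion)
  then show "conv f (\<rho> n) \<in> borel_measurable lebesgue" by (simp add: eq)
  have "integrable lebesgue (\<lambda>x. \<bar>f' x\<bar> ^ q)"
    by (rule integrable_cong_AE_imp[OF f(2)]) (use f'(2) in auto)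
  then have i': "integrable lborel (\<lambda>x. \<bar>f' x\<bar> ^ q)" by (simp add: integrable_completion)
  have ty: "integrable lborel (\<lambda>x. \<bar>f' (x + y)\<bar> ^ q)"
    "(LINT x|lborel. \<bar>f' (x + y)\<bar> ^ q) = (LINT x|lborel. \<bar>f' x\<bar> ^ q)" for y
    using lborel_translate[of "\<lambda>x. \<bar>f' x\<bar> ^ q" y] i' by simp_all
  \<comment> \<open>This crude bound holds for every shift. It gives integrability of the error for
    all indices; smallness is obtained separately for large indices.\<close>
  have "(LINT x|lborel. \<bar>f' (x + y) - f' x\<bar> ^ q) \<le> 4 * (LINT x|lborel. \<bar>f' x\<bar> ^ q)" for y
    using Lq_diff_integrable(2)[OF q _ _ ty(1)[of y] i'] ty(2)[of y] by simp
  then have E: "integrable lborel (\<lambda>p. \<bar>conv f' (\<rho> n) p - f' p\<bar> ^ q)" for n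
    using mollify_estimate(1)[OF q f'(1) i'] mollifiersD[OF \<rho>] by blast
  have ae: "AE p in lebesgue. \<bar>conv f' (\<rho> n) p - f' p\<bar> ^ q = \<bar>conv f (\<rho> n) p - f p\<bar> ^ q" for n
    using f'(2) by eventually_elim (simp add: eq)
  have "integrable lebesgue (\<lambda>p. \<bar>conv f' (\<rho> n) p - f' p\<bar> ^ q)"
    using E[of n] by (simp add: integrable_completion)
  then show "integrable lebesgue (\<lambda>p. \<bar>conv f (\<rho> n) p - f p\<bar> ^ q)"
    by (rule integrable_cong_AE_imp) (use ae in \<open>auto simp: eq\<close>)
  have eqi: "(LINT p|lebesgue. \<bar>conv f (\<rho> n) p - f p\<bar> ^ q) = (LINT p|lborel. \<bar>conv f' (\<rho> n) p - f' p\<bar> ^ q)" for n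
  proof -
    have "(LINT p|lebesgue. \<bar>conv f (\<rho> n) p - f p\<bar> ^ q) = (LINT p|lebesgue. \<bar>conv f' (\<rho> n) p - f' p\<bar> ^ q)"
      by (rule integral_cong_AE) (use ae[of n] in \<open>auto simp: eq\<close>)
    then show ?thesis by (simp add: integral_completion)
  qed
  show "(\<lambda>n. LINT p|lebesgue. \<bar>conv f (\<rho> n) p - f p\<bar> ^ q) \<longlonglongrightarrow> 0"
    unfolding eqi
  proof (rule LIMSEQ_I)
    fix r :: real assume r: "r > 0"
    obtain d where d: "d > 0" "\<And>y. norm y < d \<Longrightarrow> (LINT x|lborel. \<bar>f' (x + y) - f' x\<bar> ^ q) < r / 2"
      using translation_continuous_Lq[OF q f'(1) i', of "r / 2"] r by auto
    obtain n0 where n0: "1 / real (Suc n0) < d" using d(1) nat_approx_posE by blast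
    have "(LINT p|lborel. \<bar>conv f' (\<rho> n) p - f' p\<bar> ^ q) \<le> r / 2" if "n \<ge> n0" for n
    proof (rule mollify_estimate(2)[OF q f'(1) i' mollifiersD(1-3)[OF \<rho>]])
      fix y assume "\<rho> n y \<noteq> 0"
      then have "norm y \<le> 1 / real (Suc n)" using mollifiersD(4)[OF \<rho>] by blast
      also have "\<dots> \<le> 1 / real (Suc n0)" using that by (simp add: frac_le)
      finally show "(LINT x|lborel. \<bar>f' (x + y) - f' x\<bar> ^ q) \<le> r / 2" using n0 d(2)[of y] by simp
    qed
    then show "\<exists>no. \<forall>n\<ge>no. norm ((LINT p|lborel. \<bar>conv f' (\<rho> n) p - f' p\<bar> ^ q) - 0) < r"
      using r by (intro exI[of _ n0]) force
  qed
qed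

section \<open>Chain rule for weak derivatives\<close>

lemma abs_mult_le_weighted_squares:
  fixes a b d :: real
  assumes "d > 0"
  shows "\<bar>a * b\<bar> \<le> d * a\<^sup>2 + b\<^sup>2 / d"
proof -
  have "0 \<le> (d * \<bar>a\<bar> - \<bar>b\<bar>)\<^sup>2" by simp
  then have "2 * (\<bar>a * b\<bar> * d) \<le> d\<^sup>2 * a\<^sup>2 + b\<^sup>2"
    by (simp add: power2_diff power_mult_distrib abs_mult mult_ac)
  moreover have "0 \<le> \<bar>a * b\<bar> * d" using assms by simp
  ultimately have "\<bar>a * b\<bar> * d \<le> d\<^sup>2 * a\<^sup>2 + b\<^sup>2" by linarith
  then have "\<bar>a * b\<bar> \<le> (d\<^sup>2 * a\<^sup>2 + b\<^sup>2) / d" using assms by (simp add: pos_le_divide_eq)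
  also have "\<dots> = d * a\<^sup>2 + b\<^sup>2 / d" using assms by (simp add: add_divide_distrib power2_eq_square)
  finally show ?thesis .
qed

lemma integrable_mult_L2:
  fixes f g :: "'a \<Rightarrow> real"
  assumes [measurable]: "f \<in> borel_measurable M" "g \<in> borel_measurable M"
    and "integrable M (\<lambda>x. (f x)\<^sup>2)" "integrable M (\<lambda>x. (g x)\<^sup>2)"
  shows "integrable M (\<lambda>x. f x * g x)"
proof (rule Bochner_Integration.integrable_bound)
  show "integrable M (\<lambda>x. (f x)\<^sup>2 + (g x)\<^sup>2)" using assms by simp
  show "AE x in M. norm (f x * g x) \<le> norm ((f x)\<^sup>2 + (g x)\<^sup>2)"
    using abs_mult_le_weighted_squares[of 1] by (intro AE_I2) simp
qed measurable

text \<open>A weighted Young inequality plays the role of Cauchy-Schwarz: the weight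
  \<open>d\<close> is so small that the fixed factor \<open>f\<close> contributes less than r/2, and
  late members of the sequence compensate the factor 1/d.\<close>

lemma integral_mult_L2_tendsto_0:
  fixes f :: "'a \<Rightarrow> real"
  assumes [measurable]: "f \<in> borel_measurable M" "\<And>n. g n \<in> borel_measurable M"
    and f: "integrable M (\<lambda>x. (f x)\<^sup>2)" and g: "\<And>n. integrable M (\<lambda>x. (g n x)\<^sup>2)"
    and lim: "(\<lambda>n. LINT x|M. (g n x)\<^sup>2) \<longlonglongrightarrow> 0"
  shows "(\<lambda>n. LINT x|M. f x * g n x) \<longlonglongrightarrow> 0"
proof (rule LIMSEQ_I)
  fix r :: real assume r: "r > 0"
  define A where "A = (LINT x|M. (f x)\<^sup>2)"
  have A: "A \<ge> 0" by (simp add: A_def)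
  define d where "d = r / (2 * (A + 1))"
  have d: "d > 0" "d * A < r / 2" using r A by (auto simp: d_def divide_simps)
  have "d * r / 2 > 0" using d r by simp
  from order_tendstoD(2)[OF lim this]
  obtain n0 where n0: "\<And>n. n \<ge> n0 \<Longrightarrow> (LINT x|M. (g n x)\<^sup>2) < d * r / 2"
    by (auto simp: eventually_sequentially)
  have "norm (LINT x|M. f x * g n x) < r" if "n \<ge> n0" for n
  proof -
    note le = abs_mult_le_weighted_squares[OF d(1)]
    have i: "integrable M (\<lambda>x. f x * g n x)" by (rule integrable_mult_L2[OF _ _ f g]) measurable
    have "\<bar>LINT x|M. f x * g n x\<bar> \<le> (LINT x|M. \<bar>f x * g n x\<bar>)" by (rule integral_abs_bound)
    also have "\<dots> \<le> (LINT x|M. d * (f x)\<^sup>2 + (g n x)\<^sup>2 / d)"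
      by (rule integral_mono) (use i f g le in auto)
    finally have "norm (LINT x|M. f x * g n x) \<le> (LINT x|M. d * (f x)\<^sup>2 + (g n x)\<^sup>2 / d)" by simp
    also have "\<dots> = d * A + (LINT x|M. (g n x)\<^sup>2) / d" using f g by (simp add: A_def)
    also have "\<dots> < r"
    proof -
      have "(LINT x|M. (g n x)\<^sup>2) / d < r / 2"
        using n0[OF that] d(1) by (simp add: pos_divide_less_eq mult.commute)
      with d(2) show ?thesis by linarith
    qed
    finally show ?thesis .
  qed
  then show "\<exists>no. \<forall>n\<ge>no. norm ((LINT x|M. f x * g n x) - 0) < r" by auto
qed

lemma conv_bounded:
  fixes f :: "'a::euclidean_space \<Rightarrow> real"
  assumes f: "integrable lebesgue f" "AE x in lebesgue. \<bar>f x\<bar> \<le> M"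
    and \<rho>: "\<rho> \<in> test_functions UNIV" "\<And>y. 0 \<le> \<rho> y" "(LINT y|lebesgue. \<rho> y) = 1"
  shows "\<bar>conv f \<rho> p\<bar> \<le> M"
proof -
  note t = test_translate[OF \<rho>(1), of p]
  have 1: "(LINT y|lebesgue. \<rho> (y - p)) = 1"
    using conv_borel[of "\<lambda>_. 1" \<rho> p] test_borel[OF \<rho>(1)] \<rho>(3)
    by (simp add: conv_def integral_completion)
  have "\<bar>conv f \<rho> p\<bar> \<le> (LINT y|lebesgue. \<bar>f y * \<rho> (y - p)\<bar>)"
    unfolding conv_def by (rule integral_abs_bound)
  also have "\<dots> \<le> (LINT y|lebesgue. M * \<rho> (y - p))"
  proof (rule integral_mono_AE)
    show "AE y in lebesgue. \<bar>f y * \<rho> (y - p)\<bar> \<le> M * \<rho> (y - p)"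
      using f(2) by eventually_elim (use \<rho>(2) in \<open>auto simp: abs_mult intro: mult_right_mono\<close>)
  qed (use conv_integrable[OF f(1) \<rho>(1)] test_integrable[OF t] in auto)
  also have "\<dots> = M" using 1 by simp
  finally show ?thesis .
qed

text \<open>The translated kernel is itself an admissible test function as soon as the ball of
  radius \<open>r\<close> around \<open>p\<close> lies in \<open>U\<close>. The minus sign from
  differentiating in \<open>p\<close> cancels the one in the weak identity.\<close>

lemma dird_conv_weak:
  fixes f :: "'a::euclidean_space \<Rightarrow> real"
  assumes f: "integrable lebesgue f" and \<rho>: "\<rho> \<in> test_functions UNIV"
    and D: "\<And>\<psi>. \<psi> \<in> test_functions U \<Longrightarrow>
      (LINT x|lebesgue. f x * dird \<psi> e x) = - (LINT x|lebesgue. D x * \<psi> x)"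
    and U: "\<And>y. \<rho> y \<noteq> 0 \<Longrightarrow> norm y \<le> r" "cball p r \<subseteq> U"
  shows "dird (conv f \<rho>) e p = conv D \<rho> p"
proof -
  have s: "smooth (\<lambda>y. \<rho> (y - p))" by (rule test_smooth[OF test_translate[OF \<rho>]])
  have t: "(\<lambda>y. \<rho> (y - p)) \<in> test_functions U"
    by (rule test_functionsI[OF s compact_cball[of p r] U(2)])
      (use U(1) in \<open>force simp: dist_norm norm_minus_commute\<close>)
  have "dird (\<lambda>y. \<rho> (y - p)) e y = dird \<rho> e (y - p)" for y
    using dird_affine[OF test_smooth[OF \<rho>] bounded_linear_ident, of "- p" y e] by simp
  then show ?thesis
    using D[OF t] unfolding dird_conv[OF f \<rho>] by (simp add: conv_def)
qed

lemma test_power_integrable: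
  fixes \<phi> :: "'a::euclidean_space \<Rightarrow> real"
  assumes "\<phi> \<in> test_functions S" "q = 1 \<or> q = (2::nat)"
  shows "integrable lebesgue (\<lambda>x. \<bar>\<phi> x\<bar> ^ q)"
  using assms(2)
proof
  assume "q = 2"
  then show ?thesis
    using test_integrable[OF test_mult[OF assms(1) test_smooth[OF assms(1)]]]
    by (simp add: power2_eq_square)
qed (use test_integrable[OF assms(1)] in auto)

lemma smooth_bounded_on_interval:
  fixes H :: "real \<Rightarrow> real"
  assumes "smooth H"
  obtains C where "0 \<le> C" "\<And>s. \<bar>s\<bar> \<le> M \<Longrightarrow> \<bar>H s\<bar> \<le> C"
proof -
  have "bounded (H ` {-M..M})"
    by (intro compact_imp_bounded compact_continuous_image smooth_continuous_on assms) auto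
  then obtain C where "\<And>s. s \<in> {-M..M} \<Longrightarrow> \<bar>H s\<bar> \<le> C" by (force simp: bounded_iff)
  then have "\<bar>H s\<bar> \<le> max C 0" if "\<bar>s\<bar> \<le> M" for s using that by (smt (verit) atLeastAtMost_iff)
  with that[of "max C 0"] show thesis by auto
qed

lemma smooth_borel: "smooth (H :: 'a::euclidean_space \<Rightarrow> real) \<Longrightarrow> H \<in> borel_measurable borel"
  by (intro borel_measurable_continuous_onI smooth_continuous_on)

text \<open>The witnesses are \<open>\<zeta> \<cdot> H(f\<^sub>n)\<close> with mollifications \<open>f\<^sub>n\<close> of \<open>f\<close>. They are test functions
  themselves, so a weak equation may be tested with them before passing to the limit.\<close>

lemma weak_chain_rule_approx:
  fixes f :: "'a::euclidean_space \<Rightarrow> real"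
  assumes U: "open U" and f: "integrable lebesgue f" "AE x in lebesgue. \<bar>f x\<bar> \<le> M"
    and \<zeta>: "\<zeta> \<in> test_functions U" and H: "smooth H"
  obtains \<phi> C where "\<And>n::nat. \<phi> n \<in> test_functions U" "\<And>n x. \<bar>\<phi> n x\<bar> \<le> C"
    "AE x in lebesgue. (\<lambda>n. \<phi> n x) \<longlonglongrightarrow> \<zeta> x * H (f x)"
    "\<And>q e D. q = 1 \<or> q = (2::nat) \<Longrightarrow> D \<in> borel_measurable lebesgue \<Longrightarrow>
      integrable lebesgue (\<lambda>x. \<bar>D x\<bar> ^ q) \<Longrightarrow>
      (\<And>\<psi>. \<psi> \<in> test_functions U \<Longrightarrow>
        (LINT x|lebesgue. f x * dird \<psi> e x) = - (LINT x|lebesgue. D x * \<psi> x)) \<Longrightarrow>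
      (\<forall>n. integrable lebesgue (\<lambda>x. \<bar>dird (\<phi> n) e x -
         (dird \<zeta> e x * H (f x) + \<zeta> x * dird H 1 (f x) * D x)\<bar> ^ q)) \<and>
      (\<lambda>n. LINT x|lebesgue. \<bar>dird (\<phi> n) e x -
         (dird \<zeta> e x * H (f x) + \<zeta> x * dird H 1 (f x) * D x)\<bar> ^ q) \<longlonglongrightarrow> 0"
proof -
  obtain \<rho> :: "nat \<Rightarrow> 'a \<Rightarrow> real" where \<rho>: "mollifiers \<rho>" using mollifiers_exist .
  note \<rho>D = mollifiersD[OF \<rho>]
  have fm [measurable]: "f \<in> borel_measurable lebesgue" using f(1) by auto
  obtain K where K: "smooth \<zeta>" "compact K" "K \<subseteq> U" "\<And>x. \<zeta> x \<noteq> 0 \<Longrightarrow> x \<in> K"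
    using test_functionsE[OF \<zeta>] by blast
  \<comment> \<open>\<open>d\<close> is a safety distance between the support of
    \<open>\<zeta>\<close> and the complement of \<open>U\<close>. Kernels of radius below
    \<open>d\<close>, guaranteed from index \<open>n0\<close> on, never leave \<open>U\<close> when
    centred in that support.\<close>
  obtain d where d: "d > 0" "(\<Union>x\<in>K. cball x d) \<subseteq> U"
    by (rule compact_subset_open_imp_cball_epsilon_subset[OF K(2) U K(3)])
  obtain n0 where n0: "1 / real (Suc n0) < d" using d(1) nat_approx_posE by blast
  note ML1 = mollify_Lq[OF \<rho>, of 1 f]
  \<comment> \<open>L^1 convergence of the mollifications gives almost everywhere convergence along
    a subsequence, which is needed to pass to the limit inside the nonlinear
    \<open>H\<close>.\<close>
  have "\<exists>r::nat\<Rightarrow>nat. strict_mono r \<and> (AE x in lebesgue. (\<lambda>n. conv f (\<rho> (r n)) x - f x) \<longlonglongrightarrow> 0)"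
  proof (rule tendsto_L1_AE_subseq)
    show "integrable lebesgue (\<lambda>x. conv f (\<rho> n) x - f x)" for n
    proof -
      have c: "conv f (\<rho> n) \<in> borel_measurable lebesgue" using ML1(1) f(1) by simp
      have "integrable lebesgue (\<lambda>p. \<bar>conv f (\<rho> n) p - f p\<bar>)" using ML1(2)[of n] f(1) by simp
      then show ?thesis
        by (rule integrable_abs_iff[THEN iffD1, rotated]) (use c fm in simp)
    qed
    show "(\<lambda>n. LINT x|lebesgue. norm (conv f (\<rho> n) x - f x)) \<longlonglongrightarrow> 0"
      using ML1(3) f(1) by (simp add: real_norm_def)
  qed
  then obtain r0 :: "nat \<Rightarrow> nat" where r0: "strict_mono r0"
    "AE x in lebesgue. (\<lambda>n. conv f (\<rho> (r0 n)) x - f x) \<longlonglongrightarrow> 0" by blast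
  define r where "r n = r0 (n + n0)" for n
  have rge: "r n \<ge> n0" for n using seq_suble[OF r0(1), of "n + n0"] by (simp add: r_def)
  have rlim: "filterlim r at_top sequentially"
    unfolding r_def by (rule filterlim_compose[OF filterlim_subseq[OF r0(1)] filterlim_add_const_nat_at_top])
  define F where "F n = conv f (\<rho> (r n))" for n
  have Fs: "smooth (F n)" for n unfolding F_def by (rule smooth_conv[OF f(1) \<rho>D(1)])
  have Fb: "\<bar>F n x\<bar> \<le> M" for n x unfolding F_def by (rule conv_bounded[OF f \<rho>D(1-3)])
  have Flim: "AE x in lebesgue. (\<lambda>n. F n x) \<longlonglongrightarrow> f x"
    using r0(2)
  proof eventually_elim
    case (elim x)
    then have "(\<lambda>n. conv f (\<rho> (r0 n)) x) \<longlonglongrightarrow> f x" by (simp add: LIM_zero_iff)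
    then show ?case unfolding F_def r_def by (rule LIMSEQ_ignore_initial_segment)
  qed
  have Fm [measurable]: "F n \<in> borel_measurable lebesgue" for n
    unfolding F_def by (rule ML1(1)) (use f in auto)
  have Hm [measurable]: "H \<in> borel_measurable borel" "dird H 1 \<in> borel_measurable borel"
    using smooth_borel H smooth_dird by blast+
  have \<zeta>m [measurable]: "\<zeta> \<in> borel_measurable lebesgue" "dird \<zeta> e \<in> borel_measurable lebesgue" for e
    using test_borel_lebesgue \<zeta> test_dird[OF \<zeta>] by blast+
  obtain C1 where C1: "0 \<le> C1" "\<And>s. \<bar>s\<bar> \<le> M \<Longrightarrow> \<bar>H s\<bar> \<le> C1" using smooth_bounded_on_interval[OF H] by blast
  obtain C2 where C2: "0 \<le> C2" "\<And>s. \<bar>s\<bar> \<le> M \<Longrightarrow> \<bar>dird H 1 s\<bar> \<le> C2"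
    using smooth_bounded_on_interval[OF smooth_dird[OF H]] by blast
  obtain Z where Z: "0 \<le> Z" "\<And>x. \<bar>\<zeta> x\<bar> \<le> Z" using test_bounded[OF \<zeta>] by blast
  define \<phi> where "\<phi> n x = \<zeta> x * H (F n x)" for n x
  have \<phi>t: "\<phi> n \<in> test_functions U" for n
    unfolding \<phi>_def by (rule test_mult[OF \<zeta> smooth_compose[OF H Fs]])
  have lims: "AE x in lebesgue. (\<lambda>n. H (F n x)) \<longlonglongrightarrow> H (f x)" "AE x in lebesgue. (\<lambda>n. dird H 1 (F n x)) \<longlonglongrightarrow> dird H 1 (f x)"
  proof -
    have "isCont H s" "isCont (dird H 1) s" for s
      using smooth_continuous_on[OF H, of UNIV] smooth_continuous_on[OF smooth_dird[OF H, of 1], of UNIV]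
      by (auto simp: continuous_on_eq_continuous_at)
    note c = isCont_tendsto_compose[OF this(1)] isCont_tendsto_compose[OF this(2)]
    show "AE x in lebesgue. (\<lambda>n. H (F n x)) \<longlonglongrightarrow> H (f x)" using Flim by eventually_elim (rule c(1))
    show "AE x in lebesgue. (\<lambda>n. dird H 1 (F n x)) \<longlonglongrightarrow> dird H 1 (f x)" using Flim by eventually_elim (rule c(2))
  qed
  show thesis
  proof (rule that[of \<phi> "Z * C1"])
    show "\<phi> n \<in> test_functions U" for n by (rule \<phi>t)
    show "\<bar>\<phi> n x\<bar> \<le> Z * C1" for n x
      unfolding \<phi>_def abs_mult by (intro mult_mono Z C1 Fb) auto
    show "AE x in lebesgue. (\<lambda>n. \<phi> n x) \<longlonglongrightarrow> \<zeta> x * H (f x)"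
      using lims(1) unfolding \<phi>_def by eventually_elim (intro tendsto_intros)
    \<comment> \<open>The sequence \<open>\<phi>\<close> is already fixed here, so one sequence
      serves all directions, as is needed when a sum over coordinates is tested.\<close>
    fix q :: nat and e D
    assume q: "q = 1 \<or> q = 2" and D [measurable]: "D \<in> borel_measurable lebesgue"
      and iD: "integrable lebesgue (\<lambda>x. \<bar>D x\<bar> ^ q)"
      and weak: "\<And>\<psi>. \<psi> \<in> test_functions U \<Longrightarrow>
        (LINT x|lebesgue. f x * dird \<psi> e x) = - (LINT x|lebesgue. D x * \<psi> x)"
    have q0: "q > 0" using q by auto
    define L where "L x = dird \<zeta> e x * H (f x) + \<zeta> x * dird H 1 (f x) * D x" for x
    \<comment> \<open>The error splits into \<open>A\<close>, where only the coefficients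
      \<open>H\<close> and \<open>dird H 1\<close> vary while \<open>D\<close> is fixed, and
      \<open>B\<close>, where \<open>D\<close> is compared with its mollification. \<open>A\<close>
      is controlled by domination, \<open>B\<close> by \<open>mollify_Lq\<close>.\<close>
    define A where "A n x = dird \<zeta> e x * (H (F n x) - H (f x)) + \<zeta> x * (dird H 1 (F n x) - dird H 1 (f x)) * D x" for n x
    define B where "B n x = \<zeta> x * dird H 1 (F n x) * (conv D (\<rho> (r n)) x - D x)" for n x
    note MD = mollify_Lq[OF \<rho> q D iD]
    have [measurable]: "L \<in> borel_measurable lebesgue" "A n \<in> borel_measurable lebesgue"
      "B n \<in> borel_measurable lebesgue" for n
      using MD(1)[of "r n"] unfolding L_def A_def B_def by measurable
    \<comment> \<open>The derivative of \<open>F n\<close> equals the mollified \<open>D\<close>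
      only near the support of \<open>\<zeta>\<close>; elsewhere it is multiplied by 0.\<close>
    have eq: "dird (\<phi> n) e x - L x = A n x + B n x" for n x
    proof (cases "\<zeta> x = 0")
      case True
      then show ?thesis
        unfolding \<phi>_def dird_mult[OF K(1) smooth_compose[OF H Fs]] by (simp add: L_def A_def B_def algebra_simps)
    next
      case False
      have "1 / real (Suc (r n)) \<le> 1 / real (Suc n0)" using rge[of n] by (simp add: frac_le)
      then have "cball x (1 / real (Suc (r n))) \<subseteq> U"
        using d(2) K(4)[OF False] n0 subset_cball[of "1 / real (Suc (r n))" d x] by fastforce
      then have "dird (F n) e x = conv D (\<rho> (r n)) x"
        unfolding F_def by (intro dird_conv_weak[OF f(1) \<rho>D(1) weak \<rho>D(4)]) auto
      then show ?thesis
        unfolding \<phi>_def dird_mult[OF K(1) smooth_compose[OF H Fs]] dird_compose[OF H Fs]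
        by (simp add: L_def A_def B_def algebra_simps)
    qed
    define w where "w x = 2 * C1 * \<bar>dird \<zeta> e x\<bar> - (- (2 * C2 * Z * \<bar>D x\<bar>))" for x
    have wi: "integrable lebesgue (\<lambda>x. \<bar>w x\<bar> ^ q)"
      unfolding w_def
    proof (rule Lq_diff_integrable(1)[OF q])
      show "integrable lebesgue (\<lambda>x. \<bar>2 * C1 * \<bar>dird \<zeta> e x\<bar>\<bar> ^ q)"
        using test_power_integrable[OF test_dird[OF \<zeta>, of e] q] by (simp add: abs_mult power_mult_distrib)
      show "integrable lebesgue (\<lambda>x. \<bar>- (2 * C2 * Z * \<bar>D x\<bar>)\<bar> ^ q)"
        using iD by (simp add: abs_mult power_mult_distrib)
    qed measurable
    have Aw: "AE x in lebesgue. \<bar>A n x\<bar> ^ q \<le> \<bar>w x\<bar> ^ q" for n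
      using f(2)
    proof eventually_elim
      case (elim x)
      have "\<bar>A n x\<bar> \<le> \<bar>dird \<zeta> e x\<bar> * \<bar>H (F n x) - H (f x)\<bar> + \<bar>\<zeta> x\<bar> * \<bar>dird H 1 (F n x) - dird H 1 (f x)\<bar> * \<bar>D x\<bar>"
        unfolding A_def by (simp add: abs_mult[symmetric] abs_triangle_ineq)
      also have "\<dots> \<le> \<bar>dird \<zeta> e x\<bar> * (2 * C1) + Z * (2 * C2) * \<bar>D x\<bar>"
        using C1(2)[OF Fb[of n x]] C1(2)[OF elim] C2(2)[OF Fb[of n x]] C2(2)[OF elim] Z C2(1)
        by (intro add_mono mult_mono) auto
      finally show ?case by (intro power_mono) (auto simp: w_def mult_ac)
    qed
    have Ai: "integrable lebesgue (\<lambda>x. \<bar>A n x\<bar> ^ q)" for n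
      by (rule Bochner_Integration.integrable_bound[OF wi]) (use Aw in auto)
    have "(\<lambda>n. LINT x|lebesgue. \<bar>A n x\<bar> ^ q) \<longlonglongrightarrow> integral\<^sup>L lebesgue (\<lambda>x::'a. 0::real)"
    proof (rule integral_dominated_convergence[OF _ _ wi])
      show "AE x in lebesgue. (\<lambda>n. \<bar>A n x\<bar> ^ q) \<longlonglongrightarrow> 0"
        using lims
      proof eventually_elim
        case (elim x)
        have "(\<lambda>n. \<bar>A n x\<bar> ^ q) \<longlonglongrightarrow> \<bar>dird \<zeta> e x * (H (f x) - H (f x)) + \<zeta> x * (dird H 1 (f x) - dird H 1 (f x)) * D x\<bar> ^ q"
          unfolding A_def by (intro tendsto_intros elim)
        then show ?case using q0 by (simp add: zero_power)
      qed
    qed (use Aw in auto)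
    then have Alim: "(\<lambda>n. LINT x|lebesgue. \<bar>A n x\<bar> ^ q) \<longlonglongrightarrow> 0" by simp
    define c where "c n = (LINT x|lebesgue. \<bar>conv D (\<rho> (r n)) x - D x\<bar> ^ q)" for n
    have clim: "c \<longlonglongrightarrow> 0" unfolding c_def using filterlim_compose[OF MD(3) rlim] .
    have Bb: "\<bar>B n x\<bar> ^ q \<le> (Z * C2) ^ q * \<bar>conv D (\<rho> (r n)) x - D x\<bar> ^ q" for n x
    proof -
      have "\<bar>B n x\<bar> \<le> Z * C2 * \<bar>conv D (\<rho> (r n)) x - D x\<bar>"
        unfolding B_def abs_mult by (intro mult_mono Z C2 Fb) (use Z C2 in auto)
      then have "\<bar>B n x\<bar> ^ q \<le> (Z * C2 * \<bar>conv D (\<rho> (r n)) x - D x\<bar>) ^ q" by (intro power_mono) auto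
      then show ?thesis by (simp add: power_mult_distrib)
    qed
    have ic: "integrable lebesgue (\<lambda>x. (Z * C2) ^ q * \<bar>conv D (\<rho> (r n)) x - D x\<bar> ^ q)" for n
      using MD(2) by simp
    have Bi: "integrable lebesgue (\<lambda>x. \<bar>B n x\<bar> ^ q)" for n
      by (rule Bochner_Integration.integrable_bound[OF ic])
        (auto intro!: AE_I2 order_trans[OF Bb abs_ge_self])
    have BI: "(LINT x|lebesgue. \<bar>B n x\<bar> ^ q) \<le> (Z * C2) ^ q * c n" for n
      using integral_mono[OF Bi ic Bb] by (simp add: c_def)
    have Bi': "integrable lebesgue (\<lambda>x. \<bar>- B n x\<bar> ^ q)" for n using Bi by simp
    note S = Lq_diff_integrable[OF q _ _ Ai Bi']
    have Ii: "integrable lebesgue (\<lambda>x. \<bar>dird (\<phi> n) e x - L x\<bar> ^ q)" for n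
      using S(1)[of n n] unfolding eq by simp
    have Il: "(\<lambda>n. LINT x|lebesgue. \<bar>dird (\<phi> n) e x - L x\<bar> ^ q) \<longlonglongrightarrow> 0"
    proof (rule tendsto_sandwich[where f = "\<lambda>_. 0", OF always_eventually always_eventually])
      show "\<forall>n. (LINT x|lebesgue. \<bar>dird (\<phi> n) e x - L x\<bar> ^ q)
          \<le> 2 * ((LINT x|lebesgue. \<bar>A n x\<bar> ^ q) + (Z * C2) ^ q * c n)"
      proof
        fix n
        have "(LINT x|lebesgue. \<bar>A n x - - B n x\<bar> ^ q)
            \<le> 2 * ((LINT x|lebesgue. \<bar>A n x\<bar> ^ q) + (LINT x|lebesgue. \<bar>- B n x\<bar> ^ q))"
          by (rule S(2)) measurable
        with BI[of n] show "(LINT x|lebesgue. \<bar>dird (\<phi> n) e x - L x\<bar> ^ q)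
            \<le> 2 * ((LINT x|lebesgue. \<bar>A n x\<bar> ^ q) + (Z * C2) ^ q * c n)"
          unfolding eq by simp
      qed
      have "(\<lambda>n. 2 * ((LINT x|lebesgue. \<bar>A n x\<bar> ^ q) + (Z * C2) ^ q * c n)) \<longlonglongrightarrow> 2 * (0 + (Z * C2) ^ q * 0)"
        by (intro tendsto_intros Alim clim)
      then show "(\<lambda>n. 2 * ((LINT x|lebesgue. \<bar>A n x\<bar> ^ q) + (Z * C2) ^ q * c n)) \<longlonglongrightarrow> 0" by simp
    qed auto
    show "(\<forall>n. integrable lebesgue (\<lambda>x. \<bar>dird (\<phi> n) e x -
         (dird \<zeta> e x * H (f x) + \<zeta> x * dird H 1 (f x) * D x)\<bar> ^ q)) \<and>
      (\<lambda>n. LINT x|lebesgue. \<bar>dird (\<phi> n) e x -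
         (dird \<zeta> e x * H (f x) + \<zeta> x * dird H 1 (f x) * D x)\<bar> ^ q) \<longlonglongrightarrow> 0"
      using Ii Il unfolding L_def by simp
  qed
qed

text \<open>The integral of a directional derivative of a test function is 0, and L^1 convergence
  carries this to the limit \<open>L\<close>. Applied below in the time direction.\<close>

lemma weak_chain_rule_L1:
  fixes f :: "'a::euclidean_space \<Rightarrow> real"
  assumes U: "open U" and f: "integrable lebesgue f" "AE x in lebesgue. \<bar>f x\<bar> \<le> M"
    and \<zeta>: "\<zeta> \<in> test_functions U" and H: "smooth H"
    and D: "integrable lebesgue D" "\<And>\<psi>. \<psi> \<in> test_functions U \<Longrightarrow>
        (LINT x|lebesgue. f x * dird \<psi> e x) = - (LINT x|lebesgue. D x * \<psi> x)"
  shows "(LINT x|lebesgue. dird \<zeta> e x * H (f x) + \<zeta> x * dird H 1 (f x) * D x) = 0"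
proof -
  define L where "L x = dird \<zeta> e x * H (f x) + \<zeta> x * dird H 1 (f x) * D x" for x
  have [measurable]: "f \<in> borel_measurable lebesgue" "D \<in> borel_measurable lebesgue" using f(1) D(1) by auto
  have [measurable]: "H \<in> borel_measurable borel" "dird H 1 \<in> borel_measurable borel"
    "\<zeta> \<in> borel_measurable lebesgue" "dird \<zeta> e \<in> borel_measurable lebesgue"
    using smooth_borel H smooth_dird test_borel_lebesgue \<zeta> test_dird[OF \<zeta>] by blast+
  have Lm [measurable]: "L \<in> borel_measurable lebesgue" unfolding L_def by measurable
  obtain \<phi> :: "nat \<Rightarrow> 'a \<Rightarrow> real" where \<phi>: "\<And>n. \<phi> n \<in> test_functions U"
    and lim: "\<And>n. integrable lebesgue (\<lambda>x. \<bar>dird (\<phi> n) e x - L x\<bar>)"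
      "(\<lambda>n. LINT x|lebesgue. \<bar>dird (\<phi> n) e x - L x\<bar>) \<longlonglongrightarrow> 0"
  proof (rule weak_chain_rule_approx[OF U f \<zeta> H])
    fix \<phi> :: "nat \<Rightarrow> 'a \<Rightarrow> real" and C
    assume 1: "\<And>n. \<phi> n \<in> test_functions U"
      and 2: "\<And>q e D. q = 1 \<or> q = (2::nat) \<Longrightarrow> D \<in> borel_measurable lebesgue \<Longrightarrow>
      integrable lebesgue (\<lambda>x. \<bar>D x\<bar> ^ q) \<Longrightarrow>
      (\<And>\<psi>. \<psi> \<in> test_functions U \<Longrightarrow>
        (LINT x|lebesgue. f x * dird \<psi> e x) = - (LINT x|lebesgue. D x * \<psi> x)) \<Longrightarrow>
      (\<forall>n. integrable lebesgue (\<lambda>x. \<bar>dird (\<phi> n) e x -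
         (dird \<zeta> e x * H (f x) + \<zeta> x * dird H 1 (f x) * D x)\<bar> ^ q)) \<and>
      (\<lambda>n. LINT x|lebesgue. \<bar>dird (\<phi> n) e x -
         (dird \<zeta> e x * H (f x) + \<zeta> x * dird H 1 (f x) * D x)\<bar> ^ q) \<longlonglongrightarrow> 0"
    have "(\<forall>n. integrable lebesgue (\<lambda>x. \<bar>dird (\<phi> n) e x - L x\<bar> ^ 1)) \<and>
      (\<lambda>n. LINT x|lebesgue. \<bar>dird (\<phi> n) e x - L x\<bar> ^ 1) \<longlonglongrightarrow> 0"
      unfolding L_def by (rule 2) (use D in auto)
    then show thesis by (intro that[OF 1]) auto
  qed
  have \<phi>m [measurable]: "dird (\<phi> n) e \<in> borel_measurable lebesgue" for n
    by (rule test_borel_lebesgue[OF test_dird[OF \<phi>]])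
  have i\<phi>: "integrable lebesgue (dird (\<phi> n) e)" for n by (rule test_integrable[OF test_dird[OF \<phi>]])
  have id: "integrable lebesgue (\<lambda>x. dird (\<phi> n) e x - L x)" for n
    by (rule integrable_abs_iff[THEN iffD1, OF _ lim(1)]) measurable
  have iL: "integrable lebesgue L"
    using Bochner_Integration.integrable_diff[OF i\<phi>[of 0] id[of 0]] by simp
  have "\<bar>LINT x|lebesgue. L x\<bar> \<le> (LINT x|lebesgue. \<bar>dird (\<phi> n) e x - L x\<bar>)" for n
  proof -
    have "(LINT x|lebesgue. dird (\<phi> n) e x - L x) = - (LINT x|lebesgue. L x)"
      using i\<phi> iL integral_dird_test[OF \<phi>] by simp
    then show ?thesis
      using integral_abs_bound[of lebesgue "\<lambda>x. dird (\<phi> n) e x - L x"] by simp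
  qed
  then have "\<bar>LINT x|lebesgue. L x\<bar> \<le> 0"
    using LIMSEQ_le_const[OF lim(2)] by blast
  then show ?thesis by (simp add: L_def)
qed

text \<open>The flux terms converge because both \<open>F i\<close> and the derivatives of the
  approximants are handled in L^2, strongly in the latter. The term with \<open>g\<close>, which is
  merely integrable, converges by domination: the approximants are uniformly bounded. Weak
  derivatives of \<open>f\<close> enter only along the directions \<open>e i\<close>.\<close>

lemma weak_chain_rule_L2:
  fixes f :: "'a::euclidean_space \<Rightarrow> real"
  assumes U: "open U" and f: "integrable lebesgue f" "AE x in lebesgue. \<bar>f x\<bar> \<le> M"
    and \<zeta>: "\<zeta> \<in> test_functions U" and H: "smooth H"
    and D: "\<And>i. i \<in> I \<Longrightarrow> D i \<in> borel_measurable lebesgue"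
      "\<And>i. i \<in> I \<Longrightarrow> integrable lebesgue (\<lambda>x. (D i x)\<^sup>2)"
      "\<And>i \<psi>. i \<in> I \<Longrightarrow> \<psi> \<in> test_functions U \<Longrightarrow>
        (LINT x|lebesgue. f x * dird \<psi> (e i) x) = - (LINT x|lebesgue. D i x * \<psi> x)"
    and F: "\<And>i. i \<in> I \<Longrightarrow> F i \<in> borel_measurable lebesgue"
      "\<And>i. i \<in> I \<Longrightarrow> integrable lebesgue (\<lambda>x. (F i x)\<^sup>2)"
    and g: "integrable lebesgue g" "\<And>\<psi>. \<psi> \<in> test_functions U \<Longrightarrow>
        (LINT x|lebesgue. g x * \<psi> x) = - (\<Sum>i\<in>I. LINT x|lebesgue. F i x * dird \<psi> (e i) x)"
  shows "(LINT x|lebesgue. g x * (\<zeta> x * H (f x))) =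
      - (\<Sum>i\<in>I. LINT x|lebesgue. F i x * (dird \<zeta> (e i) x * H (f x) + \<zeta> x * dird H 1 (f x) * D i x))"
    "\<And>i. i \<in> I \<Longrightarrow> integrable lebesgue
       (\<lambda>x. F i x * (dird \<zeta> (e i) x * H (f x) + \<zeta> x * dird H 1 (f x) * D i x))"
proof -
  define L where "L i x = dird \<zeta> (e i) x * H (f x) + \<zeta> x * dird H 1 (f x) * D i x" for i x
  note [measurable] = D(1) F(1)
  have [measurable]: "f \<in> borel_measurable lebesgue" "g \<in> borel_measurable lebesgue" using f(1) g(1) by auto
  have [measurable]: "H \<in> borel_measurable borel" "dird H 1 \<in> borel_measurable borel"
    "\<zeta> \<in> borel_measurable lebesgue" "\<And>e. dird \<zeta> e \<in> borel_measurable lebesgue"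
    using smooth_borel H smooth_dird test_borel_lebesgue \<zeta> test_dird[OF \<zeta>] by blast+
  have Lm [measurable]: "i \<in> I \<Longrightarrow> L i \<in> borel_measurable lebesgue" for i unfolding L_def by measurable
  obtain \<phi> :: "nat \<Rightarrow> 'a \<Rightarrow> real" and C where \<phi>: "\<And>n. \<phi> n \<in> test_functions U"
    "\<And>n x. \<bar>\<phi> n x\<bar> \<le> C" "AE x in lebesgue. (\<lambda>n. \<phi> n x) \<longlonglongrightarrow> \<zeta> x * H (f x)"
    and lim: "\<And>i n. i \<in> I \<Longrightarrow> integrable lebesgue (\<lambda>x. (dird (\<phi> n) (e i) x - L i x)\<^sup>2)"
      "\<And>i. i \<in> I \<Longrightarrow> (\<lambda>n. LINT x|lebesgue. (dird (\<phi> n) (e i) x - L i x)\<^sup>2) \<longlonglongrightarrow> 0"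
  proof (rule weak_chain_rule_approx[OF U f \<zeta> H])
    fix \<phi> :: "nat \<Rightarrow> 'a \<Rightarrow> real" and C
    assume 1: "\<And>n. \<phi> n \<in> test_functions U" "\<And>n x. \<bar>\<phi> n x\<bar> \<le> C"
        "AE x in lebesgue. (\<lambda>n. \<phi> n x) \<longlonglongrightarrow> \<zeta> x * H (f x)"
      and 2: "\<And>q e D. q = 1 \<or> q = (2::nat) \<Longrightarrow> D \<in> borel_measurable lebesgue \<Longrightarrow>
      integrable lebesgue (\<lambda>x. \<bar>D x\<bar> ^ q) \<Longrightarrow>
      (\<And>\<psi>. \<psi> \<in> test_functions U \<Longrightarrow>
        (LINT x|lebesgue. f x * dird \<psi> e x) = - (LINT x|lebesgue. D x * \<psi> x)) \<Longrightarrow>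
      (\<forall>n. integrable lebesgue (\<lambda>x. \<bar>dird (\<phi> n) e x -
         (dird \<zeta> e x * H (f x) + \<zeta> x * dird H 1 (f x) * D x)\<bar> ^ q)) \<and>
      (\<lambda>n. LINT x|lebesgue. \<bar>dird (\<phi> n) e x -
         (dird \<zeta> e x * H (f x) + \<zeta> x * dird H 1 (f x) * D x)\<bar> ^ q) \<longlonglongrightarrow> 0"
    have 3: "(\<forall>n. integrable lebesgue (\<lambda>x. \<bar>dird (\<phi> n) (e i) x - L i x\<bar> ^ 2)) \<and>
      (\<lambda>n. LINT x|lebesgue. \<bar>dird (\<phi> n) (e i) x - L i x\<bar> ^ 2) \<longlonglongrightarrow> 0" if "i \<in> I" for i
      unfolding L_def by (rule 2) (use D that in auto)
    show thesis by (rule that[OF 1]) (use 3 in auto)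
  qed
  have \<phi>m [measurable]: "\<phi> n \<in> borel_measurable lebesgue" "dird (\<phi> n) e \<in> borel_measurable lebesgue" for n e
    using test_borel_lebesgue[OF test_dird[OF \<phi>(1)]] test_borel_lebesgue[OF \<phi>(1)] by auto
  have i\<phi>: "integrable lebesgue (\<lambda>x. F i x * dird (\<phi> n) (e i) x)" if "i \<in> I" for i n
    using integrable_mult_L2[OF F(1)[OF that] \<phi>m(2) F(2)[OF that], of n "e i"]
      test_power_integrable[OF test_dird[OF \<phi>(1)[of n]], of 2 "e i"] by simp
  have id: "integrable lebesgue (\<lambda>x. F i x * (dird (\<phi> n) (e i) x - L i x))" if "i \<in> I" for i n
    by (rule integrable_mult_L2[OF F(1)[OF that] _ F(2)[OF that] lim(1)[OF that]]) (use that in measurable)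
  have iL: "integrable lebesgue (\<lambda>x. F i x * L i x)" if "i \<in> I" for i
  proof -
    have "integrable lebesgue (\<lambda>x. F i x * dird (\<phi> 0) (e i) x - F i x * (dird (\<phi> 0) (e i) x - L i x))"
      by (intro Bochner_Integration.integrable_diff i\<phi> id that)
    then show ?thesis by (simp add: algebra_simps)
  qed
  then show "integrable lebesgue
       (\<lambda>x. F i x * (dird \<zeta> (e i) x * H (f x) + \<zeta> x * dird H 1 (f x) * D i x))" if "i \<in> I" for i
    using that by (simp add: L_def)
  have lim2: "(\<lambda>n. LINT x|lebesgue. F i x * dird (\<phi> n) (e i) x) \<longlonglongrightarrow> (LINT x|lebesgue. F i x * L i x)" if "i \<in> I" for i
  proof -
    have "(\<lambda>n. LINT x|lebesgue. F i x * (dird (\<phi> n) (e i) x - L i x)) \<longlonglongrightarrow> 0"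
      by (rule integral_mult_L2_tendsto_0[OF F(1)[OF that] _ F(2)[OF that] lim(1)[OF that] lim(2)[OF that]])
        (use that in measurable)
    moreover have "(LINT x|lebesgue. F i x * (dird (\<phi> n) (e i) x - L i x))
        = (LINT x|lebesgue. F i x * dird (\<phi> n) (e i) x) - (LINT x|lebesgue. F i x * L i x)" for n
      using i\<phi>[OF that] iL[OF that] by (simp add: right_diff_distrib)
    ultimately show ?thesis by (simp add: LIM_zero_iff)
  qed
  have "(\<lambda>n. LINT x|lebesgue. g x * \<phi> n x) \<longlonglongrightarrow> - (\<Sum>i\<in>I. LINT x|lebesgue. F i x * L i x)"
    unfolding g(2)[OF \<phi>(1)] by (intro tendsto_minus tendsto_sum lim2)
  moreover have "(\<lambda>n. LINT x|lebesgue. g x * \<phi> n x) \<longlonglongrightarrow> (LINT x|lebesgue. g x * (\<zeta> x * H (f x)))"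
  proof (rule integral_dominated_convergence)
    show "integrable lebesgue (\<lambda>x. C * \<bar>g x\<bar>)" using g(1) by simp
    show "AE x in lebesgue. (\<lambda>n. g x * \<phi> n x) \<longlonglongrightarrow> g x * (\<zeta> x * H (f x))"
      using \<phi>(3) by eventually_elim (intro tendsto_mult tendsto_const)
    show "AE x in lebesgue. norm (g x * \<phi> n x) \<le> C * \<bar>g x\<bar>" for n
      using mult_right_mono[OF \<phi>(2) abs_ge_zero] by (intro AE_I2) (simp add: abs_mult mult.commute)
  qed measurable
  ultimately show "(LINT x|lebesgue. g x * (\<zeta> x * H (f x))) =
      - (\<Sum>i\<in>I. LINT x|lebesgue. F i x * (dird \<zeta> (e i) x * H (f x) + \<zeta> x * dird H 1 (f x) * D i x))"
    unfolding L_def by (rule LIMSEQ_unique[rotated])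
qed

section \<open>Lebesgue measure on products\<close>

text \<open>The exceptional set is enclosed in a Borel null set before slicing, since slices of a
  Lebesgue null set are controlled only for almost every \<open>t\<close>.\<close>

lemma AE_lebesgue_section:
  fixes P :: "'a::euclidean_space \<times> 'b::euclidean_space \<Rightarrow> bool"
  assumes "AE z in lebesgue. P z"
  shows "AE t in lebesgue. AE x in lebesgue. P (x, t)"
proof -
  have "AE z in lborel. P z" using assms by (simp add: AE_completion_iff)
  then obtain N where N: "N \<in> null_sets lborel" "{z. \<not> P z} \<subseteq> N"
    unfolding eventually_ae_filter by auto
  then have "AE z in lborel \<Otimes>\<^sub>M lborel. z \<notin> N" by (simp add: lborel_prod AE_not_in)
  then have "AE x in lborel. AE t in lborel. (x, t) \<notin> N" by (rule lborel_pair.AE_pair)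
  moreover have "{z \<in> space (lborel \<Otimes>\<^sub>M lborel). (fst z, snd z) \<notin> N} \<in> sets (lborel \<Otimes>\<^sub>M lborel)"
  proof -
    have "space lborel - N \<in> sets (lborel :: ('a \<times> 'b) measure)"
      by (intro sets.compl_sets null_setsD2 N(1))
    then have "- N \<in> sets (lborel :: ('a \<times> 'b) measure)" by (simp add: Compl_eq_Diff_UNIV)
    moreover have "{z \<in> space (lborel \<Otimes>\<^sub>M lborel). (fst z, snd z) \<notin> N} = - N"
      by (auto simp: space_pair_measure)
    moreover have "sets (lborel \<Otimes>\<^sub>M lborel) = sets (lborel :: ('a \<times> 'b) measure)"
      by (subst lborel_prod) (rule refl)
    ultimately show ?thesis by simp
  qed
  ultimately have "AE t in lborel. AE x in lborel. (x, t) \<notin> N"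
    using lborel_pair.AE_commute[where P="\<lambda>x t. (x, t) \<notin> N"] by simp
  then have "AE t in lborel. AE x in lborel. P (x, t)"
    using N(2) by (auto elim!: eventually_mono)
  then show ?thesis by (simp add: AE_completion_iff)
qed

lemma AE_lebesgue_fst:
  fixes P :: "'a::euclidean_space \<Rightarrow> bool"
  assumes "AE x in lebesgue. P x"
  shows "AE z in (lebesgue :: ('a \<times> 'b::euclidean_space) measure). P (fst z)"
proof -
  have "AE x in lborel. P x" using assms by (simp add: AE_completion_iff)
  then obtain N where N: "N \<in> null_sets lborel" "{x. \<not> P x} \<subseteq> N"
    unfolding eventually_ae_filter by auto
  have "emeasure (lborel \<Otimes>\<^sub>M lborel) (N \<times> (UNIV :: 'b set)) = emeasure lborel N * emeasure lborel (UNIV :: 'b set)"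
    by (rule lborel.emeasure_pair_measure_Times) (use N in auto)
  then have "N \<times> (UNIV :: 'b set) \<in> null_sets (lborel \<Otimes>\<^sub>M lborel)"
    using N(1) by (auto simp: null_sets_def intro: pair_measureI)
  then have "AE z in (lborel :: ('a \<times> 'b) measure). z \<notin> N \<times> UNIV"
    by (simp add: lborel_prod AE_not_in)
  then have "AE z in (lborel :: ('a \<times> 'b) measure). P (fst z)"
    using N(2) by (auto elim!: eventually_mono)
  then show ?thesis by (simp add: AE_completion_iff)
qed

lemma borel_measurable_lebesgue_fst:
  fixes f :: "'a::euclidean_space \<Rightarrow> real"
  assumes "f \<in> borel_measurable lebesgue"
  shows "(\<lambda>z::'a \<times> 'b::euclidean_space. f (fst z)) \<in> borel_measurable lebesgue"
proof -
  obtain f' where f': "f' \<in> borel_measurable borel" "AE x in lebesgue. f x = f' x"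
    using ex_borel_version[OF assms] .
  have "(\<lambda>z::'a \<times> 'b. f' (fst z)) \<in> borel_measurable borel"
    by (rule measurable_compose[OF _ f'(1)]) (simp add: borel_prod[symmetric])
  then have "(\<lambda>z::'a \<times> 'b. f' (fst z)) \<in> borel_measurable lebesgue" by (simp add: measurable_completion)
  then show ?thesis
    by (rule borel_measurable_AE) (use AE_lebesgue_fst[OF f'(2)] in \<open>auto elim!: eventually_mono\<close>)
qed

lemma borel_measurable_lebesgue_snd:
  assumes "h \<in> borel_measurable borel"
  shows "(\<lambda>p::'a::euclidean_space \<times> 'b::euclidean_space. h (snd p) :: real) \<in> borel_measurable lebesgue"
proof -
  have "(\<lambda>p::'a \<times> 'b. h (snd p)) \<in> borel_measurable borel"
    by (rule measurable_compose[OF _ assms]) (simp add: borel_prod[symmetric])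
  then show ?thesis by (simp add: measurable_completion)
qed

lemma borel_measurable_lebesgue_section:
  fixes f :: "'a::euclidean_space \<times> 'b::euclidean_space \<Rightarrow> real"
  assumes "f \<in> borel_measurable lebesgue"
  shows "AE t in lebesgue. (\<lambda>x. f (x, t)) \<in> borel_measurable lebesgue"
proof -
  obtain f' where f': "f' \<in> borel_measurable borel" "AE x in lebesgue. f x = f' x"
    using ex_borel_version[OF assms] .
  have "(\<lambda>x. f' (x, t)) \<in> borel_measurable lebesgue" for t
  proof -
    have "(\<lambda>x. f' (x, t)) \<in> borel_measurable borel"
      by (rule measurable_compose[OF _ f'(1)]) (simp add: borel_prod[symmetric])
    then show ?thesis by (simp add: measurable_completion)
  qed
  note m = this
  show ?thesis
    using AE_lebesgue_section[OF f'(2)]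
  proof eventually_elim
    case (elim t)
    show ?case by (rule borel_measurable_AE[OF m[of t]]) (use elim in \<open>auto elim!: eventually_mono\<close>)
  qed
qed

text \<open>Tonelli's criterion: a bound on the slice norms that is uniform over a time set of
  finite measure. It turns continuity in time with values in L^1 into integrability on the
  cylinder.\<close>

lemma integrable_lebesgue_prodI:
  fixes f :: "'a::euclidean_space \<times> 'b::euclidean_space \<Rightarrow> real"
  assumes f: "f \<in> borel_measurable lebesgue" and S: "S \<in> lmeasurable"
    and b: "\<And>t. t \<in> S \<Longrightarrow> integrable lebesgue (\<lambda>x. f (x, t)) \<and> (LINT x|lebesgue. \<bar>f (x, t)\<bar>) \<le> C"
    and z: "\<And>x t. t \<notin> S \<Longrightarrow> f (x, t) = 0"
  shows "integrable lebesgue f"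
proof -
  obtain f' where f': "f' \<in> borel_measurable borel" "AE x in lebesgue. f x = f' x"
    using ex_borel_version[OF f] .
  note [measurable] = f'(1)
  define C' where "C' = max C 0"
  have "(\<integral>\<^sup>+z. ennreal \<bar>f z\<bar> \<partial>lebesgue) = (\<integral>\<^sup>+z. ennreal \<bar>f' z\<bar> \<partial>lborel)"
  proof -
    have "(\<integral>\<^sup>+z. ennreal \<bar>f z\<bar> \<partial>lebesgue) = (\<integral>\<^sup>+z. ennreal \<bar>f' z\<bar> \<partial>lebesgue)"
      by (rule nn_integral_cong_AE) (use f'(2) in \<open>auto elim!: eventually_mono\<close>)
    then show ?thesis by (simp add: nn_integral_completion)
  qed
  also have "\<dots> = (\<integral>\<^sup>+t. (\<integral>\<^sup>+x. ennreal \<bar>f' (x, t)\<bar> \<partial>lborel) \<partial>lborel)"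
    using lborel_pair.nn_integral_snd[of "\<lambda>z. ennreal \<bar>f' z\<bar>"] by (simp add: lborel_prod borel_prod)
  also have "\<dots> = (\<integral>\<^sup>+t. (\<integral>\<^sup>+x. ennreal \<bar>f' (x, t)\<bar> \<partial>lebesgue) \<partial>lebesgue)"
    by (simp add: nn_integral_completion)
  also have "\<dots> \<le> (\<integral>\<^sup>+t. ennreal C' * indicator S t \<partial>lebesgue)"
  proof (rule nn_integral_mono_AE)
    show "AE t in lebesgue. (\<integral>\<^sup>+x. ennreal \<bar>f' (x, t)\<bar> \<partial>lebesgue) \<le> ennreal C' * indicator S t"
      using AE_lebesgue_section[OF f'(2)]
    proof eventually_elim
      case (elim t)
      then have "(\<integral>\<^sup>+x. ennreal \<bar>f' (x, t)\<bar> \<partial>lebesgue) = (\<integral>\<^sup>+x. ennreal \<bar>f (x, t)\<bar> \<partial>lebesgue)"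
        by (intro nn_integral_cong_AE) (auto elim!: eventually_mono)
      also have "\<dots> \<le> ennreal C' * indicator S t"
      proof (cases "t \<in> S")
        case True
        then have "(\<integral>\<^sup>+x. ennreal \<bar>f (x, t)\<bar> \<partial>lebesgue) = ennreal (LINT x|lebesgue. \<bar>f (x, t)\<bar>)"
          using b[OF True] by (intro nn_integral_eq_integral) auto
        also have "\<dots> \<le> ennreal C'" using b[OF True] by (intro ennreal_leI) (auto simp: C'_def le_max_iff_disj)
        finally show ?thesis using True by simp
      qed (use z in simp)
      finally show ?case .
    qed
  qed
  also have "\<dots> = ennreal C' * emeasure lebesgue S"
    using S by (intro nn_integral_cmult_indicator) auto
  also have "\<dots> < \<infinity>" using S by (auto simp: fmeasurable_def ennreal_mult_less_top)
  finally show ?thesis using f by (intro integrableI_bounded) auto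
qed

lemma lebesgue_Fubini:
  fixes f :: "'a::euclidean_space \<times> 'b::euclidean_space \<Rightarrow> real"
  assumes "integrable lebesgue f"
  shows "AE t in lebesgue. integrable lebesgue (\<lambda>x. f (x, t))"
    "integrable lebesgue (\<lambda>t. LINT x|lebesgue. f (x, t))"
    "(LINT z|lebesgue. f z) = (LINT t|lebesgue. LINT x|lebesgue. f (x, t))"
proof -
  have fm: "f \<in> borel_measurable lebesgue" using assms by auto
  obtain f' where f': "f' \<in> borel_measurable borel" "AE x in lebesgue. f x = f' x"
    using ex_borel_version[OF fm] .
  note [measurable] = f'(1)
  have f'm: "f' \<in> borel_measurable lebesgue" by (simp add: measurable_completion)
  have "integrable lebesgue f'" by (rule integrable_cong_AE_imp[OF assms f'm]) (use f'(2) in \<open>auto elim!: eventually_mono\<close>)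
  then have i: "integrable (lborel \<Otimes>\<^sub>M lborel) (case_prod (\<lambda>x t. f' (x, t)))"
    by (simp add: integrable_completion lborel_prod)
  have sm [measurable]: "(\<lambda>x. f' (x, t)) \<in> borel_measurable borel" for t
    by (rule measurable_compose[OF _ f'(1)]) (simp add: borel_prod[symmetric])
  have S: "AE t in lebesgue. integrable lebesgue (\<lambda>x. f' (x, t))"
    using lborel_pair.AE_integrable_snd[OF i] by (simp add: AE_completion_iff integrable_completion)
  have ae: "AE t in lebesgue. (\<lambda>x. f (x, t)) \<in> borel_measurable lebesgue \<and> (AE x in lebesgue. f (x, t) = f' (x, t))"
    using AE_lebesgue_section[OF f'(2)] borel_measurable_lebesgue_section[OF fm] by eventually_elim auto
  show "AE t in lebesgue. integrable lebesgue (\<lambda>x. f (x, t))"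
    using S ae
  proof eventually_elim
    case (elim t)
    show ?case
      by (rule integrable_cong_AE_imp[OF elim(1)]) (use elim(2) in \<open>auto elim!: eventually_mono\<close>)
  qed
  have eq: "AE t in lebesgue. (LINT x|lborel. f' (x, t)) = (LINT x|lebesgue. f (x, t))"
    using ae
  proof eventually_elim
    case (elim t)
    have "(LINT x|lebesgue. f (x, t)) = (LINT x|lebesgue. f' (x, t))"
      by (rule integral_cong_AE) (use elim in \<open>auto simp: measurable_completion\<close>)
    then show ?case by (simp add: integral_completion)
  qed
  have i2: "integrable lborel (\<lambda>t. LINT x|lborel. f' (x, t))"
    using lborel_pair.integrable_snd[OF i] by simp
  then have i3: "integrable lebesgue (\<lambda>t. LINT x|lborel. f' (x, t))"
    by (subst integrable_completion) auto
  have m: "(\<lambda>t. LINT x|lebesgue. f (x, t)) \<in> borel_measurable lebesgue"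
    by (rule borel_measurable_AE[OF _ eq]) (use i3 in auto)
  show "integrable lebesgue (\<lambda>t. LINT x|lebesgue. f (x, t))"
    by (rule integrable_cong_AE_imp[OF i3 m]) (use eq in \<open>auto elim!: eventually_mono\<close>)
  have "(LINT z|lebesgue. f z) = (LINT z|lebesgue. f' z)"
    by (rule integral_cong_AE[OF fm f'm f'(2)])
  also have "\<dots> = (LINT z|lborel. f' z)" by (simp add: integral_completion)
  also have "\<dots> = (LINT t|lborel. LINT x|lborel. f' (x, t))"
    using lborel_pair.integral_snd[OF i] by (simp add: lborel_prod)
  also have "\<dots> = (LINT t|lebesgue. LINT x|lborel. f' (x, t))"
    using i2 by (intro integral_completion[symmetric]) auto
  also have "\<dots> = (LINT t|lebesgue. LINT x|lebesgue. f (x, t))"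
    by (rule integral_cong_AE[OF _ m eq]) (use i3 in auto)
  finally show "(LINT z|lebesgue. f z) = (LINT t|lebesgue. LINT x|lebesgue. f (x, t))" .
qed

section \<open>Product test functions, cut-offs and Dirac kernels\<close>

lemma test_prod:
  fixes \<xi> :: "'a::euclidean_space \<Rightarrow> real" and \<eta> :: "real \<Rightarrow> real"
  assumes \<xi>: "\<xi> \<in> test_functions UNIV" and \<eta>: "\<eta> \<in> test_functions J"
  shows "(\<lambda>z. \<xi> (fst z) * \<eta> (snd z)) \<in> test_functions (UNIV \<times> J)"
    "dird (\<lambda>z. \<xi> (fst z) * \<eta> (snd z)) (v, s) (x, t) = \<xi> x * (s * dird \<eta> 1 t) + dird \<xi> v x * \<eta> t"
proof -
  note s = test_smooth[OF \<xi>] test_smooth[OF \<eta>]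
  have s1: "smooth (\<lambda>z::'a \<times> real. \<xi> (fst z))"
    using smooth_affine[OF bounded_linear_fst s(1), of 0] by simp
  have s2: "smooth (\<lambda>z::'a \<times> real. \<eta> (snd z))"
    using smooth_affine[OF bounded_linear_snd s(2), of 0] by simp
  obtain K where K: "compact K" "\<And>x. \<xi> x \<noteq> 0 \<Longrightarrow> x \<in> K" using \<xi> unfolding test_functions_iff by blast
  obtain L where L: "compact L" "L \<subseteq> J" "\<And>x. \<eta> x \<noteq> 0 \<Longrightarrow> x \<in> L" using \<eta> unfolding test_functions_iff by blast
  show "(\<lambda>z. \<xi> (fst z) * \<eta> (snd z)) \<in> test_functions (UNIV \<times> J)"
    by (rule test_functionsI[OF smooth_mult[OF s1 s2] compact_Times[OF K(1) L(1)]]) (use K L in auto)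
  have 1: "dird (\<lambda>z::'a \<times> real. \<xi> (fst z)) (v, s) (x, t) = dird \<xi> v x"
    using dird_affine[OF s(1) bounded_linear_fst, of 0 "(x, t)" "(v, s)"] by simp
  have "dird (\<lambda>z::'a \<times> real. \<eta> (snd z)) (v, s) (x, t) = dird \<eta> s t"
    using dird_affine[OF s(2) bounded_linear_snd, of 0 "(x, t)" "(v, s)"] by simp
  also have "\<dots> = s * dird \<eta> 1 t" using dird_real_eq[OF smooth_real_deriv[OF s(2)], of t s] by simp
  finally show "dird (\<lambda>z. \<xi> (fst z) * \<eta> (snd z)) (v, s) (x, t) = \<xi> x * (s * dird \<eta> 1 t) + dird \<xi> v x * \<eta> t"
    unfolding dird_mult[OF s1 s2] 1 by simp
qed

lemma test_scale:
  fixes \<xi> :: "'a::euclidean_space \<Rightarrow> real"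
  assumes \<xi>: "\<xi> \<in> test_functions UNIV" and c: "c \<noteq> 0"
  shows "(\<lambda>x. \<xi> (c *\<^sub>R x)) \<in> test_functions UNIV"
    "dird (\<lambda>x. \<xi> (c *\<^sub>R x)) v x = c * dird \<xi> v (c *\<^sub>R x)"
proof -
  obtain K where K: "smooth \<xi>" "compact K" "\<And>x. \<xi> x \<noteq> 0 \<Longrightarrow> x \<in> K" using \<xi> unfolding test_functions_iff by blast
  have b: "bounded_linear (\<lambda>x::'a. c *\<^sub>R x)" by (rule bounded_linear_scaleR_right)
  have s: "smooth (\<lambda>x. \<xi> (c *\<^sub>R x))" using smooth_affine[OF b K(1), of 0] by simp
  show "(\<lambda>x. \<xi> (c *\<^sub>R x)) \<in> test_functions UNIV"
  proof (rule test_functionsI[OF s compact_scaling[OF K(2), of "inverse c"]])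
    fix x assume "\<xi> (c *\<^sub>R x) \<noteq> 0"
    then show "x \<in> (\<lambda>x. inverse c *\<^sub>R x) ` K"
      using K(3)[of "c *\<^sub>R x"] c by (intro image_eqI[of _ _ "c *\<^sub>R x"]) auto
  qed auto
  show "dird (\<lambda>x. \<xi> (c *\<^sub>R x)) v x = c * dird \<xi> v (c *\<^sub>R x)"
    using dird_affine[OF K(1) b, of 0 x v] linear_scale[OF dird_linear[OF K(1)], of "c *\<^sub>R x" c v] by simp
qed

definition smooth_step :: "(real \<Rightarrow> real) \<Rightarrow> bool" where
  "smooth_step H \<longleftrightarrow> smooth H \<and> (\<forall>s\<le>0. H s = 0) \<and> (\<forall>s\<ge>1. H s = 1) \<and>
     (\<forall>s. 0 \<le> H s \<and> H s \<le> 1 \<and> 0 \<le> dird H 1 s) \<and> mono H"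

lemma ex_smooth_step: obtains H where "smooth_step H"
  using smooth_step_exists unfolding smooth_step_def by metis

lemma smooth_stepD:
  assumes "smooth_step H"
  shows "smooth H" "s \<le> 0 \<Longrightarrow> H s = 0" "1 \<le> s \<Longrightarrow> H s = 1" "0 \<le> H s" "H s \<le> 1" "0 \<le> dird H 1 s" "mono H"
    "s \<le> 0 \<Longrightarrow> dird H 1 s = 0" "1 \<le> s \<Longrightarrow> dird H 1 s = 0"
proof -
  have H: "smooth H" "\<And>s. s \<le> 0 \<Longrightarrow> H s = 0" "\<And>s. 1 \<le> s \<Longrightarrow> H s = 1" "\<And>s. 0 \<le> H s" "\<And>s. H s \<le> 1"
    using assms by (auto simp: smooth_step_def)
  then show "smooth H" "s \<le> 0 \<Longrightarrow> H s = 0" "1 \<le> s \<Longrightarrow> H s = 1" "0 \<le> H s" "H s \<le> 1" by auto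
  show "0 \<le> dird H 1 s" "mono H" using assms by (auto simp: smooth_step_def)
  note D = smooth_real_deriv[OF H(1)]
  \<comment> \<open>At such a point \<open>H\<close> attains its minimum 0, and in the next case its
    maximum 1, so the derivative also vanishes at the end points 0 and 1 themselves.\<close>
  show "dird H 1 s = 0" if "s \<le> 0"
    by (rule DERIV_local_min[OF D, of 1]) (use that H in auto)
  show "dird H 1 s = 0" if "1 \<le> s"
    by (rule DERIV_local_max[OF D, of 1]) (use that H in auto)
qed

lemma cutoff_exists:
  obtains \<xi> :: "'a::euclidean_space \<Rightarrow> real" where "\<xi> \<in> test_functions UNIV"
    "\<And>x. 0 \<le> \<xi> x" "\<And>x. \<xi> x \<le> 1" "\<And>x. norm x \<le> 1 \<Longrightarrow> \<xi> x = 1"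
proof -
  obtain H where H: "smooth_step H" using ex_smooth_step .
  note HD = smooth_stepD[OF H]
  \<comment> \<open>The argument is at least 1 on the unit ball and nonpositive once the squared
    norm reaches 2.\<close>
  define \<xi> where "\<xi> x = H (2 - x \<bullet> x)" for x :: 'a
  have s: "smooth \<xi>"
    unfolding \<xi>_def by (intro smooth_compose[OF HD(1)] smooth_minus smooth_inner_self smooth_const)
  show thesis
  proof (rule that[of \<xi>])
    show "\<xi> \<in> test_functions UNIV"
    proof (rule test_functionsI[OF s compact_cball[of 0 2]])
      fix x assume "\<xi> x \<noteq> 0"
      then have "x \<bullet> x < 2" using HD(2)[of "2 - x \<bullet> x"] by (force simp: \<xi>_def)
      then have "(norm x)\<^sup>2 < 2\<^sup>2" by (simp add: power2_norm_eq_inner)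
      then have "norm x < 2" by (rule power2_less_imp_less) simp
      then show "x \<in> cball 0 2" by simp
    qed auto
    show "\<xi> x = 1" if "norm x \<le> 1" for x
    proof -
      have "(norm x)\<^sup>2 \<le> 1\<^sup>2" using that by (intro power_mono) auto
      then show ?thesis by (auto simp: \<xi>_def power2_norm_eq_inner intro: HD)
    qed
  qed (auto simp: \<xi>_def HD)
qed

lemma smooth_scale_shift: "smooth (H :: real \<Rightarrow> real) \<Longrightarrow> smooth (\<lambda>r. H (c * (r - s)))"
  using smooth_affine[of "\<lambda>r. c * r" H "- (c * s)"]
  by (simp add: bounded_linear_mult_right right_diff_distrib)

lemma dird_scale_shift:
  assumes "smooth (H :: real \<Rightarrow> real)"
  shows "dird (\<lambda>r. H (c * (r - s))) 1 r = c * dird H 1 (c * (r - s))"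
proof -
  have "((\<lambda>r. H (c * (r - s))) has_real_derivative dird H 1 (c * (r - s)) * c) (at r)"
    by (rule DERIV_chain2[OF smooth_real_deriv[OF assms]]) (auto intro!: derivative_eq_intros)
  from dird_real_eq[OF this, of 1] show ?thesis by simp
qed

lemma step_kernel_test:
  assumes H: "smooth_step H" and c: "c > 0"
  shows "(\<lambda>r. c * dird H 1 (c * (r - s))) \<in> test_functions {s..s + 1 / c}"
proof -
  note HD = smooth_stepD[OF H]
  have "smooth (\<lambda>r. c * dird H 1 (c * (r - s)))"
    by (intro smooth_mult smooth_const smooth_scale_shift[OF smooth_dird[OF HD(1)]])
  then show ?thesis
  proof (rule test_functionsI[OF _ compact_Icc])
    fix r assume r: "c * dird H 1 (c * (r - s)) \<noteq> 0"
    have "0 < c * (r - s)" using HD(8)[of "c * (r - s)"] r by force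
    moreover have "c * (r - s) < 1" using HD(9)[of "c * (r - s)"] r by force
    ultimately show "r \<in> {s..s + 1 / c}" using c by (simp add: zero_less_mult_iff field_simps)
  qed auto
qed

text \<open>The kernel is the derivative of the rescaled step, so it has integral 1, and it lives on
  [s, s + 1/n], to the right of \<open>s\<close>. Therefore \<open>s = 0\<close> is allowed, and for
  large n the zero extension of \<open>W\<close> beyond \<open>T\<close> is not reached.\<close>

lemma Dirac_sequence:
  fixes W :: "real \<Rightarrow> real"
  assumes H: "smooth_step H" and W: "continuous_on {0..T} W" and s: "0 \<le> s" "s < T"
  shows "(\<lambda>n. LINT r|lebesgue. (if r \<in> {0..T} then W r else 0) * (real n * dird H 1 (real n * (r - s)))) \<longlonglongrightarrow> W s"
proof (rule LIMSEQ_I)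
  fix e :: real assume e: "e > 0"
  note HD = smooth_stepD[OF H]
  define W' where "W' r = (if r \<in> {0..T} then W r else 0)" for r
  obtain d where d: "d > 0" "\<And>r. r \<in> {0..T} \<Longrightarrow> \<bar>r - s\<bar> < d \<Longrightarrow> \<bar>W r - W s\<bar> < e / 2"
    using W[unfolded continuous_on_iff, rule_format, of s "e / 2"] s e by (auto simp: dist_real_def)
  obtain n0 :: nat where n0: "real n0 > max (1 / d) (1 / (T - s))" "n0 > 0"
    using reals_Archimedean2[of "max (1 / d) (1 / (T - s))"] d s by (metis less_max_iff_disj of_nat_0_less_iff order_less_trans zero_less_divide_1_iff)
  have "norm ((LINT r|lebesgue. W' r * (real n * dird H 1 (real n * (r - s)))) - W s) < e" if n: "n \<ge> n0" for n
  proof -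
    define k where "k r = real n * dird H 1 (real n * (r - s))" for r
    have npos: "real n > 0" using n n0 by simp
    have nn: "1 / real n < d" "1 / real n < T - s"
    proof -
      have "real n > 1 / d" "real n > 1 / (T - s)" using n n0(1) by auto
      then show "1 / real n < d" "1 / real n < T - s"
        using npos d s by (simp_all add: divide_simps mult.commute)
    qed
    have k0: "k r \<ge> 0" for r using HD(6) npos by (simp add: k_def)
    have kt: "k \<in> test_functions {s..s + 1 / real n}"
      unfolding k_def by (rule step_kernel_test[OF H npos])
    have supp: "k r = 0" if "r \<notin> {s..s + 1 / real n}" for r
      using kt that unfolding test_functions_iff by blast
    have ki: "integrable lebesgue k" by (rule test_integrable[OF kt])
    have k1: "(LINT r|lebesgue. k r) = 1"
    proof -
      have D: "((\<lambda>r. H (real n * (r - s))) has_real_derivative k r) (at r)" for r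
        using smooth_real_deriv[OF smooth_scale_shift[OF HD(1), of "real n" s], of r]
        unfolding dird_scale_shift[OF HD(1)] k_def .
      have "has_bochner_integral lborel (\<lambda>r. k r * indicator {s..s + 1 / real n} r)
          (H (real n * (s + 1 / real n - s)) - H (real n * (s - s)))"
        by (rule has_bochner_integral_FTC_Icc_nonneg)
          (use D k0 npos test_borel[OF kt] in \<open>auto simp: has_real_derivative_iff_has_vector_derivative[symmetric] intro: DERIV_subset\<close>)
      moreover have "k r * indicator {s..s + 1 / real n} r = k r" for r
        using supp[of r] by (cases "r \<in> {s..s + 1 / real n}") auto
      ultimately have "(LINT r|lborel. k r) = 1"
        using npos by (simp add: has_bochner_integral_iff HD(2,3))
      then show ?thesis using test_borel[OF kt] by (simp add: integral_completion)
    qed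
    have W'm: "W' \<in> borel_measurable lebesgue"
    proof -
      have "(\<lambda>r. indicator {0..T} r *\<^sub>R W r) \<in> borel_measurable borel"
        using borel_measurable_continuous_on_indicator[OF _ W] by simp
      moreover have "(\<lambda>r. indicator {0..T} r *\<^sub>R W r) = W'" by (auto simp: W'_def indicator_def)
      ultimately show ?thesis by (simp add: measurable_completion)
    qed
    have near: "\<bar>(W' r - W s) * k r\<bar> \<le> e / 2 * k r" for r
    proof (cases "r \<in> {s..s + 1 / real n}")
      case True
      then have "r \<in> {0..T}" "\<bar>r - s\<bar> < d" using nn s by auto
      then have "\<bar>W' r - W s\<bar> \<le> e / 2" using d(2)[of r] by (simp add: W'_def)
      from mult_right_mono[OF this k0[of r]] show ?thesis using k0[of r] by (simp add: abs_mult)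
    next
      case False
      then show ?thesis using supp[of r] by simp
    qed
    have di: "integrable lebesgue (\<lambda>r. (W' r - W s) * k r)"
    proof (rule Bochner_Integration.integrable_bound)
      show "integrable lebesgue (\<lambda>r. e / 2 * k r)" using ki by simp
      show "(\<lambda>r. (W' r - W s) * k r) \<in> borel_measurable lebesgue"
        using W'm ki by auto
      show "AE r in lebesgue. norm ((W' r - W s) * k r) \<le> norm (e / 2 * k r)"
        using near k0 e by (intro AE_I2) (auto simp: abs_mult)
    qed
    have "integrable lebesgue (\<lambda>r. (W' r - W s) * k r + W s * k r)" using di ki by simp
    then have Wi: "integrable lebesgue (\<lambda>r. W' r * k r)" by (simp add: algebra_simps)
    have "(LINT r|lebesgue. W' r * k r) - W s = (LINT r|lebesgue. (W' r - W s) * k r)"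
      using Wi ki k1 by (simp add: left_diff_distrib)
    also have "\<bar>\<dots>\<bar> \<le> (LINT r|lebesgue. \<bar>(W' r - W s) * k r\<bar>)" by (rule integral_abs_bound)
    also have "\<dots> \<le> (LINT r|lebesgue. e / 2 * k r)"
      by (rule integral_mono) (use di ki near in auto)
    also have "\<dots> = e / 2" using k1 by simp
    finally show ?thesis using e by (simp add: k_def)
  qed
  then show "\<exists>no. \<forall>n\<ge>no. norm ((LINT r|lebesgue. (if r \<in> {0..T} then W r else 0) *
      (real n * dird H 1 (real n * (r - s)))) - W s) < e"
    unfolding W'_def by blast
qed

section \<open>Testing with an approximate sign\<close>

text \<open>A smooth substitute for the positive part with error at most 1; after the rescaling K(N
  r)/N the error is at most 1/N. All bounds come from the mean value theorem and 0 <= H <=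
  1.\<close>

lemma smooth_step_antiderivative:
  assumes "smooth_step H"
  obtains K where "smooth K" "\<And>s. dird K 1 s = H s" "\<And>s. \<bar>K s\<bar> \<le> \<bar>s\<bar>" "\<And>s. \<bar>K s - max s 0\<bar> \<le> 1"
proof -
  note HD = smooth_stepD[OF assms]
  obtain K where K: "\<And>x. (K has_real_derivative H x) (at x)" "\<And>x. x \<le> 0 \<Longrightarrow> K x = 0"
    using antiderivative_exists[of H] smooth_continuous_on[OF HD(1)] HD(2) by blast
  have *: "\<exists>x. K b - K a = (b - a) * H x \<and> a < x" if "a < b" for a b
    using MVT2[OF that K(1)] by blast
  have b: "0 \<le> K s \<and> K s \<le> s" if s: "s > 0" for s
  proof -
    obtain x where "K s - K 0 = (s - 0) * H x" using *[OF s] by blast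
    with K(2)[of 0] have "K s = s * H x" by simp
    then show ?thesis using HD(4,5)[of x] s by (simp add: mult_left_le)
  qed
  have c: "s - 1 \<le> K s" if s: "s > 1" for s
  proof -
    obtain x where "K s - K 1 = (s - 1) * H x" "x > 1" using *[OF s] by blast
    with HD(3)[of x] b[of 1] show ?thesis by simp
  qed
  show thesis
  proof (rule that[of K])
    show "smooth K" by (rule smoothI_real_deriv[OF K(1) HD(1)])
    show "dird K 1 s = H s" for s using dird_real_eq[OF K(1), of s 1] by simp
    show "\<bar>K s\<bar> \<le> \<bar>s\<bar>" for s using b[of s] K(2)[of s] by (cases "s > 0") auto
    show "\<bar>K s - max s 0\<bar> \<le> 1" for s
      using b[of s] c[of s] K(2)[of s] by (cases "s > 0"; cases "s > 1") auto
  qed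
qed

text \<open>The linear bound on \<open>H\<close> supplies a factor |z| in the cut-off error, where
  it is paired with the square integrable flux; the bound on the derivative controls the quadratic
  term.\<close>

lemma smooth_step_deriv_bound:
  assumes "smooth_step H"
  obtains C where "0 \<le> C" "\<And>s. dird H 1 s \<le> C" "\<And>s. H s \<le> C * \<bar>s\<bar>"
proof -
  note HD = smooth_stepD[OF assms]
  obtain C where C: "0 \<le> C" "\<And>s. \<bar>s\<bar> \<le> 1 \<Longrightarrow> \<bar>dird H 1 s\<bar> \<le> C"
    using smooth_bounded_on_interval[OF smooth_dird[OF HD(1)]] by blast
  have D: "dird H 1 s \<le> C" for s
  proof -
    consider "s \<le> 0" | "0 < s" "s < 1" | "s \<ge> 1" by linarith
    then show ?thesis using C(1) C(2)[of s] HD(8,9)[of s] by cases auto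
  qed
  have "H s \<le> C * \<bar>s\<bar>" for s
  proof (cases "s > 0")
    case True
    obtain x where "H s - H 0 = (s - 0) * dird H 1 x"
      using MVT2[OF True smooth_real_deriv[OF HD(1)]] by blast
    then show ?thesis using HD(2)[of 0] True D[of x] by (simp add: mult.commute mult_left_mono)
  qed (use HD(2)[of s] mult_nonneg_nonneg[OF C(1) abs_ge_zero[of s]] in linarith)
  with C(1) D that show thesis by blast
qed

text \<open>The approximate sign is \<open>H(n z)\<close>. The spatial cut-off lives at radius \<open>n\<^sup>2\<close>, so that its
  gradient beats the Lipschitz constant \<open>n\<close> of \<open>H(n \<cdot>)\<close> in the term that is not dominated
  uniformly in \<open>n\<close>.\<close>

lemma weak_contraction:
  fixes w z g Q :: "'a::euclidean_space \<times> real \<Rightarrow> real" and F G :: "'a \<Rightarrow> 'a \<times> real \<Rightarrow> real"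
  assumes w: "integrable lebesgue w" "AE p in lebesgue. \<bar>w p\<bar> \<le> M"
    and z: "integrable lebesgue z" "AE p in lebesgue. \<bar>z p\<bar> \<le> M"
    and g: "integrable lebesgue g"
    and F: "\<And>b. b \<in> Basis \<Longrightarrow> F b \<in> borel_measurable lebesgue"
      "\<And>b. b \<in> Basis \<Longrightarrow> integrable lebesgue (\<lambda>p. (F b p)\<^sup>2)"
    and G: "\<And>b. b \<in> Basis \<Longrightarrow> G b \<in> borel_measurable lebesgue"
      "\<And>b. b \<in> Basis \<Longrightarrow> integrable lebesgue (\<lambda>p. (G b p)\<^sup>2)"
    and wt: "\<And>\<psi>. \<psi> \<in> test_functions (UNIV \<times> {0<..<T}) \<Longrightarrow>
      (LINT p|lebesgue. w p * dird \<psi> (0, 1) p) = - (LINT p|lebesgue. g p * \<psi> p)"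
    and gF: "\<And>\<psi>. \<psi> \<in> test_functions (UNIV \<times> {0<..<T}) \<Longrightarrow>
      (LINT p|lebesgue. g p * \<psi> p) = - (\<Sum>b\<in>Basis. LINT p|lebesgue. F b p * dird \<psi> (b, 0) p)"
    and zx: "\<And>b \<psi>. b \<in> Basis \<Longrightarrow> \<psi> \<in> test_functions (UNIV \<times> {0<..<T}) \<Longrightarrow>
      (LINT p|lebesgue. z p * dird \<psi> (b, 0) p) = - (LINT p|lebesgue. G b p * \<psi> p)"
    and sgn: "AE p in lebesgue. z p > 0 \<longleftrightarrow> w p > 0"
    and FG: "AE p in lebesgue. z p > 0 \<longrightarrow> - (\<Sum>b\<in>Basis. F b p * G b p) \<le> z p powr (1 + \<alpha>) * Q p"
    and \<alpha>: "\<alpha> > 0" and Q: "integrable lebesgue Q" "\<And>p. 0 \<le> Q p"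
    and \<eta>: "\<eta> \<in> test_functions {0<..<T}" "\<And>t. 0 \<le> \<eta> t"
  shows "0 \<le> (LINT p|lebesgue. dird \<eta> 1 (snd p) * max (w p) 0)"
proof -
  let ?U = "UNIV \<times> {0<..<T} :: ('a \<times> real) set"
  have U: "open ?U" by (intro open_Times) auto
  have wm [measurable]: "w \<in> borel_measurable lebesgue" and zm [measurable]: "z \<in> borel_measurable lebesgue"
    and gm [measurable]: "g \<in> borel_measurable lebesgue" and Qm [measurable]: "Q \<in> borel_measurable lebesgue"
    using w(1) z(1) g Q(1) by auto
  note [measurable] = F(1) G(1)
  obtain H where H: "smooth_step H" using ex_smooth_step .
  note HD = smooth_stepD[OF H]
  obtain K where K: "smooth K" "\<And>s. dird K 1 s = H s" "\<And>s. \<bar>K s\<bar> \<le> \<bar>s\<bar>" "\<And>s. \<bar>K s - max s 0\<bar> \<le> 1"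
    using smooth_step_antiderivative[OF H] by blast
  obtain C1 where C1: "0 \<le> C1" "\<And>s. dird H 1 s \<le> C1" "\<And>s. H s \<le> C1 * \<bar>s\<bar>"
    using smooth_step_deriv_bound[OF H] by blast
  obtain \<xi> :: "'a \<Rightarrow> real" where \<xi>: "\<xi> \<in> test_functions UNIV"
    "\<And>x. 0 \<le> \<xi> x" "\<And>x. \<xi> x \<le> 1" "\<And>x. norm x \<le> 1 \<Longrightarrow> \<xi> x = 1"
    using cutoff_exists by blast
  obtain Ce where Ce: "0 \<le> Ce" "\<And>t. \<bar>\<eta> t\<bar> \<le> Ce" using test_bounded[OF \<eta>(1)] by blast
  obtain Ce' where Ce': "0 \<le> Ce'" "\<And>t. \<bar>dird \<eta> 1 t\<bar> \<le> Ce'" using test_bounded[OF test_dird[OF \<eta>(1)]] by blast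
  have "\<forall>b. \<exists>C\<ge>0. \<forall>x. \<bar>dird \<xi> b x\<bar> \<le> C" using test_bounded[OF test_dird[OF \<xi>(1)]] by metis
  then obtain D where D: "\<And>b. D b \<ge> 0" "\<And>b x. \<bar>dird \<xi> b x\<bar> \<le> D b" by metis
  define Cx where "Cx = (\<Sum>b\<in>Basis. D b)"
  have Cx: "0 \<le> Cx" "\<And>b x. b \<in> Basis \<Longrightarrow> \<bar>dird \<xi> b x\<bar> \<le> Cx"
    unfolding Cx_def using D by (auto intro!: sum_nonneg order_trans[OF D(2)] member_le_sum)
  define N where "N n = real (Suc n)" for n
  have N: "N n > 0" "N n \<ge> 1" for n by (auto simp: N_def)
  define c where "c n = 1 / (N n)\<^sup>2" for n
  have c: "c n > 0" for n using N(1)[of n] by (simp add: c_def)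
  define \<zeta> where "\<zeta> n p = \<xi> (c n *\<^sub>R fst p) * \<eta> (snd p)" for n and p :: "'a \<times> real"
  have \<zeta>: "\<zeta> n \<in> test_functions ?U" for n
    unfolding \<zeta>_def by (rule test_prod(1)[OF test_scale(1)[OF \<xi>(1)] \<eta>(1)]) (use c[of n] in simp)
  have \<zeta>d: "dird (\<zeta> n) (v, s) p =
      \<xi> (c n *\<^sub>R fst p) * (s * dird \<eta> 1 (snd p)) + c n * dird \<xi> v (c n *\<^sub>R fst p) * \<eta> (snd p)" for n v s p
  proof -
    have "c n \<noteq> 0" using c[of n] by simp
    from test_prod(2)[OF test_scale(1)[OF \<xi>(1) this] \<eta>(1), of "fst p" "snd p" v s] show ?thesis
      unfolding \<zeta>_def by (simp add: test_scale(2)[OF \<xi>(1) \<open>c n \<noteq> 0\<close>])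
  qed
  have \<zeta>b: "0 \<le> \<zeta> n p" "\<zeta> n p \<le> Ce" for n p
  proof -
    show "0 \<le> \<zeta> n p" unfolding \<zeta>_def by (intro mult_nonneg_nonneg \<xi> \<eta>)
    have "\<zeta> n p \<le> 1 * Ce"
      unfolding \<zeta>_def using Ce(2)[of "snd p"] by (intro mult_mono \<xi> \<eta>) auto
    then show "\<zeta> n p \<le> Ce" by simp
  qed
  have ev\<xi>: "\<forall>\<^sub>F n in sequentially. \<xi> (c n *\<^sub>R x) = 1" for x
    using eventually_ge_at_top[of "nat \<lceil>norm x\<rceil>"]
  proof eventually_elim
    case (elim n)
    then have "norm x \<le> N n" unfolding N_def by linarith
    also have "\<dots> \<le> (N n)\<^sup>2" using N(2)[of n] by (simp add: power2_eq_square)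
    finally have "norm (c n *\<^sub>R x) \<le> 1" using N(1)[of n] by (simp add: c_def divide_le_eq_1)
    then show ?case by (rule \<xi>(4))
  qed
  have evN: "\<forall>\<^sub>F n in sequentially. N n * s \<ge> 1" if "s > 0" for s
    using eventually_ge_at_top[of "nat \<lceil>1 / s\<rceil>"]
  proof eventually_elim
    case (elim n)
    then have "1 / s \<le> N n" unfolding N_def by linarith
    then show ?case using that by (simp add: divide_le_eq)
  qed
  have evH: "\<forall>\<^sub>F n in sequentially. H (N n * s) = (if s > 0 then 1 else 0)" for s
  proof (cases "s > 0")
    case True
    from evN[OF True] show ?thesis by eventually_elim (use True HD(3) in auto)
  next
    case False
    then have "N n * s \<le> 0" for n using N(1)[of n] by (simp add: mult_le_0_iff)
    with False show ?thesis by (auto intro!: always_eventually HD(2))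
  qed
  have Hs: "smooth (\<lambda>r. H (N n * r))" "dird (\<lambda>r. H (N n * r)) 1 s = N n * dird H 1 (N n * s)" for n s
    using smooth_scale_shift[OF HD(1), of "N n" 0] dird_scale_shift[OF HD(1), of "N n" 0] by simp_all

  \<comment> \<open>The spatial half. The approximate sign is taken of \<open>z\<close>, the
    function whose gradient \<open>G\<close> is known.\<close>
  have space: "(LINT p|lebesgue. g p * \<eta> (snd p) * (if z p > 0 then 1 else 0)) \<le> 0"
  proof -
    \<comment> \<open>\<open>S\<close> measures the cut-off error. It is integrable because
      \<open>F\<close> is square integrable and so is \<open>z\<close>, being bounded and
      integrable.\<close>
    define S where "S p = (\<Sum>b\<in>Basis. \<bar>F b p\<bar> * \<bar>z p\<bar>)" for p
    have z2: "integrable lebesgue (\<lambda>p. (z p)\<^sup>2)"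
      using integrable_mult_bounded[OF z(1) zm z(2)] by (simp add: power2_eq_square)
    have iS: "integrable lebesgue S"
      unfolding S_def
    proof (intro Bochner_Integration.integrable_sum)
      fix b :: 'a assume b: "b \<in> Basis"
      show "integrable lebesgue (\<lambda>p. \<bar>F b p\<bar> * \<bar>z p\<bar>)"
        by (rule integrable_mult_L2) (use F(1)[OF b] F(2)[OF b] z2 in auto)
    qed
    define R where "R n b p = F b p * (dird (\<zeta> n) (b, 0) p * H (N n * z p)
        + \<zeta> n p * (N n * dird H 1 (N n * z p)) * G b p)" for n b p
    note WL2 = weak_chain_rule_L2[where I=Basis and e="\<lambda>b. (b, 0)" and D=G and F=F and g=g,
        OF U z \<zeta> Hs(1) G zx F g gF, unfolded Hs(2)]
    have id: "(LINT p|lebesgue. g p * (\<zeta> n p * H (N n * z p))) = - (\<Sum>b\<in>Basis. LINT p|lebesgue. R n b p)"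
      and iR: "\<And>b. b \<in> Basis \<Longrightarrow> integrable lebesgue (R n b)" for n
      unfolding R_def using WL2 by blast+
    have bound: "AE p in lebesgue. - (\<Sum>b\<in>Basis. R n b p)
        \<le> (Cx * Ce * C1 / N n) * S p + (Ce * C1 * N n powr (- \<alpha>)) * Q p" for n
      using FG
    proof eventually_elim
      case (elim p)
      have 1: "- (F b p * (dird (\<zeta> n) (b, 0) p * H (N n * z p))) \<le> (Cx * Ce * C1 / N n) * (\<bar>F b p\<bar> * \<bar>z p\<bar>)"
        if b: "b \<in> Basis" for b
      proof -
        have "- (F b p * (dird (\<zeta> n) (b, 0) p * H (N n * z p))) \<le> \<bar>F b p * (dird (\<zeta> n) (b, 0) p * H (N n * z p))\<bar>"
          by simp
        also have "\<dots> = \<bar>F b p\<bar> * (c n * \<bar>dird \<xi> b (c n *\<^sub>R fst p)\<bar> * \<bar>\<eta> (snd p)\<bar> * H (N n * z p))"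
          using c[of n] HD(4) by (simp add: \<zeta>d abs_mult)
        \<comment> \<open>The linear bound on \<open>H\<close> costs a factor \<open>N n\<close>,
          while the cut-off gradient gains \<open>c n\<close>, the inverse square of
          \<open>N n\<close>; a factor 1/N remains.\<close>
        also have "\<dots> \<le> \<bar>F b p\<bar> * (c n * Cx * Ce * (C1 * \<bar>N n * z p\<bar>))"
          using c[of n] Cx Ce C1(1) HD(4) b
          by (intro mult_mono order_refl Cx Ce C1) auto
        also have "\<dots> = (Cx * Ce * C1 / N n) * (\<bar>F b p\<bar> * \<bar>z p\<bar>)"
          using N(1)[of n] by (simp add: c_def abs_mult power2_eq_square field_simps)
        finally show ?thesis .
      qed
      define k where "k = \<zeta> n p * (N n * dird H 1 (N n * z p))"
      have k: "0 \<le> k" "k \<le> Ce * (N n * C1)"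
        unfolding k_def using \<zeta>b[of n p] N(1)[of n] HD(6) C1 Ce(1)
        by (auto intro!: mult_nonneg_nonneg mult_mono)
      have 2: "k * (- (\<Sum>b\<in>Basis. F b p * G b p)) \<le> (Ce * C1 * N n powr (- \<alpha>)) * Q p"
      \<comment> \<open>The derivative of the approximate sign lives only in this strip. There
        \<open>z p\<close> is at most 1/N, so the power \<open>1 + \<alpha>\<close> beats the factor
        \<open>N n\<close> and leaves \<open>N n powr (- \<alpha>)\<close>.\<close>
      proof (cases "z p > 0 \<and> N n * z p < 1")
        case False
        then have "N n * z p \<le> 0 \<or> N n * z p \<ge> 1" using N(1)[of n] by (auto simp: mult_le_0_iff)
        then have "k = 0" unfolding k_def using HD(8,9) by auto
        then show ?thesis using Ce C1 Q(2) by simp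
      next
        case True
        then have "z p \<le> 1 / N n" using N(1)[of n] by (simp add: pos_le_divide_eq mult.commute)
        then have "z p powr (1 + \<alpha>) \<le> (1 / N n) powr (1 + \<alpha>)" using True \<alpha> by (intro powr_mono2) auto
        then have "- (\<Sum>b\<in>Basis. F b p * G b p) \<le> (1 / N n) powr (1 + \<alpha>) * Q p"
          using elim True Q(2)[of p] by (meson mult_right_mono order_trans)
        then have "k * (- (\<Sum>b\<in>Basis. F b p * G b p)) \<le> k * ((1 / N n) powr (1 + \<alpha>) * Q p)"
          by (intro mult_left_mono k)
        also have "\<dots> \<le> (Ce * (N n * C1)) * ((1 / N n) powr (1 + \<alpha>) * Q p)"
          by (intro mult_right_mono k) (use Q in auto)
        also have "\<dots> = (Ce * C1 * Q p) * (N n * (1 / N n) powr (1 + \<alpha>))" by simp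
        also have "N n * (1 / N n) powr (1 + \<alpha>) = N n powr (- \<alpha>)"
          using N(1)[of n] by (simp add: powr_divide powr_add powr_minus field_simps)
        also have "(Ce * C1 * Q p) * N n powr (- \<alpha>) = (Ce * C1 * N n powr (- \<alpha>)) * Q p" by simp
        finally show ?thesis .
      qed
      have "- (\<Sum>b\<in>Basis. R n b p) = (\<Sum>b\<in>Basis. - (F b p * (dird (\<zeta> n) (b, 0) p * H (N n * z p))))
          + k * (- (\<Sum>b\<in>Basis. F b p * G b p))"
        unfolding R_def k_def sum_distrib_left sum_negf[symmetric] sum.distrib[symmetric]
        by (intro sum.cong) (auto simp: algebra_simps)
      also have "\<dots> \<le> (\<Sum>b\<in>Basis. (Cx * Ce * C1 / N n) * (\<bar>F b p\<bar> * \<bar>z p\<bar>)) + (Ce * C1 * N n powr (- \<alpha>)) * Q p"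
        by (intro add_mono sum_mono 1 2)
      finally show ?case unfolding S_def sum_distrib_left .
    qed
    have le: "(LINT p|lebesgue. g p * (\<zeta> n p * H (N n * z p)))
        \<le> (Cx * Ce * C1 / N n) * (LINT p|lebesgue. S p) + (Ce * C1 * N n powr (- \<alpha>)) * (LINT p|lebesgue. Q p)" for n
    proof -
      have "(LINT p|lebesgue. g p * (\<zeta> n p * H (N n * z p))) = (LINT p|lebesgue. - (\<Sum>b\<in>Basis. R n b p))"
        unfolding id using iR by (simp add: Bochner_Integration.integral_sum)
      also have "\<dots> \<le> (LINT p|lebesgue. (Cx * Ce * C1 / N n) * S p + (Ce * C1 * N n powr (- \<alpha>)) * Q p)"
        by (rule integral_mono_AE[OF _ _ bound]) (use iR iS Q(1) in \<open>auto intro!: Bochner_Integration.integrable_sum\<close>)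
      finally show ?thesis using iS Q(1) by simp
    qed
    have Nlim: "filterlim N at_top sequentially"
      unfolding N_def by (rule filterlim_compose[OF filterlim_real_sequentially filterlim_Suc])
    have lim0: "(\<lambda>n. (Cx * Ce * C1 / N n) * (LINT p|lebesgue. S p) + (Ce * C1 * N n powr (- \<alpha>)) * (LINT p|lebesgue. Q p))
        \<longlonglongrightarrow> 0 * (LINT p|lebesgue. S p) + (Ce * C1 * 0) * (LINT p|lebesgue. Q p)"
      by (intro tendsto_add tendsto_mult tendsto_const tendsto_divide_0[OF tendsto_const]
          filterlim_at_top_imp_at_infinity Nlim tendsto_neg_powr) (use \<alpha> in auto)
    have "(\<lambda>n. LINT p|lebesgue. g p * (\<zeta> n p * H (N n * z p)))
        \<longlonglongrightarrow> (LINT p|lebesgue. g p * \<eta> (snd p) * (if z p > 0 then 1 else 0))"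
    proof (rule integral_dominated_convergence)
      show "integrable lebesgue (\<lambda>p. Ce * \<bar>g p\<bar>)" using g by simp
      have [measurable]: "(\<lambda>p. \<eta> (snd p)) \<in> borel_measurable (lebesgue :: ('a \<times> real) measure)"
        by (rule borel_measurable_lebesgue_snd[OF test_borel[OF \<eta>(1)]])
      show "(\<lambda>p. g p * \<eta> (snd p) * (if z p > 0 then 1 else 0)) \<in> borel_measurable lebesgue" by measurable
      show "(\<lambda>p. g p * (\<zeta> n p * H (N n * z p))) \<in> borel_measurable lebesgue" for n
        using test_borel_lebesgue[OF \<zeta>[of n]] smooth_borel[OF HD(1)] by measurable
      show "AE p in lebesgue. (\<lambda>n. g p * (\<zeta> n p * H (N n * z p))) \<longlonglongrightarrow> g p * \<eta> (snd p) * (if z p > 0 then 1 else 0)"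
      proof (intro AE_I2 tendsto_eventually)
        fix p :: "'a \<times> real"
        show "\<forall>\<^sub>F n in sequentially. g p * (\<zeta> n p * H (N n * z p)) = g p * \<eta> (snd p) * (if z p > 0 then 1 else 0)"
          using ev\<xi>[of "fst p"] evH[of "z p"] by eventually_elim (simp add: \<zeta>_def)
      qed
      show "AE p in lebesgue. norm (g p * (\<zeta> n p * H (N n * z p))) \<le> Ce * \<bar>g p\<bar>" for n
      proof (intro AE_I2)
        fix p :: "'a \<times> real"
        have "\<zeta> n p * H (N n * z p) \<le> Ce * 1" by (intro mult_mono \<zeta>b HD Ce)
        from mult_right_mono[OF this abs_ge_zero[of "g p"]]
        show "norm (g p * (\<zeta> n p * H (N n * z p))) \<le> Ce * \<bar>g p\<bar>"
          using \<zeta>b[of n p] HD(4)[of "N n * z p"] by (simp add: abs_mult mult_ac)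
      qed
    qed
    from LIMSEQ_le[OF this lim0] le show ?thesis by auto
  qed

  \<comment> \<open>The temporal half. The sign is now taken of \<open>w\<close>, whose time
    derivative is \<open>g\<close>; the derivative in direction (0, 1) does not touch the spatial
    factor of the cut-off.\<close>
  have time: "(LINT p|lebesgue. dird \<eta> 1 (snd p) * max (w p) 0 + \<eta> (snd p) * (if w p > 0 then 1 else 0) * g p) = 0"
    and time_int: "integrable lebesgue (\<lambda>p. dird \<eta> 1 (snd p) * max (w p) 0)"
    and time_int': "integrable lebesgue (\<lambda>p. \<eta> (snd p) * (if w p > 0 then 1 else 0) * g p)"
  proof -
    \<comment> \<open>Scaled so that the derivative is exactly the approximate sign
      \<open>H (N n * r)\<close> while the values stay within \<open>1 / N n\<close> of the positive
      part.\<close>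
    define Kn where "Kn n r = (1 / N n) * K (N n * r)" for n r
    have Kns: "smooth (Kn n)" for n
      unfolding Kn_def using smooth_scale_shift[OF K(1), of "N n" 0] by (intro smooth_mult smooth_const) simp
    have Knd: "dird (Kn n) 1 r = H (N n * r)" for n r
    proof -
      have "smooth (\<lambda>r. K (N n * r))" using smooth_scale_shift[OF K(1), of "N n" 0] by simp
      from smooth_real_deriv[OF this, of r]
      have "((\<lambda>r. K (N n * r)) has_real_derivative N n * H (N n * r)) (at r)"
        using dird_scale_shift[OF K(1), of "N n" 0 r] K(2) by simp
      from DERIV_cmult[OF this, of "1 / N n"]
      have "(Kn n has_real_derivative H (N n * r)) (at r)"
        using N(1)[of n] unfolding Kn_def by simp
      from dird_real_eq[OF this, of 1] show ?thesis by simp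
    qed
    have Knb: "\<bar>Kn n r\<bar> \<le> \<bar>r\<bar>" for n r
      using K(3)[of "N n * r"] N(1)[of n] by (simp add: Kn_def abs_mult divide_simps mult.commute)
    have Knl: "(\<lambda>n. Kn n r) \<longlonglongrightarrow> max r 0" for r
    proof -
      have bd: "\<bar>Kn n r - max r 0\<bar> \<le> 1 / N n" for n
      proof -
        have "max (N n * r) 0 = N n * max r 0" using N(1)[of n] by (auto simp: max_def mult_le_0_iff zero_le_mult_iff)
        then have "Kn n r - max r 0 = (1 / N n) * (K (N n * r) - max (N n * r) 0)"
          using N(1)[of n] by (simp add: Kn_def right_diff_distrib)
        then have "\<bar>Kn n r - max r 0\<bar> = (1 / N n) * \<bar>K (N n * r) - max (N n * r) 0\<bar>"
          using N(1)[of n] by (simp add: abs_mult)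
        also have "\<dots> \<le> (1 / N n) * 1" by (intro mult_left_mono K) (use N(1)[of n] in auto)
        finally show ?thesis by simp
      qed
      have l: "(\<lambda>n. 1 / N n) \<longlonglongrightarrow> 0"
        using LIMSEQ_inverse_real_of_nat by (simp add: N_def inverse_eq_divide)
      have "(\<lambda>n. Kn n r - max r 0) \<longlonglongrightarrow> 0"
        by (rule Lim_null_comparison[OF always_eventually l]) (use bd in auto)
      then show ?thesis by (simp add: LIM_zero_iff)
    qed
    have id: "(LINT p|lebesgue. dird (\<zeta> n) (0, 1) p * Kn n (w p) + \<zeta> n p * H (N n * w p) * g p) = 0" for n
      using weak_chain_rule_L1[OF U w \<zeta> Kns g wt, of n n] unfolding Knd .
    have [measurable]: "(\<lambda>p. \<eta> (snd p)) \<in> borel_measurable (lebesgue :: ('a \<times> real) measure)"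
      "(\<lambda>p. dird \<eta> 1 (snd p)) \<in> borel_measurable (lebesgue :: ('a \<times> real) measure)"
      by (intro borel_measurable_lebesgue_snd test_borel[OF \<eta>(1)] test_borel[OF test_dird[OF \<eta>(1)]])+
    have dom: "integrable lebesgue (\<lambda>p. Ce' * \<bar>w p\<bar> + Ce * \<bar>g p\<bar>)" using w(1) g by simp
    \<comment> \<open>One domination for all uses: the full integrand, and with \<open>B = 0\<close>
      or \<open>A = 0\<close> each of its two summands alone.\<close>
    have b: "\<bar>A * a + B * (h * g p)\<bar> \<le> Ce' * \<bar>w p\<bar> + Ce * \<bar>g p\<bar>"
      if "\<bar>A\<bar> \<le> Ce'" "\<bar>a\<bar> \<le> \<bar>w p\<bar>" "\<bar>B\<bar> \<le> Ce" "0 \<le> h" "h \<le> 1" for A a B h p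
    proof -
      have "\<bar>A * a\<bar> \<le> Ce' * \<bar>w p\<bar>" unfolding abs_mult using that Ce' by (intro mult_mono) auto
      moreover have "\<bar>B * (h * g p)\<bar> \<le> Ce * (1 * \<bar>g p\<bar>)" unfolding abs_mult using that Ce by (intro mult_mono) auto
      ultimately show ?thesis by linarith
    qed
    have "(\<lambda>n. LINT p|lebesgue. dird (\<zeta> n) (0, 1) p * Kn n (w p) + \<zeta> n p * H (N n * w p) * g p)
      \<longlonglongrightarrow> (LINT p|lebesgue. dird \<eta> 1 (snd p) * max (w p) 0 + \<eta> (snd p) * (if w p > 0 then 1 else 0) * g p)"
    proof (rule integral_dominated_convergence[OF _ _ dom])
      show "(\<lambda>p. dird (\<zeta> n) (0, 1) p * Kn n (w p) + \<zeta> n p * H (N n * w p) * g p) \<in> borel_measurable lebesgue" for n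
        using test_borel_lebesgue[OF \<zeta>[of n]] test_borel_lebesgue[OF test_dird[OF \<zeta>[of n]], of "(0,1)"]
          smooth_borel[OF HD(1)] smooth_borel[OF Kns] by measurable
      show "AE p in lebesgue. (\<lambda>n. dird (\<zeta> n) (0, 1) p * Kn n (w p) + \<zeta> n p * H (N n * w p) * g p)
        \<longlonglongrightarrow> dird \<eta> 1 (snd p) * max (w p) 0 + \<eta> (snd p) * (if w p > 0 then 1 else 0) * g p"
      proof (intro AE_I2 tendsto_add tendsto_mult Knl tendsto_const)
        fix p :: "'a \<times> real"
        show "(\<lambda>n. H (N n * w p)) \<longlonglongrightarrow> (if 0 < w p then 1 else 0)" by (rule tendsto_eventually[OF evH])
        have *: "dird \<xi> 0 x = 0" for x using linear_0[OF dird_linear[OF test_smooth[OF \<xi>(1)]]] .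
        show "(\<lambda>n. dird (\<zeta> n) (0, 1) p) \<longlonglongrightarrow> dird \<eta> 1 (snd p)"
          by (rule tendsto_eventually, rule eventually_mono[OF ev\<xi>[of "fst p"]]) (simp add: \<zeta>d *)
        show "(\<lambda>n. \<zeta> n p) \<longlonglongrightarrow> \<eta> (snd p)"
          by (rule tendsto_eventually, rule eventually_mono[OF ev\<xi>[of "fst p"]]) (simp add: \<zeta>_def)
      qed
      show "AE p in lebesgue. norm (dird (\<zeta> n) (0, 1) p * Kn n (w p) + \<zeta> n p * H (N n * w p) * g p) \<le> Ce' * \<bar>w p\<bar> + Ce * \<bar>g p\<bar>" for n
      proof (intro AE_I2)
        fix p :: "'a \<times> real"
        have *: "dird \<xi> 0 x = 0" for x using linear_0[OF dird_linear[OF test_smooth[OF \<xi>(1)]]] .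
        have "\<bar>dird (\<zeta> n) (0, 1) p\<bar> \<le> 1 * Ce'"
          unfolding \<zeta>d by (simp add: * abs_mult) (use mult_mono[OF \<xi>(3) Ce'(2)] \<xi>(2) in force)
        then have "\<bar>dird (\<zeta> n) (0, 1) p * Kn n (w p) + \<zeta> n p * (H (N n * w p) * g p)\<bar> \<le> Ce' * \<bar>w p\<bar> + Ce * \<bar>g p\<bar>"
          using \<zeta>b[of n p] by (intro b Knb HD) auto
        then show "norm (dird (\<zeta> n) (0, 1) p * Kn n (w p) + \<zeta> n p * H (N n * w p) * g p) \<le> Ce' * \<bar>w p\<bar> + Ce * \<bar>g p\<bar>"
          by (simp add: mult.assoc)
      qed
    qed measurable
    then show "(LINT p|lebesgue. dird \<eta> 1 (snd p) * max (w p) 0 + \<eta> (snd p) * (if w p > 0 then 1 else 0) * g p) = 0"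
      unfolding id by (simp add: LIMSEQ_const_iff)
    show "integrable lebesgue (\<lambda>p. dird \<eta> 1 (snd p) * max (w p) 0)"
    proof (rule Bochner_Integration.integrable_bound[OF dom])
      show "AE p in lebesgue. norm (dird \<eta> 1 (snd p) * max (w p) 0) \<le> norm (Ce' * \<bar>w p\<bar> + Ce * \<bar>g p\<bar>)"
      proof (intro AE_I2)
        fix p :: "'a \<times> real"
        show "norm (dird \<eta> 1 (snd p) * max (w p) 0) \<le> norm (Ce' * \<bar>w p\<bar> + Ce * \<bar>g p\<bar>)"
          using b[of "dird \<eta> 1 (snd p)" "max (w p) 0" p 0 0] Ce' Ce by simp
      qed
    qed measurable
    show "integrable lebesgue (\<lambda>p. \<eta> (snd p) * (if w p > 0 then 1 else 0) * g p)"
    proof (rule Bochner_Integration.integrable_bound[OF dom])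
      show "AE p in lebesgue. norm (\<eta> (snd p) * (if w p > 0 then 1 else 0) * g p) \<le> norm (Ce' * \<bar>w p\<bar> + Ce * \<bar>g p\<bar>)"
      proof (intro AE_I2)
        fix p :: "'a \<times> real"
        show "norm (\<eta> (snd p) * (if w p > 0 then 1 else 0) * g p) \<le> norm (Ce' * \<bar>w p\<bar> + Ce * \<bar>g p\<bar>)"
          using b[of 0 0 p "\<eta> (snd p)" "if w p > 0 then 1 else 0"] Ce' Ce by (simp add: mult.assoc split: if_splits)
      qed
    qed measurable
  qed
  \<comment> \<open>By \<open>sgn\<close> the two indicators agree almost everywhere; the identity
    \<open>time\<close> then converts the inequality \<open>space\<close> into the claim.\<close>
  have "(LINT p|lebesgue. g p * \<eta> (snd p) * (if z p > 0 then 1 else 0))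
      = (LINT p|lebesgue. \<eta> (snd p) * (if w p > 0 then 1 else 0) * g p)"
  proof (rule integral_cong_AE)
    show "AE p in lebesgue. g p * \<eta> (snd p) * (if z p > 0 then 1 else 0) = \<eta> (snd p) * (if w p > 0 then 1 else 0) * g p"
      using sgn by eventually_elim simp
    show "(\<lambda>p. \<eta> (snd p) * (if w p > 0 then 1 else 0) * g p) \<in> borel_measurable lebesgue" using time_int' by auto
    have [measurable]: "(\<lambda>p::'a \<times> real. \<eta> (snd p)) \<in> borel_measurable lebesgue"
      by (rule borel_measurable_lebesgue_snd[OF test_borel[OF \<eta>(1)]])
    show "(\<lambda>p. g p * \<eta> (snd p) * (if z p > 0 then 1 else 0)) \<in> borel_measurable lebesgue" by measurable
  qed
  with space time time_int time_int' show ?thesis by simp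
qed

section \<open>Monotonicity in time and the initial trace\<close>

lemma continuous_on_extended_integrable:
  fixes W :: "real \<Rightarrow> real"
  assumes "continuous_on {0..T} W"
  shows "integrable lebesgue (\<lambda>t. if t \<in> {0..T} then W t else 0)"
proof -
  have "integrable lborel (\<lambda>x. indicator {0..T} x *\<^sub>R W x)"
    by (rule borel_integrable_compact[OF _ assms]) simp
  moreover have "(\<lambda>x. indicator {0..T} x *\<^sub>R W x) = (\<lambda>t. if t \<in> {0..T} then W t else 0)"
    by (auto simp: indicator_def)
  ultimately have "integrable lborel (\<lambda>t. if t \<in> {0..T} then W t else 0)" by simp
  then show ?thesis using integrable_completion[OF borel_measurable_integrable] by blast
qed

text \<open>Tested with smoothed indicators of [s, t], the hypothesis compares \<open>W\<close> at
  two interior times. Since the admissible \<open>\<eta>\<close> have to vanish near 0 and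
  \<open>T\<close>, the end points are reached afterwards by continuity.\<close>

lemma decreasing_of_weak_derivative:
  fixes W :: "real \<Rightarrow> real"
  assumes W: "continuous_on {0..T} W" and T: "T > 0"
    and weak: "\<And>\<eta>. \<eta> \<in> test_functions {0<..<T} \<Longrightarrow> (\<And>t. 0 \<le> \<eta> t) \<Longrightarrow>
      0 \<le> (LINT t|lebesgue. dird \<eta> 1 t * (if t \<in> {0..T} then W t else 0))"
    and t: "t \<in> {0..T}"
  shows "W t \<le> W 0"
proof -
  obtain H where H: "smooth_step H" using ex_smooth_step .
  note HD = smooth_stepD[OF H]
  define W' where "W' t = (if t \<in> {0..T} then W t else 0)" for t
  have W'i: "integrable lebesgue W'"
    using continuous_on_extended_integrable[OF W] by (simp add: W'_def[abs_def])
  have inner: "W t \<le> W s" if st: "0 < s" "s < t" "t < T" for s t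
  proof -
    define k where "k n s r = real n * dird H 1 (real n * (r - s))" for n s r
    \<comment> \<open>A plateau rising just after \<open>s\<close> and falling just after
      \<open>t\<close>. It is nonnegative because \<open>H\<close> is monotone, and its derivative
      is a difference of two Dirac kernels, at \<open>s\<close> with sign plus and at
      \<open>t\<close> with sign minus.\<close>
    define \<eta> where "\<eta> n r = H (real n * (r - s)) - H (real n * (r - t))" for n r
    have i: "integrable lebesgue (\<lambda>r. W' r * k n q r)" if "n > 0" for n q
      using test_integrable_mult[OF step_kernel_test[OF H, of "real n" q] W'i] that
      unfolding k_def by simp
    obtain n0 :: nat where n0: "n0 > 0" "1 / (T - t) < real n0"
      using reals_Archimedean2[of "1 / (T - t)"] st
      by (metis diff_gt_0_iff_gt of_nat_0_less_iff order_less_trans zero_less_divide_1_iff)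
    have "0 \<le> (LINT r|lebesgue. W' r * k n s r) - (LINT r|lebesgue. W' r * k n t r)" if n: "n \<ge> n0" for n
    proof -
      have np: "real n > 0" "n > 0" using n n0 by auto
      have "1 / (T - t) < real n" using n n0 by linarith
      then have tn: "t + 1 / real n < T" using np st by (simp add: field_simps)
      have sm: "smooth (\<eta> n)" unfolding \<eta>_def by (intro smooth_minus smooth_scale_shift HD)
      have \<eta>t: "\<eta> n \<in> test_functions {0<..<T}"
      proof (rule test_functionsI[OF sm compact_Icc[of s "t + 1 / real n"]])
        show "{s..t + 1 / real n} \<subseteq> {0<..<T}" using st tn by auto
        fix r assume r: "\<eta> n r \<noteq> 0"
        have "s \<le> r"
        proof (rule ccontr)
          assume "\<not> s \<le> r"
          then have "real n * (r - s) \<le> 0" "real n * (r - t) \<le> 0" using np st by (auto simp: mult_le_0_iff)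
          with r HD(2) show False by (simp add: \<eta>_def)
        qed
        moreover have "r \<le> t + 1 / real n"
        proof (rule ccontr)
          assume "\<not> r \<le> t + 1 / real n"
          then have "real n * (r - t) \<ge> 1" using np by (simp add: field_simps)
          moreover have "real n * (r - s) \<ge> real n * (r - t)" using np st by (intro mult_left_mono) auto
          ultimately show False using r HD(3) by (simp add: \<eta>_def)
        qed
        ultimately show "r \<in> {s..t + 1 / real n}" by simp
      qed
      have "0 \<le> \<eta> n r" for r
      proof -
        have "real n * (r - t) \<le> real n * (r - s)" using np st by (intro mult_left_mono) auto
        with HD(7) show ?thesis by (simp add: \<eta>_def mono_def)
      qed
      from weak[OF \<eta>t this] have nn: "0 \<le> (LINT r|lebesgue. dird (\<eta> n) 1 r * W' r)" by (simp add: W'_def)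
      have "dird (\<eta> n) 1 r = k n s r - k n t r" for r
      proof -
        have "((\<lambda>r. H (real n * (r - q))) has_real_derivative k n q r) (at r)" for q
          using smooth_real_deriv[OF smooth_scale_shift[OF HD(1), of "real n" q], of r]
          unfolding dird_scale_shift[OF HD(1)] k_def .
        from dird_real_eq[OF DERIV_diff[OF this[of s] this[of t]], of 1] show ?thesis by (simp add: \<eta>_def[abs_def])
      qed
      then have "(LINT r|lebesgue. dird (\<eta> n) 1 r * W' r) = (LINT r|lebesgue. W' r * k n s r - W' r * k n t r)"
        by (simp only: right_diff_distrib mult.commute)
      also have "\<dots> = (LINT r|lebesgue. W' r * k n s r) - (LINT r|lebesgue. W' r * k n t r)"
        using i[OF np(2)] by simp
      finally show ?thesis using nn by simp
    qed
    moreover have "(\<lambda>n. (LINT r|lebesgue. W' r * k n s r) - (LINT r|lebesgue. W' r * k n t r)) \<longlonglongrightarrow> W s - W t"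
      unfolding k_def W'_def by (intro tendsto_diff Dirac_sequence[OF H W]) (use st in auto)
    ultimately have "0 \<le> W s - W t" by (intro LIMSEQ_le_const[of _ _ 0] exI[of _ n0]) auto
    then show ?thesis by simp
  qed
  \<comment> \<open>The shift by 2 makes the factor at most 1/2 from n = 0 on, so the approximating
    times are strictly inside the interval at every index.\<close>
  have l0: "(\<lambda>n. 1 / real (n + 2)) \<longlonglongrightarrow> 0"
    using LIMSEQ_ignore_initial_segment[OF lim_1_over_n, of 2] by simp
  have lt: "W t \<le> W 0" if "0 < t" "t < T" for t
  proof -
    have "(\<lambda>n. W (t * (1 / real (n + 2)))) \<longlonglongrightarrow> W (t * 0)"
    proof (rule continuous_on_tendsto_compose[OF W])
      show "\<forall>\<^sub>F n in sequentially. t * (1 / real (n + 2)) \<in> {0..T}"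
        using that mult_left_le[of "1 / real (n + 2)" t for n] by (intro always_eventually) (force intro: order_trans)
      show "(\<lambda>n. t * (1 / real (n + 2))) \<longlonglongrightarrow> t * 0" by (intro tendsto_mult tendsto_const l0)
    qed (use that in auto)
    moreover have "W t \<le> W (t * (1 / real (n + 2)))" for n
      by (rule inner) (use that in \<open>auto simp: field_simps intro!: add_pos_nonneg\<close>)
    ultimately show ?thesis by (intro LIMSEQ_le_const[of _ _ "W t"]) auto
  qed
  show ?thesis
  proof (cases "t = T")
    case False
    with t lt[of t] show ?thesis by (cases "t = 0") auto
  next
    case True
    have "(\<lambda>n. W (T * (1 - 1 / real (n + 2)))) \<longlonglongrightarrow> W (T * (1 - 0))"
    proof (rule continuous_on_tendsto_compose[OF W])
      show "\<forall>\<^sub>F n in sequentially. T * (1 - 1 / real (n + 2)) \<in> {0..T}"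
        using T by (intro always_eventually) (auto simp: field_simps)
      show "(\<lambda>n. T * (1 - 1 / real (n + 2))) \<longlonglongrightarrow> T * (1 - 0)"
        by (intro tendsto_mult tendsto_diff tendsto_const l0)
    qed (use T in auto)
    moreover have "W (T * (1 - 1 / real (n + 2))) \<le> W 0" for n
      by (rule lt) (use T in \<open>auto simp: field_simps intro!: add_pos_nonneg\<close>)
    ultimately show ?thesis using True by (intro LIMSEQ_le_const2[of _ _ "W 0"]) auto
  qed
qed

text \<open>Every value of a mollification is an integral against a test function, hence 0, while
  the mollifications converge to \<open>f\<close> in L^1.\<close>

lemma ae_zero_of_test_integrals:
  fixes f :: "'a::euclidean_space \<Rightarrow> real"
  assumes f: "integrable lebesgue f"
    and zero: "\<And>\<psi>. \<psi> \<in> test_functions UNIV \<Longrightarrow> (LINT x|lebesgue. f x * \<psi> x) = 0"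
  shows "AE x in lebesgue. f x = 0"
proof -
  obtain \<rho> :: "nat \<Rightarrow> 'a \<Rightarrow> real" where \<rho>: "mollifiers \<rho>" using mollifiers_exist .
  have c: "conv f (\<rho> n) p = 0" for n p
    unfolding conv_def by (rule zero[OF test_translate[OF mollifiersD(1)[OF \<rho>]]])
  have "(\<lambda>n::nat. LINT p|lebesgue. \<bar>f p\<bar>) \<longlonglongrightarrow> 0"
    using mollify_Lq(3)[OF \<rho>, of 1 f] f by (simp add: c)
  then have "(LINT p|lebesgue. \<bar>f p\<bar>) = 0" by (simp add: LIMSEQ_const_iff)
  then show ?thesis
    using integral_nonneg_eq_0_iff_AE[of lebesgue "\<lambda>p. \<bar>f p\<bar>"] f by simp
qed

lemma Lp_1_iff:
  fixes f :: "'b \<Rightarrow> real"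
  shows "Lp 1 M f \<longleftrightarrow> integrable M f"
  using integrable_abs_iff[of f M] by (auto simp: Lp_def)

lemma C_L1_integrable: "C_L1 T u \<Longrightarrow> t \<in> {0..T} \<Longrightarrow> integrable lebesgue (\<lambda>x. u (x, t))"
  by (auto simp: C_L1_def Lp_1_iff)

lemma C_L1_diff:
  assumes u: "C_L1 T u" and v: "C_L1 T v"
  shows "C_L1 T (\<lambda>z. u z - v z)"
  unfolding C_L1_def
proof (intro conjI ballI)
  fix t assume t: "t \<in> {0..T}"
  note ui = C_L1_integrable[OF u] and vi = C_L1_integrable[OF v]
  show "Lp 1 lebesgue (\<lambda>x. u (x, t) - v (x, t))" using ui[OF t] vi[OF t] by (simp add: Lp_1_iff)
  have l: "((\<lambda>s. (LINT x|lebesgue. \<bar>u (x, s) - u (x, t)\<bar>) + (LINT x|lebesgue. \<bar>v (x, s) - v (x, t)\<bar>)) \<longlongrightarrow> 0) (at t within {0..T})"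
    using u v t unfolding C_L1_def by (intro tendsto_add_zero) auto
  have "\<forall>\<^sub>F s in at t within {0..T}. s \<in> {0..T}" by (simp add: eventually_at_filter)
  then have "\<forall>\<^sub>F s in at t within {0..T}. norm (LINT x|lebesgue. \<bar>u (x, s) - v (x, s) - (u (x, t) - v (x, t))\<bar>)
      \<le> (LINT x|lebesgue. \<bar>u (x, s) - u (x, t)\<bar>) + (LINT x|lebesgue. \<bar>v (x, s) - v (x, t)\<bar>)"
  proof eventually_elim
    case (elim s)
    have "(LINT x|lebesgue. \<bar>u (x, s) - v (x, s) - (u (x, t) - v (x, t))\<bar>)
      \<le> (LINT x|lebesgue. \<bar>u (x, s) - u (x, t)\<bar> + \<bar>v (x, s) - v (x, t)\<bar>)"
      by (rule integral_mono) (use ui[OF t] vi[OF t] ui[OF elim] vi[OF elim] in auto)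
    then show ?case using ui[OF t] vi[OF t] ui[OF elim] vi[OF elim] by simp
  qed
  then show "((\<lambda>s. LINT x|lebesgue. \<bar>u (x, s) - v (x, s) - (u (x, t) - v (x, t))\<bar>) \<longlongrightarrow> 0) (at t within {0..T})"
    by (rule Lim_null_comparison[OF _ l])
qed

text \<open>\<open>\<Phi>\<close> may depend on \<open>x\<close> so that one statement covers the
  absolute value, the positive part and multiplication by a fixed test function.\<close>

lemma C_L1_continuous_on:
  assumes u: "C_L1 T u" and K: "\<And>x a b. \<bar>\<Phi> x a - \<Phi> x b\<bar> \<le> K * \<bar>a - b\<bar>" "\<And>x. \<Phi> x 0 = 0"
    and m: "\<And>f. f \<in> borel_measurable lebesgue \<Longrightarrow> (\<lambda>x. \<Phi> x (f x)) \<in> borel_measurable lebesgue"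
  shows "t \<in> {0..T} \<Longrightarrow> integrable lebesgue (\<lambda>x. \<Phi> x (u (x, t)))"
    "continuous_on {0..T} (\<lambda>t. LINT x|lebesgue. \<Phi> x (u (x, t)))"
proof -
  note ui = C_L1_integrable[OF u]
  show i: "integrable lebesgue (\<lambda>x. \<Phi> x (u (x, t)))" if t: "t \<in> {0..T}" for t
  proof (rule Bochner_Integration.integrable_bound)
    show "integrable lebesgue (\<lambda>x. K * \<bar>u (x, t)\<bar>)" using ui[OF t] by simp
    show "(\<lambda>x. \<Phi> x (u (x, t))) \<in> borel_measurable lebesgue" by (rule m) (use ui[OF t] in auto)
    have "\<bar>\<Phi> x (u (x, t))\<bar> \<le> K * \<bar>u (x, t)\<bar>" for x using K(1)[of x "u (x, t)" 0] K(2)[of x] by simp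
    then show "AE x in lebesgue. norm (\<Phi> x (u (x, t))) \<le> norm (K * \<bar>u (x, t)\<bar>)"
      by (intro AE_I2) (auto intro: order_trans[OF _ abs_ge_self])
  qed
  show "continuous_on {0..T} (\<lambda>t. LINT x|lebesgue. \<Phi> x (u (x, t)))"
    unfolding continuous_on_def
  proof
    fix t assume t: "t \<in> {0..T}"
    have l: "((\<lambda>s. K * (LINT x|lebesgue. \<bar>u (x, s) - u (x, t)\<bar>)) \<longlongrightarrow> 0) (at t within {0..T})"
      using u t unfolding C_L1_def by (intro tendsto_mult_right_zero) auto
    have "\<forall>\<^sub>F s in at t within {0..T}. s \<in> {0..T}" by (simp add: eventually_at_filter)
    then have "\<forall>\<^sub>F s in at t within {0..T}. norm ((LINT x|lebesgue. \<Phi> x (u (x, s))) - (LINT x|lebesgue. \<Phi> x (u (x, t))))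
        \<le> K * (LINT x|lebesgue. \<bar>u (x, s) - u (x, t)\<bar>)"
    proof eventually_elim
      case (elim s)
      have "norm ((LINT x|lebesgue. \<Phi> x (u (x, s))) - (LINT x|lebesgue. \<Phi> x (u (x, t))))
          = \<bar>LINT x|lebesgue. \<Phi> x (u (x, s)) - \<Phi> x (u (x, t))\<bar>"
        using i[OF elim] i[OF t] by simp
      also have "\<dots> \<le> (LINT x|lebesgue. \<bar>\<Phi> x (u (x, s)) - \<Phi> x (u (x, t))\<bar>)" by (rule integral_abs_bound)
      also have "\<dots> \<le> (LINT x|lebesgue. K * \<bar>u (x, s) - u (x, t)\<bar>)"
        by (rule integral_mono) (use i[OF elim] i[OF t] ui[OF elim] ui[OF t] K in auto)
      finally show ?case by simp
    qed
    then have "((\<lambda>s. (LINT x|lebesgue. \<Phi> x (u (x, s))) - (LINT x|lebesgue. \<Phi> x (u (x, t)))) \<longlongrightarrow> 0) (at t within {0..T})"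
      by (rule Lim_null_comparison[OF _ l])
    then show "((\<lambda>t. LINT x|lebesgue. \<Phi> x (u (x, t))) \<longlongrightarrow> (LINT x|lebesgue. \<Phi> x (u (x, t)))) (at t within {0..T})"
      by (simp add: LIM_zero_iff)
  qed
qed

lemma sets_lebesgue_cylinder [simp]: "(UNIV :: 'a::euclidean_space set) \<times> {0..T::real} \<in> sets lebesgue"
  by (intro sets_completionI_sets) (simp add: closed_Times borel_closed)

lemma measurable_extend:
  fixes f :: "'a::euclidean_space \<Rightarrow> real"
  assumes "S \<in> sets lebesgue" "f \<in> borel_measurable (lebesgue_on S)"
  shows "(\<lambda>p. if p \<in> S then f p else 0) \<in> borel_measurable lebesgue"
proof -
  have "(\<lambda>p. indicator S p *\<^sub>R f p) \<in> borel_measurable lebesgue"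
    using borel_measurable_restrict_space_iff[of S lebesgue f] assms by simp
  moreover have "(\<lambda>p. indicator S p *\<^sub>R f p) = (\<lambda>p. if p \<in> S then f p else 0)" by (auto simp: indicator_def)
  ultimately show ?thesis by simp
qed

text \<open>The L^1 norm of the slices is continuous on a compact time interval, hence bounded, and
  Tonelli's criterion applies.\<close>

lemma C_L1_integrable_cylinder:
  fixes u :: "'a::euclidean_space \<times> real \<Rightarrow> real"
  assumes u: "C_L1 T u" and m: "u \<in> borel_measurable (cylinder T)"
  shows "integrable lebesgue (\<lambda>p. if p \<in> UNIV \<times> {0..T} then u p else 0)"
proof -
  have c: "continuous_on {0..T} (\<lambda>t. LINT x|lebesgue. \<bar>u (x, t)\<bar>)"
    by (rule C_L1_continuous_on(2)[OF u, of "\<lambda>x. abs" 1]) auto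
  have "bounded ((\<lambda>t. LINT x|lebesgue. \<bar>u (x, t)\<bar>) ` {0..T})"
    by (intro compact_imp_bounded compact_continuous_image[OF c]) simp
  then obtain C where C: "\<forall>t\<in>{0..T}. \<bar>LINT x|lebesgue. \<bar>u (x, t)\<bar>\<bar> \<le> C"
    unfolding bounded_iff by auto
  show ?thesis
  proof (rule integrable_lebesgue_prodI[where S="{0..T}" and C=C])
    show "(\<lambda>p. if p \<in> UNIV \<times> {0..T} then u p else 0) \<in> borel_measurable lebesgue"
      by (rule measurable_extend[OF sets_lebesgue_cylinder m])
    show "{0..T} \<in> lmeasurable" by simp
    fix t assume t: "t \<in> {0..T}"
    then show "integrable lebesgue (\<lambda>x. if (x, t) \<in> UNIV \<times> {0..T} then u (x, t) else 0) \<and>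
      (LINT x|lebesgue. \<bar>if (x, t) \<in> UNIV \<times> {0..T} then u (x, t) else 0\<bar>) \<le> C"
      using C_L1_integrable[OF u t] bspec[OF C t] by auto
  qed auto
qed

lemma LINT_cylinder_iterated:
  fixes u :: "'a::euclidean_space \<times> real \<Rightarrow> real" and h :: "real \<Rightarrow> real"
  assumes i: "integrable lebesgue (\<lambda>p. (if p \<in> UNIV \<times> {0..T} then u p else 0) * h (snd p))"
  shows "(LINT p|lebesgue. (if p \<in> UNIV \<times> {0..T} then u p else 0) * h (snd p))
    = (LINT t|lebesgue. (if t \<in> {0..T} then LINT x|lebesgue. u (x, t) else 0) * h t)"
  unfolding lebesgue_Fubini(3)[OF i] by (rule Bochner_Integration.integral_cong) auto

text \<open>The weak formulation ties the datum to the solution only through an integral, so the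
  value at time 0 has to be recovered. Testing with a product of \<open>\<xi>\<close> and a function
  of time that drops from 1 to 0 right after t = 0 turns the time derivative into a Dirac kernel at
  0, and the flux term disappears because its time support shrinks.\<close>

lemma initial_trace:
  fixes w :: "'a::euclidean_space \<times> real \<Rightarrow> real"
  assumes T: "T > 0" and w: "C_L1 T w" "w \<in> borel_measurable (cylinder T)" and w0: "integrable lebesgue w0"
    and F: "\<And>b. b \<in> Basis \<Longrightarrow> F b \<in> borel_measurable lebesgue"
      "\<And>b. b \<in> Basis \<Longrightarrow> integrable lebesgue (\<lambda>p. (F b p)\<^sup>2)"
      "\<And>b p. p \<notin> UNIV \<times> {0..T} \<Longrightarrow> F b p = 0"
    and eq: "\<And>\<phi>. \<phi> \<in> test_functions (UNIV \<times> {..<T}) \<Longrightarrow>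
      (LINT p|lebesgue. (if p \<in> UNIV \<times> {0..T} then w p else 0) * dird \<phi> (0, 1) p) =
        - (LINT x|lebesgue. w0 x * \<phi> (x, 0)) + (\<Sum>b\<in>Basis. LINT p|lebesgue. F b p * dird \<phi> (b, 0) p)"
  shows "AE x in lebesgue. w (x, 0) = w0 x"
proof -
  obtain H where H: "smooth_step H" using ex_smooth_step .
  note HD = smooth_stepD[OF H]
  have wi: "integrable lebesgue (\<lambda>p. if p \<in> UNIV \<times> {0..T} then w p else 0)"
    by (rule C_L1_integrable_cylinder[OF w])
  have w0i: "integrable lebesgue (\<lambda>x. w (x, 0))" by (rule C_L1_integrable[OF w(1)]) (use T in simp)
  have "(LINT x|lebesgue. (w (x, 0) - w0 x) * \<xi> x) = 0" if \<xi>: "\<xi> \<in> test_functions UNIV" for \<xi> :: "'a \<Rightarrow> real"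
  proof -
    define U where "U t = (LINT x|lebesgue. w (x, t) * \<xi> x)" for t
    obtain C where C: "\<And>x. \<bar>\<xi> x\<bar> \<le> C" using test_bounded[OF \<xi>] by metis
    note [measurable] = test_borel_lebesgue[OF \<xi>]
    have "\<bar>a * \<xi> x - b * \<xi> x\<bar> \<le> C * \<bar>a - b\<bar>" for x a b
    proof -
      have "\<bar>a * \<xi> x - b * \<xi> x\<bar> = \<bar>a - b\<bar> * \<bar>\<xi> x\<bar>" by (simp add: left_diff_distrib[symmetric] abs_mult)
      also have "\<dots> \<le> \<bar>a - b\<bar> * C" by (intro mult_left_mono C) simp
      finally show ?thesis by (simp add: mult.commute)
    qed
    then have Uc: "continuous_on {0..T} U"
      unfolding U_def by (intro C_L1_continuous_on(2)[OF w(1), of "\<lambda>x a. a * \<xi> x" C]) auto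
    obtain n0 :: nat where n0: "n0 > 0" "1 / T < real n0"
      using reals_Archimedean2[of "1 / T"] T
      by (metis of_nat_0_less_iff order_less_trans zero_less_divide_1_iff)
    define N where "N n = real (n + n0)" for n
    have N: "N n > 0" "1 / N n < T" for n
    proof -
      show "N n > 0" using n0 by (simp add: N_def)
      have "1 / T < N n" using n0(2) by (simp add: N_def)
      then show "1 / N n < T" using T \<open>N n > 0\<close> by (simp add: field_simps)
    qed
    \<comment> \<open>The first step rises on [-2, -1] and only provides compact support on the side
      of negative times, which the cylinder does not see; for r >= 0 it is constantly 1, so the
      value at 0 is 1 and the derivative comes from the second step alone.\<close>
    define \<theta> where "\<theta> n r = H (1 * (r - (- 2))) - H (N n * (r - 0))" for n r
    have s\<theta>: "smooth (\<theta> n)" for n unfolding \<theta>_def by (intro smooth_minus smooth_scale_shift HD)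
    have t\<theta>: "\<theta> n \<in> test_functions {..<T}" for n
    proof (rule test_functionsI[OF s\<theta> compact_Icc[of "- 2" "1 / N n"]])
      show "{- 2..1 / N n} \<subseteq> {..<T}" using N(2)[of n] by auto
      fix r assume r: "\<theta> n r \<noteq> 0"
      have "- 2 \<le> r"
      proof (rule ccontr)
        assume "\<not> - 2 \<le> r"
        then have "1 * (r - (- 2)) \<le> 0" "N n * (r - 0) \<le> 0" using N(1)[of n] by (auto simp: mult_le_0_iff)
        with r HD(2) show False by (simp add: \<theta>_def)
      qed
      moreover have "r \<le> 1 / N n"
      proof (rule ccontr)
        assume a: "\<not> r \<le> 1 / N n"
        then have "1 \<le> N n * (r - 0)" using N(1)[of n] by (simp add: field_simps)
        moreover have "r > 0" using a N(1)[of n] less_trans[of 0 "1 / N n" r] by simp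
        then have "1 \<le> 1 * (r - (- 2))" by simp
        ultimately show False using r HD(3) by (simp add: \<theta>_def)
      qed
      ultimately show "r \<in> {- 2..1 / N n}" by simp
    qed
    define k where "k n r = N n * dird H 1 (N n * (r - 0))" for n r
    have \<theta>d: "dird (\<theta> n) 1 r = - k n r" if "r \<ge> 0" for n r
    proof -
      have "((\<lambda>r. H (c * (r - q))) has_real_derivative c * dird H 1 (c * (r - q))) (at r)" for c q
        using smooth_real_deriv[OF smooth_scale_shift[OF HD(1), of c q], of r]
        unfolding dird_scale_shift[OF HD(1)] .
      from dird_real_eq[OF DERIV_diff[OF this[of 1 "- 2"] this[of "N n" 0]], of 1]
      show ?thesis using that HD(9)[of "r + 2"] by (simp add: \<theta>_def[abs_def] k_def)
    qed
    have \<theta>01: "\<bar>\<theta> n r\<bar> \<le> 1" for n r unfolding \<theta>_def using HD(4,5) by (smt (verit))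
    define \<phi> where "\<phi> n p = \<xi> (fst p) * \<theta> n (snd p)" for n and p :: "'a \<times> real"
    have \<phi>: "\<phi> n \<in> test_functions (UNIV \<times> {..<T})" for n unfolding \<phi>_def by (rule test_prod(1)[OF \<xi> t\<theta>])
    have \<phi>d: "dird (\<phi> n) (v, s) p = \<xi> (fst p) * (s * dird (\<theta> n) 1 (snd p)) + dird \<xi> v (fst p) * \<theta> n (snd p)" for n v s p
      using test_prod(2)[OF \<xi> t\<theta>[of n], of "fst p" "snd p" v s] unfolding \<phi>_def by simp
    have \<xi>0: "dird \<xi> 0 x = 0" for x using linear_0[OF dird_linear[OF test_smooth[OF \<xi>]]] .
    have lhs: "(LINT p|lebesgue. (if p \<in> UNIV \<times> {0..T} then w p else 0) * dird (\<phi> n) (0, 1) p)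
      = - (LINT t|lebesgue. (if t \<in> {0..T} then U t else 0) * k n t)" for n
    proof -
      define u where "u p = w p * \<xi> (fst p)" for p
      have e: "(if p \<in> UNIV \<times> {0..T} then w p else 0) * dird (\<phi> n) (0, 1) p
        = (if p \<in> UNIV \<times> {0..T} then u p else 0) * (- k n (snd p))" for p
        by (cases p) (auto simp: \<phi>d \<xi>0 \<theta>d u_def)
      have "integrable lebesgue (\<lambda>p. (if p \<in> UNIV \<times> {0..T} then w p else 0) * dird (\<phi> n) (0, 1) p)"
        by (rule test_integrable_mult[OF test_dird[OF \<phi>] wi])
      then have "integrable lebesgue (\<lambda>p. (if p \<in> UNIV \<times> {0..T} then u p else 0) * (- k n (snd p)))" unfolding e .
      note it = LINT_cylinder_iterated[OF this]
      have Uu: "(LINT x|lebesgue. u (x, t)) = U t" for t by (simp add: u_def U_def)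
      have "(LINT p|lebesgue. (if p \<in> UNIV \<times> {0..T} then w p else 0) * dird (\<phi> n) (0, 1) p)
        = (LINT t|lebesgue. (if t \<in> {0..T} then U t else 0) * - k n t)"
        unfolding e it Uu ..
      then show ?thesis by simp
    qed
    have "(\<lambda>n. LINT t|lebesgue. (if t \<in> {0..T} then U t else 0) * k n t) \<longlonglongrightarrow> U 0"
      using LIMSEQ_ignore_initial_segment[OF Dirac_sequence[OF H Uc, of 0], of n0] T
      unfolding k_def N_def by simp
    then have L1: "(\<lambda>n. LINT p|lebesgue. (if p \<in> UNIV \<times> {0..T} then w p else 0) * dird (\<phi> n) (0, 1) p) \<longlonglongrightarrow> - U 0"
      unfolding lhs by (rule tendsto_minus)
    have L2: "(\<lambda>n. LINT p|lebesgue. F b p * dird (\<phi> n) (b, 0) p) \<longlonglongrightarrow> 0" if b: "b \<in> Basis" for b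
    proof -
      obtain \<tau> :: "real \<Rightarrow> real" where \<tau>: "\<tau> \<in> test_functions UNIV" "\<And>x. norm x \<le> 1 \<Longrightarrow> \<tau> x = 1"
        using cutoff_exists by metis
      \<comment> \<open>The derivative of \<open>\<xi>\<close> does not decay in time. The factor
        with \<open>\<tau>\<close> is 1 for times in [0, T], so it makes \<open>\<psi>\<close> a
        square integrable test function without altering the product with
        \<open>F b\<close>.\<close>
      define \<psi> where "\<psi> p = dird \<xi> b (fst p) * \<tau> ((1 / T) *\<^sub>R snd p)" for p :: "'a \<times> real"
      have \<psi>: "\<psi> \<in> test_functions (UNIV \<times> UNIV)"
        unfolding \<psi>_def by (rule test_prod(1)[OF test_dird[OF \<xi>] test_scale(1)[OF \<tau>(1)]]) (use T in simp)
      have i: "integrable lebesgue (\<lambda>p. F b p * \<psi> p)"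
        by (rule integrable_mult_L2[OF F(1)[OF b] test_borel_lebesgue[OF \<psi>] F(2)[OF b]])
          (use test_power_integrable[OF \<psi>, of 2] in simp)
      have e: "F b p * dird (\<phi> n) (b, 0) p = F b p * \<psi> p * \<theta> n (snd p)" for n p
      proof (cases "p \<in> UNIV \<times> {0..T}")
        case True
        then have "\<tau> ((1 / T) *\<^sub>R snd p) = 1" using T by (intro \<tau>(2)) (auto simp: mem_Times_iff)
        then show ?thesis by (simp add: \<phi>d \<psi>_def)
      qed (simp add: F(3))
      have "(\<lambda>n. LINT p|lebesgue. F b p * dird (\<phi> n) (b, 0) p) \<longlonglongrightarrow> integral\<^sup>L lebesgue (\<lambda>p::'a \<times> real. 0::real)"
      proof (rule integral_dominated_convergence)
        show "integrable lebesgue (\<lambda>p. \<bar>F b p * \<psi> p\<bar>)" using i by simp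
        show "(\<lambda>p. F b p * dird (\<phi> n) (b, 0) p) \<in> borel_measurable lebesgue" for n
          using F(1)[OF b] test_borel_lebesgue[OF test_dird[OF \<phi>]] by (intro borel_measurable_times) auto
        show "AE p in lebesgue. norm (F b p * dird (\<phi> n) (b, 0) p) \<le> \<bar>F b p * \<psi> p\<bar>" for n
          unfolding e real_norm_def abs_mult[of _ "\<theta> n _"]
          by (intro AE_I2 mult_left_le \<theta>01) simp
        \<comment> \<open>At time 0 every \<open>\<theta> n\<close> equals 1, so pointwise
          convergence to 0 holds only off this null hyperplane.\<close>
        have "AE p in (lborel :: ('a \<times> real) measure). p \<bullet> (0, 1) \<noteq> 0"
          by (rule AE_lborel_inner_neq) (simp add: Basis_prod_def)
        then have "AE p in (lebesgue :: ('a \<times> real) measure). snd p \<noteq> 0"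
          by (auto simp: AE_completion_iff elim!: eventually_mono)
        then show "AE p in lebesgue. (\<lambda>n. F b p * dird (\<phi> n) (b, 0) p) \<longlonglongrightarrow> 0"
        proof eventually_elim
          case (elim p)
          show ?case
          proof (cases "p \<in> UNIV \<times> {0..T}")
            case True
            with elim have sp: "snd p > 0" by (auto simp: mem_Times_iff)
            have "\<forall>\<^sub>F n in sequentially. \<theta> n (snd p) = 0"
              using eventually_ge_at_top[of "nat \<lceil>1 / snd p\<rceil>"]
            proof eventually_elim
              case (elim n)
              then have "1 / snd p \<le> N n" unfolding N_def by linarith
              then have "1 \<le> N n * snd p" using sp by (simp add: divide_le_eq)
              then show ?case using sp HD(3)[of "N n * snd p"] HD(3)[of "snd p + 2"] by (simp add: \<theta>_def)
            qed
            then have "\<forall>\<^sub>F n in sequentially. F b p * dird (\<phi> n) (b, 0) p = 0"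
              by eventually_elim (simp add: e)
            then show ?thesis by (rule tendsto_eventually)
          qed (simp add: F(3))
        qed
      qed simp
      then show ?thesis by simp
    qed
    have "\<phi> n (x, 0) = \<xi> x" for n x
      using HD(2)[of 0] HD(3)[of 2] by (simp add: \<phi>_def \<theta>_def)
    then have E: "(LINT p|lebesgue. (if p \<in> UNIV \<times> {0..T} then w p else 0) * dird (\<phi> n) (0, 1) p) =
        - (LINT x|lebesgue. w0 x * \<xi> x) + (\<Sum>b\<in>Basis. LINT p|lebesgue. F b p * dird (\<phi> n) (b, 0) p)" for n
      using eq[OF \<phi>, of n] by simp
    have "(\<lambda>n. - (LINT x|lebesgue. w0 x * \<xi> x) + (\<Sum>b\<in>Basis. LINT p|lebesgue. F b p * dird (\<phi> n) (b, 0) p))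
        \<longlonglongrightarrow> - (LINT x|lebesgue. w0 x * \<xi> x) + (\<Sum>b\<in>(Basis :: 'a set). 0)"
      by (intro tendsto_add tendsto_const tendsto_sum L2)
    with L1 have "- U 0 = - (LINT x|lebesgue. w0 x * \<xi> x) + (\<Sum>b\<in>(Basis :: 'a set). 0)"
      unfolding E by (rule LIMSEQ_unique)
    then show ?thesis
      using test_integrable_mult[OF \<xi> w0i] test_integrable_mult[OF \<xi> w0]
      by (simp add: U_def left_diff_distrib)
  qed
  then have "AE x in lebesgue. w (x, 0) - w0 x = 0"
    by (intro ae_zero_of_test_integrals) (use w0i w0 in auto)
  then show ?thesis by simp
qed

section \<open>Weak solutions\<close>

text \<open>Extension by 0 keeps all the analysis on \<open>lebesgue\<close> over the whole
  space-time, where mollification and Fubini are stated. Test functions supported in 0 < t < T do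
  not notice the jumps at the two ends.\<close>

abbreviation cyl_ext :: "real \<Rightarrow> ('a::euclidean_space \<times> real \<Rightarrow> real) \<Rightarrow> 'a \<times> real \<Rightarrow> real" where
  "cyl_ext T f \<equiv> (\<lambda>p. if p \<in> UNIV \<times> {0..T} then f p else 0)"

lemma integral_cylinder:
  fixes f :: "'a::euclidean_space \<times> real \<Rightarrow> real"
  shows "integral\<^sup>L (cylinder T) f = (LINT p|lebesgue. cyl_ext T f p)"
  by (rule Lebesgue_Measure.integral_restrict_UNIV[symmetric]) simp

lemma smooth_slice:
  fixes \<phi> :: "'a::euclidean_space \<times> real \<Rightarrow> real"
  assumes "smooth \<phi>"
  shows "smooth (\<lambda>y. \<phi> (y, t))" "dird (\<lambda>y. \<phi> (y, t)) v x = dird \<phi> (v, 0) (x, t)"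
    "deriv (\<lambda>s. \<phi> (x, s)) t = dird \<phi> (0, 1) (x, t)"
proof -
  have b: "bounded_linear (\<lambda>y::'a. (y, 0::real))" "bounded_linear (\<lambda>s::real. (0::'a, s))"
    by (intro bounded_linear_Pair bounded_linear_ident bounded_linear_zero)+
  show "smooth (\<lambda>y. \<phi> (y, t))"
    using smooth_affine[OF b(1) assms, of "(0, t)"] by simp
  show "dird (\<lambda>y. \<phi> (y, t)) v x = dird \<phi> (v, 0) (x, t)"
    using dird_affine[OF assms b(1), of "(0, t)" x v] by simp
  have s: "smooth (\<lambda>s. \<phi> (x, s))"
    using smooth_affine[OF b(2) assms, of "(x, 0)"] by simp
  have "deriv (\<lambda>s. \<phi> (x, s)) t = dird (\<lambda>s. \<phi> (x, s)) 1 t"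
    by (rule DERIV_imp_deriv[OF smooth_real_deriv[OF s]])
  also have "\<dots> = dird \<phi> (0, 1) (x, t)"
    using dird_affine[OF assms b(2), of "(x, 0)" t 1] by simp
  finally show "deriv (\<lambda>s. \<phi> (x, s)) t = dird \<phi> (0, 1) (x, t)" .
qed

lemma test_slice:
  fixes \<phi> :: "'a::euclidean_space \<times> real \<Rightarrow> real"
  assumes "\<phi> \<in> test_functions S"
  shows "(\<lambda>y. \<phi> (y, t)) \<in> test_functions UNIV"
proof -
  obtain K where K: "compact K" "\<And>p. \<phi> p \<noteq> 0 \<Longrightarrow> p \<in> K"
    using assms unfolding test_functions_iff by blast
  have c: "compact (fst ` K)" by (intro compact_continuous_image continuous_intros K)
  show ?thesis
    by (rule test_functionsI[OF smooth_slice(1)[OF test_smooth[OF assms]] c])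
      (use K(2) in \<open>force intro: image_eqI[rotated]\<close>)+
qed

lemma inner_grad:
  fixes \<phi> :: "'a::euclidean_space \<times> real \<Rightarrow> real"
  assumes "smooth \<phi>"
  shows "v \<bullet> grad (\<lambda>y. \<phi> (y, t)) x = (\<Sum>b\<in>Basis. (v \<bullet> b) * dird \<phi> (b, 0) (x, t))"
  by (simp add: grad_def inner_sum_right smooth_slice(2)[OF assms] mult.commute)

lemma grad_inner_Basis:
  fixes \<phi> :: "'a::euclidean_space \<times> real \<Rightarrow> real"
  assumes "smooth \<phi>" "b \<in> Basis"
  shows "grad (\<lambda>y. \<phi> (y, t)) x \<bullet> b = dird \<phi> (b, 0) (x, t)"
proof -
  have "grad (\<lambda>y. \<phi> (y, t)) x \<bullet> b = b \<bullet> grad (\<lambda>y. \<phi> (y, t)) x" by (simp add: inner_commute)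
  also have "\<dots> = (\<Sum>c\<in>Basis. (if b = c then 1 else 0) * dird \<phi> (c, 0) (x, t))"
    unfolding inner_grad[OF assms(1)] by (intro sum.cong) (auto simp: inner_Basis assms(2))
  also have "\<dots> = dird \<phi> (b, 0) (x, t)" using assms(2) by (simp add: if_distrib if_distribR sum.delta cong: if_cong)
  finally show ?thesis .
qed

lemma Lp_2_components:
  fixes F :: "'a::euclidean_space \<times> real \<Rightarrow> 'c::euclidean_space"
  assumes F: "Lp 2 (cylinder T) F" and b: "b \<in> Basis"
  shows "cyl_ext T (\<lambda>p. F p \<bullet> b) \<in> borel_measurable lebesgue"
    "integrable lebesgue (\<lambda>p. (cyl_ext T (\<lambda>p. F p \<bullet> b) p)\<^sup>2)"
proof -
  have Fm: "F \<in> borel_measurable (cylinder T)" and Fi: "integrable (cylinder T) (\<lambda>p. norm (F p) powr 2)"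
    using F by (auto simp: Lp_def)
  have bm: "(\<lambda>p. F p \<bullet> b) \<in> borel_measurable (cylinder T)" using Fm by simp
  show m: "cyl_ext T (\<lambda>p. F p \<bullet> b) \<in> borel_measurable lebesgue"
    by (rule measurable_extend[OF sets_lebesgue_cylinder bm])
  have "integrable lebesgue (\<lambda>p. if p \<in> UNIV \<times> {0..T} then norm (F p) powr 2 else 0)"
    by (subst Lebesgue_Measure.integrable_restrict_UNIV) (use Fi in simp_all)
  then show "integrable lebesgue (\<lambda>p. (cyl_ext T (\<lambda>p. F p \<bullet> b) p)\<^sup>2)"
  proof (rule Bochner_Integration.integrable_bound)
    show "(\<lambda>p. (cyl_ext T (\<lambda>p. F p \<bullet> b) p)\<^sup>2) \<in> borel_measurable lebesgue" using m by measurable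
    have "(F p \<bullet> b)\<^sup>2 \<le> norm (F p) powr 2" for p
      using power_mono[OF Basis_le_norm[OF b, of "F p"], of 2] by (simp add: power2_abs)
    then show "AE p in lebesgue. norm ((cyl_ext T (\<lambda>p. F p \<bullet> b) p)\<^sup>2)
        \<le> norm (if p \<in> UNIV \<times> {0..T} then norm (F p) powr 2 else 0)"
      by (intro AE_I2) simp
  qed
qed

lemma integrable_L2_mult_test:
  fixes f :: "'a::euclidean_space \<Rightarrow> real"
  assumes "f \<in> borel_measurable lebesgue" "integrable lebesgue (\<lambda>p. (f p)\<^sup>2)" "\<phi> \<in> test_functions S"
  shows "integrable lebesgue (\<lambda>p. f p * \<phi> p)"
  by (rule integrable_mult_L2[OF assms(1) test_borel_lebesgue[OF assms(3)] assms(2)])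
    (use test_power_integrable[OF assms(3), of 2] in simp)

text \<open>Slices of a space-time test function are spatial test functions, so the slicewise
  identity holds for almost every \<open>t\<close>; Fubini reassembles it. Both products are
  integrable: a bounded factor against an integrable one on the left, two square integrable factors
  on the right.\<close>

lemma weak_gradient_spacetime:
  fixes f :: "'a::euclidean_space \<times> real \<Rightarrow> real"
  assumes f: "integrable lebesgue (cyl_ext T f)" and G: "L2_Hdot1 T f G"
    and b: "b \<in> Basis" and \<psi>: "\<psi> \<in> test_functions S"
  shows "(LINT p|lebesgue. cyl_ext T f p * dird \<psi> (b, 0) p)
    = - (LINT p|lebesgue. cyl_ext T (\<lambda>p. G p \<bullet> b) p * \<psi> p)"
proof -
  have L: "Lp 2 (cylinder T) G" using G by (simp add: L2_Hdot1_def)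
  have "AE t in lebesgue_on {0..T}. has_weak_gradient (\<lambda>x. f (x, t)) (\<lambda>x. G (x, t))"
    using G by (simp add: L2_Hdot1_def)
  then have ae: "AE t in lebesgue. t \<in> {0..T} \<longrightarrow> has_weak_gradient (\<lambda>x. f (x, t)) (\<lambda>x. G (x, t))"
    by (subst (asm) AE_restrict_space_iff) auto
  have i1: "integrable lebesgue (\<lambda>p. cyl_ext T f p * dird \<psi> (b, 0) p)"
    by (rule test_integrable_mult[OF test_dird[OF \<psi>] f])
  have i2: "integrable lebesgue (\<lambda>p. cyl_ext T (\<lambda>p. G p \<bullet> b) p * \<psi> p)"
    by (rule integrable_L2_mult_test[OF Lp_2_components[OF L b] \<psi>])
  note F1 = lebesgue_Fubini[OF i1] and F2 = lebesgue_Fubini[OF i2]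
  have "(LINT t|lebesgue. LINT x|lebesgue. cyl_ext T f (x, t) * dird \<psi> (b, 0) (x, t))
      = (LINT t|lebesgue. - (LINT x|lebesgue. cyl_ext T (\<lambda>p. G p \<bullet> b) (x, t) * \<psi> (x, t)))"
  proof (rule integral_cong_AE)
    show "(\<lambda>t. LINT x|lebesgue. cyl_ext T f (x, t) * dird \<psi> (b, 0) (x, t)) \<in> borel_measurable lebesgue"
      using F1(2) by auto
    show "(\<lambda>t. - (LINT x|lebesgue. cyl_ext T (\<lambda>p. G p \<bullet> b) (x, t) * \<psi> (x, t))) \<in> borel_measurable lebesgue"
      using F2(2) by auto
    show "AE t in lebesgue. (LINT x|lebesgue. cyl_ext T f (x, t) * dird \<psi> (b, 0) (x, t))
        = - (LINT x|lebesgue. cyl_ext T (\<lambda>p. G p \<bullet> b) (x, t) * \<psi> (x, t))"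
      using ae
    proof eventually_elim
      case (elim t)
      show ?case
      proof (cases "t \<in> {0..T}")
        case True
        then have "(LINT x|lebesgue. f (x, t) * (grad (\<lambda>y. \<psi> (y, t)) x \<bullet> b)) = - (LINT x|lebesgue. (G (x, t) \<bullet> b) * \<psi> (x, t))"
          using elim test_slice[OF \<psi>, of t] b unfolding has_weak_gradient_def by blast
        with True show ?thesis by (simp add: grad_inner_Basis[OF test_smooth[OF \<psi>] b])
      qed auto
    qed
  qed
  then show ?thesis unfolding F1(3) F2(3) by simp
qed

text \<open>One factor \<open>x\<close> is kept linear, so that \<open>u powr m\<close> inherits
  integrability on the cylinder from a bounded integrable \<open>u\<close>.\<close>

lemma powr_le_mult_powr:
  fixes x M m :: real
  assumes "0 \<le> x" "x \<le> M" "1 < m"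
  shows "x powr m \<le> M powr (m - 1) * x"
proof (cases "x = 0")
  case False
  then have "x powr m = x powr (m - 1) * x" using assms by (simp add: powr_diff)
  also have "\<dots> \<le> M powr (m - 1) * x" using assms by (intro mult_right_mono powr_mono2) auto
  finally show ?thesis .
qed simp

text \<open>Unpacks a solution into the form used by the abstract lemmas: zero extensions instead of
  cylinder integrals, and a flux split into coordinates, each summand being square
  integrable.\<close>

lemma weak_solutionE:
  fixes u :: "'a::euclidean_space \<times> real \<Rightarrow> real"
  assumes "weak_solution V m T u0 u" and m: "1 < m"
  obtains M G where "0 \<le> M" "AE p in lebesgue. p \<in> UNIV \<times> {0..T} \<longrightarrow> 0 \<le> u p \<and> u p \<le> M"
    "C_L1 T u" "u \<in> borel_measurable (cylinder T)" "integrable lebesgue u0"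
    "Lp 2 (cylinder T) (\<lambda>p. u p *\<^sub>R V (fst p))" "Lp 2 (cylinder T) G"
    "integrable lebesgue (cyl_ext T u)" "integrable lebesgue (cyl_ext T (\<lambda>p. u p powr m))"
    "\<forall>b\<in>Basis. \<forall>\<psi>\<in>test_functions (UNIV \<times> {0<..<T}).
      (LINT p|lebesgue. cyl_ext T (\<lambda>p. u p powr m) p * dird \<psi> (b, 0) p)
        = - (LINT p|lebesgue. cyl_ext T (\<lambda>p. G p \<bullet> b) p * \<psi> p)"
    "\<forall>\<phi>\<in>test_functions (UNIV \<times> {..<T}).
      (LINT p|lebesgue. cyl_ext T u p * dird \<phi> (0, 1) p) = - (LINT x|lebesgue. u0 x * \<phi> (x, 0)) +
        (\<Sum>b\<in>Basis. LINT p|lebesgue. (cyl_ext T (\<lambda>p. G p \<bullet> b) p +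
           cyl_ext T (\<lambda>p. (u p *\<^sub>R V (fst p)) \<bullet> b) p) * dird \<phi> (b, 0) p)"
proof -
  let ?S = "UNIV \<times> {0..T} :: ('a \<times> real) set"
  have u0: "integrable lebesgue u0" and nn: "AE z in cylinder T. 0 \<le> u z" and C: "C_L1 T u"
    and Li: "Linfty (cylinder T) u" and uV: "Lp 2 (cylinder T) (\<lambda>p. u p *\<^sub>R V (fst p))"
    using assms by (auto simp: weak_solution_def Lp_1_iff case_prod_beta')
  obtain G where G: "L2_Hdot1 T (\<lambda>z. u z powr m) G"
    and eq: "\<And>\<phi>. \<phi> \<in> test_functions (UNIV \<times> {..<T}) \<Longrightarrow>
           integral\<^sup>L (cylinder T) (\<lambda>(x, t). u (x, t) * deriv (\<lambda>s. \<phi> (x, s)) t) =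
             - (LINT x|lebesgue. u0 x * \<phi> (x, 0))
             + integral\<^sup>L (cylinder T)
                 (\<lambda>(x, t). (G (x, t) + u (x, t) *\<^sub>R V x) \<bullet> grad (\<lambda>y. \<phi> (y, t)) x)"
    using assms unfolding weak_solution_def by blast
  have GL: "Lp 2 (cylinder T) G" using G by (simp add: L2_Hdot1_def)
  have um: "u \<in> borel_measurable (cylinder T)" using Li by (simp add: Linfty_def)
  obtain M0 where M0: "AE z in cylinder T. norm (u z) \<le> M0" using Li by (auto simp: Linfty_def)
  \<comment> \<open>The essential bound need not be nonnegative when the cylinder is a null
    set.\<close>
  define M where "M = max M0 0"
  have "AE z in cylinder T. 0 \<le> u z \<and> u z \<le> M"
    using nn M0 by eventually_elim (auto simp: M_def)
  then have bd: "AE p in lebesgue. p \<in> ?S \<longrightarrow> 0 \<le> u p \<and> u p \<le> M"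
    by (subst (asm) AE_restrict_space_iff) auto
  have ui: "integrable lebesgue (cyl_ext T u)" by (rule C_L1_integrable_cylinder[OF C um])
  have umi: "integrable lebesgue (cyl_ext T (\<lambda>p. u p powr m))"
  proof (rule Bochner_Integration.integrable_bound)
    show "integrable lebesgue (\<lambda>p. M powr (m - 1) * cyl_ext T u p)" using ui by simp
    have "(\<lambda>p. u p powr m) \<in> borel_measurable (cylinder T)" using um by measurable
    then show "cyl_ext T (\<lambda>p. u p powr m) \<in> borel_measurable lebesgue"
      by (rule measurable_extend[OF sets_lebesgue_cylinder])
    show "AE p in lebesgue. norm (cyl_ext T (\<lambda>p. u p powr m) p) \<le> norm (M powr (m - 1) * cyl_ext T u p)"
      using bd
    proof eventually_elim
      case (elim p)
      show ?case
      proof (cases "p \<in> ?S")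
        case True
        then have "0 \<le> u p" "u p \<le> M" using elim by auto
        with powr_le_mult_powr[OF this m] True show ?thesis by (simp add: abs_mult)
      qed simp
    qed
  qed
  have eq': "(LINT p|lebesgue. cyl_ext T u p * dird \<phi> (0, 1) p) = - (LINT x|lebesgue. u0 x * \<phi> (x, 0)) +
        (\<Sum>b\<in>Basis. LINT p|lebesgue. (cyl_ext T (\<lambda>p. G p \<bullet> b) p +
           cyl_ext T (\<lambda>p. (u p *\<^sub>R V (fst p)) \<bullet> b) p) * dird \<phi> (b, 0) p)"
    if \<phi>: "\<phi> \<in> test_functions (UNIV \<times> {..<T})" for \<phi>
  proof -
    note s = smooth_slice[OF test_smooth[OF \<phi>]]
    have "integral\<^sup>L (cylinder T) (\<lambda>(x, t). u (x, t) * deriv (\<lambda>s. \<phi> (x, s)) t)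
        = (LINT p|cylinder T. u p * dird \<phi> (0, 1) p)"
      by (rule Bochner_Integration.integral_cong) (auto simp: s(3))
    also have "\<dots> = (LINT p|lebesgue. cyl_ext T u p * dird \<phi> (0, 1) p)"
      unfolding integral_cylinder by (rule Bochner_Integration.integral_cong) auto
    finally have 1: "integral\<^sup>L (cylinder T) (\<lambda>(x, t). u (x, t) * deriv (\<lambda>s. \<phi> (x, s)) t)
        = (LINT p|lebesgue. cyl_ext T u p * dird \<phi> (0, 1) p)" .
    have "integral\<^sup>L (cylinder T) (\<lambda>(x, t). (G (x, t) + u (x, t) *\<^sub>R V x) \<bullet> grad (\<lambda>y. \<phi> (y, t)) x)
        = (LINT p|cylinder T. (\<Sum>b\<in>Basis. ((G p + u p *\<^sub>R V (fst p)) \<bullet> b) * dird \<phi> (b, 0) p))"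
      by (rule Bochner_Integration.integral_cong) (auto simp: inner_grad[OF test_smooth[OF \<phi>]])
    also have "\<dots> = (LINT p|lebesgue. (\<Sum>b\<in>Basis. (cyl_ext T (\<lambda>p. G p \<bullet> b) p +
           cyl_ext T (\<lambda>p. (u p *\<^sub>R V (fst p)) \<bullet> b) p) * dird \<phi> (b, 0) p))"
      unfolding integral_cylinder
      by (rule Bochner_Integration.integral_cong) (auto simp: inner_add_left)
    also have "\<dots> = (\<Sum>b\<in>Basis. LINT p|lebesgue. (cyl_ext T (\<lambda>p. G p \<bullet> b) p +
           cyl_ext T (\<lambda>p. (u p *\<^sub>R V (fst p)) \<bullet> b) p) * dird \<phi> (b, 0) p)"
    proof (rule Bochner_Integration.integral_sum)
      fix b :: 'a assume b: "b \<in> Basis"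
      have "integrable lebesgue (\<lambda>p. cyl_ext T (\<lambda>p. G p \<bullet> b) p * dird \<phi> (b, 0) p +
           cyl_ext T (\<lambda>p. (u p *\<^sub>R V (fst p)) \<bullet> b) p * dird \<phi> (b, 0) p)"
        by (intro Bochner_Integration.integrable_add integrable_L2_mult_test[OF Lp_2_components[OF _ b] test_dird[OF \<phi>]] GL uV)
      then show "integrable lebesgue (\<lambda>p. (cyl_ext T (\<lambda>p. G p \<bullet> b) p +
           cyl_ext T (\<lambda>p. (u p *\<^sub>R V (fst p)) \<bullet> b) p) * dird \<phi> (b, 0) p)"
        by (simp only: distrib_right)
    qed
    finally show ?thesis using eq[OF \<phi>] unfolding 1 by simp
  qed
  show thesis
    by (rule that[of M G, OF _ bd C um u0 uV GL ui umi])
      (use weak_gradient_spacetime[OF umi G] eq' in \<open>auto simp: M_def\<close>)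
qed

section \<open>Pointwise inequalities behind the exponent condition\<close>

text \<open>After division by \<open>a powr m\<close> the two fractions add up to 1 and lie in
  [0, 1], where s^m <= s. This is how a difference of solutions is bounded by the m-th root of the
  difference of the powers.\<close>

lemma powr_diff_superadditive:
  fixes a b m :: real
  assumes "0 \<le> b" "b \<le> a" "1 \<le> m"
  shows "(a - b) powr m \<le> a powr m - b powr m"
proof (cases "a = 0")
  case True
  then show ?thesis using assms by simp
next
  case False
  then have a: "a > 0" using assms by simp
  have le: "s powr m \<le> s" if "0 \<le> s" "s \<le> 1" for s :: real
    using powr_mono'[of 1 m s] that assms by (cases "s = 0") auto
  have "((a - b) / a) powr m + (b / a) powr m \<le> (a - b) / a + b / a"
    using assms a by (intro add_mono le) auto
  also have "\<dots> = 1" using a by (simp add: add_divide_distrib[symmetric])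
  finally have "((a - b) powr m + b powr m) / a powr m \<le> 1"
    using assms a by (simp add: powr_divide add_divide_distrib)
  then show ?thesis using a by (simp add: divide_le_eq)
qed

text \<open>After removing the factor \<open>w powr (1 + 2 / p)\<close> it is Young's inequality
  with exponents p/2 and p/(p - 2). Distinguishing whether \<open>w\<close> or
  \<open>v powr p\<close> is larger gives constant 1 and includes p = 2.\<close>

lemma weighted_square_le:
  fixes v w p :: real
  assumes "0 \<le> v" "0 < w" "2 \<le> p"
  shows "w\<^sup>2 * v\<^sup>2 \<le> w powr (1 + 2 / p) * (v powr p + w)"
proof -
  have "v\<^sup>2 * w powr (1 - 2 / p) \<le> v powr p + w"
  proof (cases "w \<le> v powr p")
    case True
    have v: "v > 0" using True assms by (cases "v = 0") auto
    have "w powr (1 - 2 / p) \<le> (v powr p) powr (1 - 2 / p)"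
      using True assms by (intro powr_mono2) auto
    also have "\<dots> = v powr (p - 2)" using assms by (simp add: powr_powr right_diff_distrib)
    finally have "v\<^sup>2 * w powr (1 - 2 / p) \<le> v\<^sup>2 * v powr (p - 2)" by (intro mult_left_mono) auto
    also have "\<dots> = v powr p" using v by (simp add: powr_diff)
    finally show ?thesis using assms by simp
  next
    case False
    have "v\<^sup>2 = (v powr p) powr (2 / p)" using assms by (cases "v = 0") (auto simp: powr_powr)
    also have "\<dots> \<le> w powr (2 / p)" using False assms by (intro powr_mono2) auto
    finally have "v\<^sup>2 * w powr (1 - 2 / p) \<le> w powr (2 / p) * w powr (1 - 2 / p)" by (intro mult_right_mono) auto
    also have "\<dots> = w" using assms by (simp flip: powr_add)
    finally show ?thesis by (simp add: add_increasing)
  qed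
  then have "w powr (1 + 2 / p) * (v\<^sup>2 * w powr (1 - 2 / p)) \<le> w powr (1 + 2 / p) * (v powr p + w)"
    by (intro mult_left_mono) auto
  moreover have "w powr (1 + 2 / p) * w powr (1 - 2 / p) = w\<^sup>2"
    using assms by (simp flip: powr_add)
  then have "w powr (1 + 2 / p) * (v\<^sup>2 * w powr (1 - 2 / p)) = w\<^sup>2 * v\<^sup>2"
    by (simp add: mult.left_commute mult.commute)
  ultimately show ?thesis by simp
qed

text \<open>Completing the square in the gradient; the exponent on the right exceeds \<open>1\<close> exactly
  when \<open>m < 1 + 2/p\<close>.\<close>

lemma drift_term_bound:
  fixes G V :: "'a::euclidean_space" and a b m p :: real
  assumes ab: "0 \<le> b" "0 \<le> a" and z: "a powr m - b powr m > 0" and m: "1 < m" and p: "2 \<le> p"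
  shows "- (\<Sum>i\<in>Basis. (G \<bullet> i + (a - b) * (V \<bullet> i)) * (G \<bullet> i))
    \<le> (a powr m - b powr m) powr ((1 + 2 / p) / m) * (norm V powr p + (a - b))"
proof -
  define w where "w = a - b"
  have w: "w > 0"
  proof (rule ccontr)
    assume "\<not> w > 0"
    then have "a powr m \<le> b powr m" using ab m by (intro powr_mono2) (auto simp: w_def)
    with z show False by simp
  qed
  have "- ((G \<bullet> i + w * (V \<bullet> i)) * (G \<bullet> i)) \<le> w\<^sup>2 * (V \<bullet> i)\<^sup>2" for i
  proof -
    \<comment> \<open>The square alone would give the constant 1/4; adding the 3/4 rounds it up to
      1.\<close>
    have "0 \<le> (G \<bullet> i + w * (V \<bullet> i) / 2)\<^sup>2 + 3 / 4 * (w * (V \<bullet> i))\<^sup>2" by simp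
    then show ?thesis by (simp add: power2_eq_square algebra_simps)
  qed
  then have "(\<Sum>i\<in>Basis. - ((G \<bullet> i + w * (V \<bullet> i)) * (G \<bullet> i))) \<le> (\<Sum>i\<in>Basis. w\<^sup>2 * (V \<bullet> i)\<^sup>2)"
    by (intro sum_mono)
  also have "\<dots> = w\<^sup>2 * (norm V)\<^sup>2"
    unfolding power2_norm_eq_inner euclidean_inner[of V V] by (simp add: sum_distrib_left power2_eq_square)
  also have "\<dots> \<le> w powr (1 + 2 / p) * (norm V powr p + w)"
    by (rule weighted_square_le) (use w p in auto)
  also have "\<dots> \<le> (a powr m - b powr m) powr ((1 + 2 / p) / m) * (norm V powr p + w)"
  proof (rule mult_right_mono)
    \<comment> \<open>Superadditivity bounds \<open>w powr m\<close> by the difference of the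
      powers; taking the m-th root introduces the division by \<open>m\<close> in the
      exponent.\<close>
    have "w = (w powr m) powr (1 / m)" using w m by (simp add: powr_powr)
    also have "\<dots> \<le> (a powr m - b powr m) powr (1 / m)"
      using powr_diff_superadditive[of b a m] ab w m by (intro powr_mono2) (auto simp: w_def)
    finally have "w powr (1 + 2 / p) \<le> ((a powr m - b powr m) powr (1 / m)) powr (1 + 2 / p)"
      using w p by (intro powr_mono2) auto
    then show "w powr (1 + 2 / p) \<le> (a powr m - b powr m) powr ((1 + 2 / p) / m)"
      by (simp add: powr_powr)
  qed (use w in simp)
  finally show ?thesis by (simp add: w_def sum_negf)
qed

text \<open>The time interval has finite length, so a time-independent integrable function stays
  integrable on the cylinder; needed for the p-th power of \<open>norm V\<close>.\<close>

lemma integrable_fst_cylinder: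
  fixes f :: "'a::euclidean_space \<Rightarrow> real"
  assumes "integrable lebesgue f"
  shows "integrable lebesgue (cyl_ext T (\<lambda>p. f (fst p)))"
proof (rule integrable_lebesgue_prodI[where S="{0..T}" and C="LINT x|lebesgue. \<bar>f x\<bar>"])
  have "(\<lambda>p::'a \<times> real. f (fst p)) \<in> borel_measurable lebesgue"
    by (rule borel_measurable_lebesgue_fst) (use assms in auto)
  then have "(\<lambda>p::'a \<times> real. f (fst p)) \<in> borel_measurable (cylinder T)"
    by (rule measurable_restrict_space1)
  then show "cyl_ext T (\<lambda>p::'a \<times> real. f (fst p)) \<in> borel_measurable lebesgue"
    by (rule measurable_extend[OF sets_lebesgue_cylinder])
qed (use assms in auto)

lemma L2_diff:
  fixes f g :: "'b \<Rightarrow> real"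
  assumes "f \<in> borel_measurable M" "g \<in> borel_measurable M"
    "integrable M (\<lambda>x. (f x)\<^sup>2)" "integrable M (\<lambda>x. (g x)\<^sup>2)"
  shows "integrable M (\<lambda>x. (f x - g x)\<^sup>2)"
  using Lq_diff_integrable(1)[of 2 f M g] assms by simp

theorem theorem3p5:
  fixes V :: "real ^ 'd \<Rightarrow> real ^ 'd"
    and u1 u2 :: "(real ^ 'd) \<times> real \<Rightarrow> real"
    and u10 u20 :: "real ^ 'd \<Rightarrow> real"
    and p m T :: real
  assumes "0 < T"
    and "2 \<le> p" and "Lp p lebesgue V"
    and "1 < m" and "m < 1 + 2 / p"
    and "weak_solution V m T u10 u1"
    and "weak_solution V m T u20 u2"
    and "time_derivative_L1 T (\<lambda>z. u1 z - u2 z)"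
  shows "\<forall>t\<in>{0..T}.
           (LINT x|lebesgue. max (u1 (x, t) - u2 (x, t)) 0)
             \<le> (LINT x|lebesgue. max (u10 x - u20 x) 0)"
proof -
  let ?S = "UNIV \<times> {0..T} :: ((real ^ 'd) \<times> real) set"
  note T = assms(1) and p = assms(2) and VL = assms(3) and m = assms(4,5)
  obtain M1 G1 where u1: "0 \<le> M1"
    "AE p in lebesgue. p \<in> ?S \<longrightarrow> 0 \<le> u1 p \<and> u1 p \<le> M1"
    "C_L1 T u1" "u1 \<in> borel_measurable (cylinder T)" "integrable lebesgue u10"
    "Lp 2 (cylinder T) (\<lambda>p. u1 p *\<^sub>R V (fst p))" "Lp 2 (cylinder T) G1"
    "integrable lebesgue (cyl_ext T u1)" "integrable lebesgue (cyl_ext T (\<lambda>p. u1 p powr m))"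
    and g1: "\<forall>b\<in>Basis. \<forall>\<psi>\<in>test_functions (UNIV \<times> {0<..<T}).
      (LINT p|lebesgue. cyl_ext T (\<lambda>p. u1 p powr m) p * dird \<psi> (b, 0) p)
        = - (LINT p|lebesgue. cyl_ext T (\<lambda>p. G1 p \<bullet> b) p * \<psi> p)"
    and e1: "\<forall>\<phi>\<in>test_functions (UNIV \<times> {..<T}).
      (LINT p|lebesgue. cyl_ext T u1 p * dird \<phi> (0, 1) p) = - (LINT x|lebesgue. u10 x * \<phi> (x, 0)) +
        (\<Sum>b\<in>Basis. LINT p|lebesgue. (cyl_ext T (\<lambda>p. G1 p \<bullet> b) p +
           cyl_ext T (\<lambda>p. (u1 p *\<^sub>R V (fst p)) \<bullet> b) p) * dird \<phi> (b, 0) p)"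
    by (rule weak_solutionE[OF assms(6) m(1)])
  obtain M2 G2 where u2: "0 \<le> M2"
    "AE p in lebesgue. p \<in> ?S \<longrightarrow> 0 \<le> u2 p \<and> u2 p \<le> M2"
    "C_L1 T u2" "u2 \<in> borel_measurable (cylinder T)" "integrable lebesgue u20"
    "Lp 2 (cylinder T) (\<lambda>p. u2 p *\<^sub>R V (fst p))" "Lp 2 (cylinder T) G2"
    "integrable lebesgue (cyl_ext T u2)" "integrable lebesgue (cyl_ext T (\<lambda>p. u2 p powr m))"
    and g2: "\<forall>b\<in>Basis. \<forall>\<psi>\<in>test_functions (UNIV \<times> {0<..<T}).
      (LINT p|lebesgue. cyl_ext T (\<lambda>p. u2 p powr m) p * dird \<psi> (b, 0) p)
        = - (LINT p|lebesgue. cyl_ext T (\<lambda>p. G2 p \<bullet> b) p * \<psi> p)"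
    and e2: "\<forall>\<phi>\<in>test_functions (UNIV \<times> {..<T}).
      (LINT p|lebesgue. cyl_ext T u2 p * dird \<phi> (0, 1) p) = - (LINT x|lebesgue. u20 x * \<phi> (x, 0)) +
        (\<Sum>b\<in>Basis. LINT p|lebesgue. (cyl_ext T (\<lambda>p. G2 p \<bullet> b) p +
           cyl_ext T (\<lambda>p. (u2 p *\<^sub>R V (fst p)) \<bullet> b) p) * dird \<phi> (b, 0) p)"
    by (rule weak_solutionE[OF assms(7) m(1)])
  obtain h where h: "Lp 1 (cylinder T) h"
    "\<And>\<phi>. \<phi> \<in> test_functions (UNIV \<times> {0<..<T}) \<Longrightarrow>
           integral\<^sup>L (cylinder T) (\<lambda>(x, t). (u1 (x, t) - u2 (x, t)) * deriv (\<lambda>s. \<phi> (x, s)) t) =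
             - integral\<^sup>L (cylinder T) (\<lambda>z. h z * \<phi> z)"
    using assms(8) unfolding time_derivative_L1_def by blast
  define w where "w = cyl_ext T (\<lambda>p. u1 p - u2 p)"
  define z where "z = cyl_ext T (\<lambda>p. u1 p powr m - u2 p powr m)"
  define g where "g = cyl_ext T h"
  define G where "G b q = cyl_ext T (\<lambda>p. G1 p \<bullet> b) q - cyl_ext T (\<lambda>p. G2 p \<bullet> b) q" for b q
  define D where "D b q = cyl_ext T (\<lambda>p. (u1 p *\<^sub>R V (fst p)) \<bullet> b) q - cyl_ext T (\<lambda>p. (u2 p *\<^sub>R V (fst p)) \<bullet> b) q" for b q
  define F where "F b q = G b q + D b q" for b q
  \<comment> \<open>The weight left over by \<open>drift_term_bound\<close>. The absolute value
    keeps it nonnegative where \<open>w\<close> is negative. Points are called \<open>q\<close>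
    because \<open>p\<close> is the exponent.\<close>
  define Q where "Q q = cyl_ext T (\<lambda>q. norm (V (fst q)) powr p) q + \<bar>w q\<bar>" for q
  \<comment> \<open>Chosen so that \<open>1 + \<alpha>\<close> is the exponent in
    \<open>drift_term_bound\<close>; positivity is exactly the condition m < 1 + 2/p.\<close>
  define \<alpha> where "\<alpha> = (1 + 2 / p) / m - 1"
  \<comment> \<open>A common bound for \<open>w\<close> and \<open>z\<close>, as
    \<open>weak_contraction\<close> takes a single constant for both.\<close>
  define M where "M = M1 + M2 + M1 powr m + M2 powr m"
  have w_eq: "w q = cyl_ext T u1 q - cyl_ext T u2 q" for q by (simp add: w_def)
  have z_eq: "z q = cyl_ext T (\<lambda>p. u1 p powr m) q - cyl_ext T (\<lambda>p. u2 p powr m) q" for q by (simp add: z_def)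
  have wi: "integrable lebesgue w" unfolding w_eq[abs_def] by (intro Bochner_Integration.integrable_diff u1 u2)
  have zi: "integrable lebesgue z" unfolding z_eq[abs_def] by (intro Bochner_Integration.integrable_diff u1 u2)
  have Gc: "G b q = cyl_ext T (\<lambda>p. (G1 p - G2 p) \<bullet> b) q" for b q by (simp add: G_def inner_diff_left)
  have Dc: "D b q = cyl_ext T (\<lambda>p. (u1 p - u2 p) * (V (fst p) \<bullet> b)) q" for b q
    by (simp add: D_def left_diff_distrib)
  have Gm: "G b \<in> borel_measurable lebesgue" and G2i: "integrable lebesgue (\<lambda>q. (G b q)\<^sup>2)"
    if b: "b \<in> Basis" for b
    unfolding G_def[abs_def]
    by (intro borel_measurable_diff L2_diff Lp_2_components[OF _ b] u1 u2)+
  have Dm: "D b \<in> borel_measurable lebesgue" and D2i: "integrable lebesgue (\<lambda>q. (D b q)\<^sup>2)"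
    if b: "b \<in> Basis" for b
    unfolding D_def[abs_def]
    by (intro borel_measurable_diff L2_diff Lp_2_components[OF _ b] u1 u2)+
  have Fm: "F b \<in> borel_measurable lebesgue" and F2i: "integrable lebesgue (\<lambda>q. (F b q)\<^sup>2)"
    if b: "b \<in> Basis" for b
  proof -
    show "F b \<in> borel_measurable lebesgue" unfolding F_def[abs_def] using Gm[OF b] Dm[OF b] by simp
    have "integrable lebesgue (\<lambda>q. (G b q - - D b q)\<^sup>2)"
      by (rule L2_diff) (use Gm[OF b] Dm[OF b] G2i[OF b] D2i[OF b] in auto)
    then show "integrable lebesgue (\<lambda>q. (F b q)\<^sup>2)" by (simp add: F_def)
  qed
  have E: "(LINT q|lebesgue. w q * dird \<phi> (0, 1) q) =
      - (LINT x|lebesgue. (u10 x - u20 x) * \<phi> (x, 0)) + (\<Sum>b\<in>Basis. LINT q|lebesgue. F b q * dird \<phi> (b, 0) q)"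
    if \<phi>: "\<phi> \<in> test_functions (UNIV \<times> {..<T})" for \<phi>
  proof -
    note i = test_integrable_mult[OF test_dird[OF \<phi>]] test_integrable_mult[OF test_slice[OF \<phi>]]
    have 1: "(LINT q|lebesgue. w q * dird \<phi> (0, 1) q) =
        (LINT q|lebesgue. cyl_ext T u1 q * dird \<phi> (0, 1) q) - (LINT q|lebesgue. cyl_ext T u2 q * dird \<phi> (0, 1) q)"
      unfolding w_eq left_diff_distrib by (intro Bochner_Integration.integral_diff i u1 u2)
    have 2: "(LINT x|lebesgue. (u10 x - u20 x) * \<phi> (x, 0)) =
        (LINT x|lebesgue. u10 x * \<phi> (x, 0)) - (LINT x|lebesgue. u20 x * \<phi> (x, 0))"
      unfolding left_diff_distrib by (intro Bochner_Integration.integral_diff i u1 u2)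
    have 3: "(LINT q|lebesgue. F b q * dird \<phi> (b, 0) q) =
        (LINT p|lebesgue. (cyl_ext T (\<lambda>p. G1 p \<bullet> b) p + cyl_ext T (\<lambda>p. (u1 p *\<^sub>R V (fst p)) \<bullet> b) p) * dird \<phi> (b, 0) p)
        - (LINT p|lebesgue. (cyl_ext T (\<lambda>p. G2 p \<bullet> b) p + cyl_ext T (\<lambda>p. (u2 p *\<^sub>R V (fst p)) \<bullet> b) p) * dird \<phi> (b, 0) p)"
      if b: "b \<in> Basis" for b
    proof -
      note j = integrable_L2_mult_test[OF Lp_2_components[OF _ b] test_dird[OF \<phi>]]
      have "F b q * dird \<phi> (b, 0) q =
          (cyl_ext T (\<lambda>p. G1 p \<bullet> b) q + cyl_ext T (\<lambda>p. (u1 p *\<^sub>R V (fst p)) \<bullet> b) q) * dird \<phi> (b, 0) q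
        - (cyl_ext T (\<lambda>p. G2 p \<bullet> b) q + cyl_ext T (\<lambda>p. (u2 p *\<^sub>R V (fst p)) \<bullet> b) q) * dird \<phi> (b, 0) q" for q
        unfolding F_def G_def D_def by (simp only: algebra_simps)
      then show ?thesis
        unfolding distrib_right
        by (simp only:, intro Bochner_Integration.integral_diff Bochner_Integration.integrable_add j u1 u2)
    qed
    show ?thesis unfolding 1 2 e1[rule_format, OF \<phi>] e2[rule_format, OF \<phi>] by (simp add: 3 sum_subtractf)
  qed
  have wt: "(LINT q|lebesgue. w q * dird \<psi> (0, 1) q) = - (LINT q|lebesgue. g q * \<psi> q)"
    if \<psi>: "\<psi> \<in> test_functions (UNIV \<times> {0<..<T})" for \<psi>
  proof -
    have "(LINT q|lebesgue. w q * dird \<psi> (0, 1) q)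
        = integral\<^sup>L (cylinder T) (\<lambda>(x, t). (u1 (x, t) - u2 (x, t)) * deriv (\<lambda>s. \<psi> (x, s)) t)"
      unfolding integral_cylinder
      by (rule Bochner_Integration.integral_cong) (auto simp: w_def smooth_slice(3)[OF test_smooth[OF \<psi>]])
    also have "\<dots> = - (LINT q|lebesgue. g q * \<psi> q)"
      unfolding h(2)[OF \<psi>] unfolding integral_cylinder
      by (intro arg_cong[where f=uminus] Bochner_Integration.integral_cong) (auto simp: g_def)
    finally show ?thesis .
  qed
  have gF: "(LINT q|lebesgue. g q * \<psi> q) = - (\<Sum>b\<in>Basis. LINT q|lebesgue. F b q * dird \<psi> (b, 0) q)"
    if \<psi>: "\<psi> \<in> test_functions (UNIV \<times> {0<..<T})" for \<psi>
  proof -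
    \<comment> \<open>The support lies in 0 < t < T, so the initial term of \<open>E\<close> drops
      out. Comparing with \<open>wt\<close> then leaves an equation between \<open>g\<close> and the
      spatial flux.\<close>
    have "\<psi> (x, 0) = 0" for x using \<psi> unfolding test_functions_iff by force
    then show ?thesis
      using E[OF test_functions_mono[OF \<psi>]] wt[OF \<psi>] by (force simp del: mult_eq_0_iff)
  qed
  have zx: "(LINT q|lebesgue. z q * dird \<psi> (b, 0) q) = - (LINT q|lebesgue. G b q * \<psi> q)"
    if b: "b \<in> Basis" and \<psi>: "\<psi> \<in> test_functions (UNIV \<times> {0<..<T})" for b \<psi>
  proof -
    note j = integrable_L2_mult_test[OF Lp_2_components[OF _ b] \<psi>]
    have "(LINT q|lebesgue. z q * dird \<psi> (b, 0) q) =
        (LINT q|lebesgue. cyl_ext T (\<lambda>p. u1 p powr m) q * dird \<psi> (b, 0) q)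
        - (LINT q|lebesgue. cyl_ext T (\<lambda>p. u2 p powr m) q * dird \<psi> (b, 0) q)"
      unfolding z_eq left_diff_distrib
      by (intro Bochner_Integration.integral_diff test_integrable_mult[OF test_dird[OF \<psi>]] u1 u2)
    moreover have "(LINT q|lebesgue. G b q * \<psi> q) =
        (LINT q|lebesgue. cyl_ext T (\<lambda>p. G1 p \<bullet> b) q * \<psi> q) - (LINT q|lebesgue. cyl_ext T (\<lambda>p. G2 p \<bullet> b) q * \<psi> q)"
      unfolding G_def left_diff_distrib by (intro Bochner_Integration.integral_diff j u1 u2)
    ultimately show ?thesis using g1[rule_format, OF b \<psi>] g2[rule_format, OF b \<psi>] by simp
  qed
  have gi: "integrable lebesgue g"
    unfolding g_def using h(1) by (subst Lebesgue_Measure.integrable_restrict_UNIV) (auto simp: Lp_1_iff)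
  have bounds: "AE q in lebesgue. q \<in> ?S \<longrightarrow> 0 \<le> u1 q \<and> u1 q \<le> M1 \<and> 0 \<le> u2 q \<and> u2 q \<le> M2"
    using u1(2) u2(2) by eventually_elim auto
  have wb: "AE q in lebesgue. \<bar>w q\<bar> \<le> M"
    using bounds
  proof eventually_elim
    case (elim q)
    have "0 \<le> M1 powr m" "0 \<le> M2 powr m" by auto
    moreover have "w q = (if q \<in> ?S then u1 q - u2 q else 0)" by (simp add: w_def)
    ultimately show ?case using elim u1(1) u2(1) unfolding M_def by (cases "q \<in> ?S"; simp only: if_True if_False simp_thms; linarith)
  qed
  have zb: "AE q in lebesgue. \<bar>z q\<bar> \<le> M"
    using bounds
  proof eventually_elim
    case (elim q)
    have "u1 q powr m \<le> M1 powr m" "u2 q powr m \<le> M2 powr m" if "q \<in> ?S"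
      using elim that m by (auto intro!: powr_mono2)
    moreover have "0 \<le> u1 q powr m" "0 \<le> u2 q powr m" "0 \<le> M1 powr m" "0 \<le> M2 powr m" by auto
    moreover have "z q = (if q \<in> ?S then u1 q powr m - u2 q powr m else 0)" by (simp add: z_def)
    ultimately show ?case using u1(1) u2(1) unfolding M_def by (cases "q \<in> ?S"; simp only: if_True if_False simp_thms; linarith)
  qed
  have sgn: "AE q in lebesgue. z q > 0 \<longleftrightarrow> w q > 0"
    using bounds
  proof eventually_elim
    case (elim q)
    \<comment> \<open>Both directions come from strict monotonicity of the power on nonnegative
      numbers, which is why the almost everywhere bounds are needed first.\<close>
    have "u1 q powr m > u2 q powr m \<longleftrightarrow> u1 q > u2 q" if "q \<in> ?S"
      using elim that m powr_less_mono2[of m "u2 q" "u1 q"] powr_mono2[of m "u1 q" "u2 q"]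
      by (meson less_le_not_le not_less order_less_trans zero_less_one)
    then show ?case by (simp add: z_def w_def)
  qed
  have \<alpha>: "\<alpha> > 0" using m by (simp add: \<alpha>_def)
  have Qi: "integrable lebesgue Q"
    unfolding Q_def[abs_def]
    by (intro Bochner_Integration.integrable_add integrable_fst_cylinder[where f="\<lambda>x. norm (V x) powr p"]
        integrable_abs wi) (use VL in \<open>simp add: Lp_def\<close>)
  have Q0: "0 \<le> Q q" for q by (simp add: Q_def)
  have FG: "AE q in lebesgue. z q > 0 \<longrightarrow> - (\<Sum>b\<in>Basis. F b q * G b q) \<le> z q powr (1 + \<alpha>) * Q q"
    using bounds sgn
  proof eventually_elim
    case (elim q)
    show ?case
    proof
      assume zq: "z q > 0"
      then have q: "q \<in> ?S" by (auto simp: z_def split: if_splits)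
      then have "- (\<Sum>b\<in>Basis. F b q * G b q) = - (\<Sum>b\<in>Basis. ((G1 q - G2 q) \<bullet> b + (u1 q - u2 q) * (V (fst q) \<bullet> b)) * ((G1 q - G2 q) \<bullet> b))"
        by (simp add: F_def Gc Dc)
      also have "\<dots> \<le> (u1 q powr m - u2 q powr m) powr ((1 + 2 / p) / m) * (norm (V (fst q)) powr p + (u1 q - u2 q))"
        by (rule drift_term_bound) (use elim q zq m p in \<open>auto simp: z_def\<close>)
      \<comment> \<open>Where \<open>z\<close> is positive so is \<open>w\<close>, by
        \<open>sgn\<close>, and the absolute value in \<open>Q\<close> may be dropped.\<close>
      also have "\<dots> = z q powr (1 + \<alpha>) * Q q"
        using elim zq q by (simp add: z_def Q_def w_def \<alpha>_def)
      finally show "- (\<Sum>b\<in>Basis. F b q * G b q) \<le> z q powr (1 + \<alpha>) * Q q" .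
    qed
  qed
  define W where "W t = (LINT x|lebesgue. max (u1 (x, t) - u2 (x, t)) 0)" for t
  note C = C_L1_diff[OF u1(3) u2(3)]
  have Wc: "continuous_on {0..T} W"
    unfolding W_def by (rule C_L1_continuous_on(2)[OF C, of "\<lambda>x a. max a 0" 1]) (auto simp: max_def)
  have weak: "0 \<le> (LINT t|lebesgue. dird \<eta> 1 t * (if t \<in> {0..T} then W t else 0))"
    if \<eta>: "\<eta> \<in> test_functions {0<..<T}" "\<And>t. 0 \<le> \<eta> t" for \<eta>
  proof -
    have "0 \<le> (LINT q|lebesgue. dird \<eta> 1 (snd q) * max (w q) 0)"
      by (rule weak_contraction[OF wi wb zi zb gi Fm F2i Gm G2i wt gF zx sgn FG \<alpha> Qi Q0 \<eta>])
    also have "(LINT q|lebesgue. dird \<eta> 1 (snd q) * max (w q) 0)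
        = (LINT q|lebesgue. cyl_ext T (\<lambda>q. max (u1 q - u2 q) 0) q * dird \<eta> 1 (snd q))"
      by (rule Bochner_Integration.integral_cong) (simp_all add: w_def)
    also have "(LINT q|lebesgue. cyl_ext T (\<lambda>q. max (u1 q - u2 q) 0) q * dird \<eta> 1 (snd q))
        = (LINT t|lebesgue. (if t \<in> {0..T} then LINT x|lebesgue. max (u1 (x, t) - u2 (x, t)) 0 else 0) * dird \<eta> 1 t)"
    proof (rule LINT_cylinder_iterated)
      obtain K where K: "\<And>t. \<bar>dird \<eta> 1 t\<bar> \<le> K" using test_bounded[OF test_dird[OF \<eta>(1)]] by metis
      have "integrable lebesgue (\<lambda>q. max (w q) 0 * dird \<eta> 1 (snd q))"
        by (rule integrable_mult_bounded[where C=K])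
          (use wi K borel_measurable_lebesgue_snd[OF test_borel[OF test_dird[OF \<eta>(1)]]] in auto)
      moreover have "max (w q) 0 = cyl_ext T (\<lambda>q. max (u1 q - u2 q) 0) q" for q by (simp add: w_def)
      ultimately show "integrable lebesgue (\<lambda>q. cyl_ext T (\<lambda>q. max (u1 q - u2 q) 0) q * dird \<eta> 1 (snd q))" by simp
    qed
    finally show ?thesis unfolding W_def by (simp only: mult.commute)
  qed
  \<comment> \<open>Only the difference of the two traces is identified; this suffices because
    \<open>W 0\<close> depends on nothing else.\<close>
  have "AE x in lebesgue. u1 (x, 0) - u2 (x, 0) = u10 x - u20 x"
  proof (rule initial_trace[OF T C, where F=F])
    show "(\<lambda>z. u1 z - u2 z) \<in> borel_measurable (cylinder T)" using u1(4) u2(4) by simp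
    show "integrable lebesgue (\<lambda>x. u10 x - u20 x)" using u1(5) u2(5) by simp
    show "F b q = 0" if "q \<notin> UNIV \<times> {0..T}" for b q using that by (simp add: F_def G_def D_def)
  qed (use Fm F2i E in \<open>simp_all add: w_def\<close>)
  then have "W 0 = (LINT x|lebesgue. max (u10 x - u20 x) 0)"
    unfolding W_def
  proof (intro integral_cong_AE)
    show "(\<lambda>x. max (u1 (x, 0) - u2 (x, 0)) 0) \<in> borel_measurable lebesgue"
      using C_L1_integrable[OF C, of 0] T by (intro borel_measurable_max) auto
    show "(\<lambda>x. max (u10 x - u20 x) 0) \<in> borel_measurable lebesgue"
      using u1(5) u2(5) by (intro borel_measurable_max) auto
  qed auto
  then show ?thesis
    using decreasing_of_weak_derivative[OF Wc T weak] by (simp add: W_def)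
qed

end
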